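(* Let $L>0$, $\beta_1,\dots,\beta_d>0$ be fixed, and let $N_1,\dots,N_{d_y}$ be the numbers of support points of the discrete coordinates (each $N_j=N_{j,n}\ge 2$ may depend on the sample size $n$). Let $$\mathcal{P}=\Big\{p:\ p(y,x)=\int_{A_y} f(\tilde y,x)\,d\tilde y,\ f\in\mathcal{C}^{\beta_1,\dots,\beta_d,L}\cap\mathcal{D}\Big\}$$ and $$\Gamma_n=\min_{J\in\mathcal{A}}\left[\frac{N_J}{n}\right]^{\frac{\beta_{J^c}}{2\beta_{J^c}+1}} .$$ Then $\Gamma_n$ multiplied by a positive constant is a lower bound on the estimation error over $\mathcal{P}$ in the total variation distance; that is, there exist constants $c,c'>0$ not depending on $n$ such that $$\inf_{\hat p}\ \sup_{p\in\mathcal{P}} P_p^n\big(d_{TV}(\hat p,p)\ge c\,\Gamma_n\big)\ \ge\ c'>0 ,$$ where the infimum is over all estimators $\hat p$ based on an i.i.d. sample of size $n$ from $p$ and $P_p^n$ is the law of that sample.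
   Context: Observations are $(y,x)$ with $x\in\mathcal X\subset\mathbb{R}^{d_x}$ continuous and $y=(y_1,\dots,y_{d_y})\in\mathcal{Y}=\prod_{j=1}^{d_y}\mathcal{Y}_j$ discrete, $\mathcal{Y}_j=\{\frac{1-1/2}{N_j},\frac{2-1/2}{N_j},\dots,\frac{N_j-1/2}{N_j}\}$; $d=d_x+d_y$. For $y\in\mathcal{Y}$, $A_y=\prod_{j=1}^{d_y}A_{y_j}$ with $A_{y_j}=(-\infty,y_j+0.5/N_j]$ if $y_j=0.5/N_j$, $A_{y_j}=(y_j-0.5/N_j,\infty)$ if $y_j=1-0.5/N_j$, and $A_{y_j}=(y_j-0.5/N_j,y_j+0.5/N_j]$ otherwise. $\mathcal{D}$ is the set of probability densities on $\mathbb{R}^{d}$ with respect to Lebesgue measure. Anisotropic smoothness: for $\beta_1,\dots,\beta_d>0$ and an envelope $L:\mathbb{R}^{2d}\to\mathbb{R}$, $f\in\mathcal{C}^{\beta_1,\dots,\beta_d,L}$ if for every $k=(k_1,\dots,k_d)\in\mathbb{Z}_+^d$ (non-negative integers) with $\sum_{i=1}^d k_i/\beta_i<1$, the mixed partial derivative $D^kf$ of order $k$ is finite and $$|D^kf(z+\Delta z)-D^kf(z)|\le L(z,\Delta z)\sum_{j=1}^d|\Delta z_j|^{\beta_j(1-\sum_{i=1}^d k_i/\beta_i)}$$ for all $z,\Delta z$ such that $\Delta z_j=0$ whenever $\sum_{i=1}^d k_i/\beta_i+1/\beta_j<1$. Here $L$ is a positive constant (constant envelope). $\mathcal{A}$ is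 the collection of all subsets of $\{1,\dots,d_y\}$ (including $\emptyset$). For $J\in\mathcal{A}$: $J^c=\{1,\dots,d\}\setminus J$, $N_J=\prod_{i\in J}N_i$, $\beta_{J^c}=\big[\sum_{i\in J^c}\beta_i^{-1}\big]^{-1}$, with conventions $N_\emptyset=1$, $\beta_\emptyset=\infty$ and $\beta_\emptyset/(2\beta_\emptyset+1)=1/2$. The total variation distance is $d_{TV}(p,q)=\sum_{y\in\mathcal Y}\int|p(y,x)-q(y,x)|\,dx$. *)

theory Defs
  imports "HOL-Analysis.Analysis"
begin

text \<open>
  Vectors in the Euclidean space with coordinates indexed by a finite set \<open>I\<close> of naturals are the
  elements of \<open>PiE I (\<lambda>_. UNIV)\<close>. Coordinates \<open>1..dy\<close> are the discrete ones and \<open>dy+1..dy+dx\<close> the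
  continuous ones; a vector \<open>(y, x)\<close> of length \<open>d = dy + dx\<close> is \<open>merge {1..dy} {dy+1..dy+dx} (y, x)\<close>.
  This encoding (rather than a type-indexed one) keeps the cases \<open>dx = 0\<close> and \<open>dy = 0\<close> available.
\<close>

type_synonym vec = "nat \<Rightarrow> real"

definition lborel_vec :: "nat set \<Rightarrow> vec measure" where
  "lborel_vec I = PiM I (\<lambda>_. lborel)"

definition vecs :: "nat set \<Rightarrow> vec set" where
  "vecs I = PiE I (\<lambda>_. UNIV)"

definition densities :: "nat \<Rightarrow> (vec \<Rightarrow> real) set" where
  "densities d = {f. f \<in> borel_measurable (lborel_vec {1..d}) \<and> (\<forall>z\<in>vecs {1..d}. 0 \<le> f z) \<and>
     (\<integral>\<^sup>+ z. ennreal (f z) \<partial>lborel_vec {1..d}) = 1}"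


subsection \<open>Anisotropic smoothness\<close>

definition partial_deriv :: "nat \<Rightarrow> (vec \<Rightarrow> real) \<Rightarrow> vec \<Rightarrow> real" where
  "partial_deriv i g = (\<lambda>z. deriv (\<lambda>t. g (z(i := t))) (z i))"

definition partially_differentiable :: "nat \<Rightarrow> nat \<Rightarrow> (vec \<Rightarrow> real) \<Rightarrow> bool" where
  "partially_differentiable d i g \<longleftrightarrow>
     (\<forall>z\<in>vecs {1..d}. (\<lambda>t. g (z(i := t))) field_differentiable at (z i))"

text \<open>
  \<open>D\<^sup>k f = \<partial>\<^sub>1\<^bsup>k 1\<^esup> \<dots> \<partial>\<^sub>d\<^bsup>k d\<^esup> f\<close>, with the innermost (first) differentiations in coordinate \<open>d\<close>.
\<close>

definition mixed_partial :: "nat \<Rightarrow> (nat \<Rightarrow> nat) \<Rightarrow> (vec \<Rightarrow> real) \<Rightarrow> vec \<Rightarrow> real" where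
  "mixed_partial d k f = foldr (\<lambda>i. partial_deriv i ^^ k i) [1..<Suc d] f"

text \<open>
  Since \<^const>\<open>deriv\<close> is total, existence is stated separately: every differentiation performed in
  \<^const>\<open>mixed_partial\<close> must act on a function differentiable in that coordinate. The step that
  follows \<open>m\<close> differentiations in coordinate \<open>i\<close> acts on the mixed partial of order
  \<open>(0, \<dots>, 0, m, k (i+1), \<dots>, k d)\<close>.
\<close>

definition mixed_partial_exists :: "nat \<Rightarrow> (nat \<Rightarrow> nat) \<Rightarrow> (vec \<Rightarrow> real) \<Rightarrow> bool" where
  "mixed_partial_exists d k f \<longleftrightarrow> (\<forall>i\<in>{1..d}. \<forall>m<k i.
     partially_differentiable d i
       (mixed_partial d (\<lambda>l. if l < i then 0 else if l = i then m else k l) f))"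

definition weighted_order :: "nat \<Rightarrow> (nat \<Rightarrow> real) \<Rightarrow> (nat \<Rightarrow> nat) \<Rightarrow> real" where
  "weighted_order d \<beta> k = (\<Sum>i\<in>{1..d}. real (k i) / \<beta> i)"

definition smooth_class ::
    "nat \<Rightarrow> (nat \<Rightarrow> real) \<Rightarrow> (vec \<Rightarrow> vec \<Rightarrow> real) \<Rightarrow> (vec \<Rightarrow> real) set" where
  "smooth_class d \<beta> L = {f. \<forall>k. weighted_order d \<beta> k < 1 \<longrightarrow>
     mixed_partial_exists d k f \<and>
     (\<forall>z\<in>vecs {1..d}. \<forall>u\<in>vecs {1..d}.
        (\<forall>j\<in>{1..d}. weighted_order d \<beta> k + 1 / \<beta> j < 1 \<longrightarrow> u j = 0) \<longrightarrow>
        \<bar>mixed_partial d k f (\<lambda>i\<in>{1..d}. z i + u i) - mixed_partial d k f z\<bar>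
          \<le> L z u * (\<Sum>j\<in>{1..d}. \<bar>u j\<bar> powr (\<beta> j * (1 - weighted_order d \<beta> k))))}"


subsection \<open>Mixed discrete-continuous observations\<close>

definition support_points1 :: "nat \<Rightarrow> real set" where
  "support_points1 M = (\<lambda>k. (real k - 1/2) / real M) ` {1..M}"

definition support_points :: "nat \<Rightarrow> (nat \<Rightarrow> nat) \<Rightarrow> vec set" where
  "support_points dy N = PiE {1..dy} (\<lambda>j. support_points1 (N j))"

definition cell1 :: "nat \<Rightarrow> real \<Rightarrow> real set" where
  "cell1 M v =
     (if v = (1/2) / real M then {.. v + (1/2) / real M}
      else if v = 1 - (1/2) / real M then {v - (1/2) / real M <..}
      else {v - (1/2) / real M <.. v + (1/2) / real M})"

definition cell :: "nat \<Rightarrow> (nat \<Rightarrow> nat) \<Rightarrow> vec \<Rightarrow> vec set" where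
  "cell dy N y = PiE {1..dy} (\<lambda>j. cell1 (N j) (y j))"

text \<open>
  For a density \<open>f\<close> the integral below exists for almost every \<open>x\<close>; on the exceptional null set its
  value is 0 by the convention for the Bochner integral.
\<close>

definition discretize ::
    "nat \<Rightarrow> nat \<Rightarrow> (nat \<Rightarrow> nat) \<Rightarrow> (vec \<Rightarrow> real) \<Rightarrow> vec \<times> vec \<Rightarrow> real" where
  "discretize dy dx N f = (\<lambda>(y, x).
     LINT y':cell dy N y|lborel_vec {1..dy}. f (merge {1..dy} {dy+1..dy+dx} (y', x)))"

definition model ::
    "nat \<Rightarrow> nat \<Rightarrow> (nat \<Rightarrow> real) \<Rightarrow> real \<Rightarrow> (nat \<Rightarrow> nat) \<Rightarrow> (vec \<times> vec \<Rightarrow> real) set" where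
  "model dy dx \<beta> L N = discretize dy dx N `
     (smooth_class (dy + dx) \<beta> (\<lambda>_ _. L) \<inter> densities (dy + dx))"

definition obs_measure :: "nat \<Rightarrow> nat \<Rightarrow> (nat \<Rightarrow> nat) \<Rightarrow> (vec \<times> vec) measure" where
  "obs_measure dy dx N = count_space (support_points dy N) \<Otimes>\<^sub>M lborel_vec {dy+1..dy+dx}"

definition sample_law ::
    "nat \<Rightarrow> nat \<Rightarrow> (nat \<Rightarrow> nat) \<Rightarrow> nat \<Rightarrow> (vec \<times> vec \<Rightarrow> real) \<Rightarrow> (nat \<Rightarrow> vec \<times> vec) measure" where
  "sample_law dy dx N n p =
     PiM {1..n} (\<lambda>_. density (obs_measure dy dx N) (\<lambda>w. ennreal (p w)))"

text \<open>
  An estimator is any real function of the sample and the evaluation point that is jointly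
  measurable, so that the distance to a fixed \<open>p\<close> is measurable in the sample; its values need
  not be densities.
\<close>

definition estimators ::
    "nat \<Rightarrow> nat \<Rightarrow> (nat \<Rightarrow> nat) \<Rightarrow> nat \<Rightarrow> ((nat \<Rightarrow> vec \<times> vec) \<Rightarrow> vec \<times> vec \<Rightarrow> real) set" where
  "estimators dy dx N n = {phat. (\<lambda>(s, w). phat s w) \<in>
     borel_measurable (PiM {1..n} (\<lambda>_. obs_measure dy dx N) \<Otimes>\<^sub>M obs_measure dy dx N)}"

definition tv_dist ::
    "nat \<Rightarrow> nat \<Rightarrow> (nat \<Rightarrow> nat) \<Rightarrow> (vec \<times> vec \<Rightarrow> real) \<Rightarrow> (vec \<times> vec \<Rightarrow> real) \<Rightarrow> ennreal" where
  "tv_dist dy dx N p q =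
     (\<Sum>y\<in>support_points dy N. \<integral>\<^sup>+ x. ennreal \<bar>p (y, x) - q (y, x)\<bar> \<partial>lborel_vec {dy+1..dy+dx})"


subsection \<open>The rate\<close>

definition agg_smoothness :: "(nat \<Rightarrow> real) \<Rightarrow> nat set \<Rightarrow> real" where
  "agg_smoothness \<beta> I = inverse (\<Sum>i\<in>I. inverse (\<beta> i))"

text \<open>The empty case is the limit of \<open>b / (2 * b + 1)\<close> as \<open>b\<close> tends to infinity.\<close>

definition rate_exponent :: "(nat \<Rightarrow> real) \<Rightarrow> nat set \<Rightarrow> real" where
  "rate_exponent \<beta> I =
     (if I = {} then 1/2 else agg_smoothness \<beta> I / (2 * agg_smoothness \<beta> I + 1))"

definition rate :: "nat \<Rightarrow> nat \<Rightarrow> (nat \<Rightarrow> real) \<Rightarrow> (nat \<Rightarrow> nat) \<Rightarrow> nat \<Rightarrow> real" where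
  "rate dy dx \<beta> N n =
     Min ((\<lambda>J. (real (\<Prod>i\<in>J. N i) / real n) powr rate_exponent \<beta> ({1..dy+dx} - J)) ` Pow {1..dy})"

end

theory Submission
  imports Defs
begin

text \<open>
  The bound is a hypercube argument. Around a wide product density \<open>f\<^sub>0\<close> one places, on a grid of
  boxes in the unit cube, small product-type signals \<open>g\<^sub>a\<close> with disjoint supports, and for every set
  \<open>\<omega>\<close> of boxes considers the density \<open>f\<^sub>0 + \<epsilon> \<delta> (\<Sum>a\<in>\<omega>. g\<^sub>a)\<close> with \<open>\<delta>\<close> a small multiple of
  \<open>\<Gamma>\<^sub>n\<close>. An estimator has to decide for every box whether its signal is present. If one signal
  changes the law of the whole sample by a bounded amount only, a fixed proportion of these
  decisions is wrong with probability bounded below, and each wrong decision costs the mass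
  of one signal (\<open>assouad_in_probability\<close>).

  In coordinate \<open>i\<close> a signal is a wave: two adjacent copies of a smooth bump, with opposite signs and of
  width \<open>h\<^sub>i\<close>. It integrates to zero, so that all perturbed functions remain densities. Three demands
  fix \<open>h\<^sub>i\<close>. Anisotropic smoothness allows amplitude \<open>\<delta>\<close> as soon as \<open>h\<^sub>i \<ge> \<delta> powr (1 / \<beta>\<^sub>i)\<close>
  (\<open>holder_jet_separable\<close>). For a discrete coordinate, integration over the cells must not destroy the
  signal; hence \<open>h\<^sub>i\<close> is a multiple of \<open>1 / N\<^sub>i\<close>, so that no cell sees both signs
  (\<open>coordinate_total_abs_observed_wave\<close>). Finally \<open>h\<^sub>i\<close> should be small, as the boxes must be
  numerous. Up to a factor 2 the best choice is \<open>max (1 / N\<^sub>i) (\<delta> powr (1 / \<beta>\<^sub>i))\<close>, without the first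
  entry in a continuous coordinate (\<open>ex_well_placed\<close>).

  A single signal cannot be detected reliably if \<open>n \<delta>\<^sup>2 (\<Prod>i. h\<^sub>i)\<close> is bounded. The product of these widths equals, up to
  constants, \<open>\<delta> powr (\<Sum>i\<in>J\<^sup>c. 1 / \<beta>\<^sub>i) / N\<^sub>J\<close> for the set \<open>J\<close> of those discrete coordinates in which \<open>1 / N\<^sub>i\<close>
  is the larger entry. Since \<open>\<delta>\<close> lies below the minimum \<open>\<Gamma>\<^sub>n\<close>, it lies below the term of this
  particular \<open>J\<close>, and that is precisely the required bound (\<open>sample_size_le_widths\<close>). The minimising
  \<open>J\<close> therefore never has to be identified.

  The total mass of the signals is of order \<open>\<delta>\<close>, because the boxes fill a fixed fraction of the unit cube, whence the
  loss is of order \<open>\<Gamma>\<^sub>n\<close>.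
\<close>

section \<open>Testing two product laws\<close>

lemma sigma_finite_if_mass_1: "emeasure P (space P) = 1 \<Longrightarrow> sigma_finite_measure P"
  by (intro finite_measure.axioms(1) finite_measureI) auto

text \<open>
  Two losses with sum at least 1, \<open>Z0\<close> under \<open>P\<close> and \<open>Z1\<close> under the measure \<open>Q\<close> with likelihood
  ratio \<open>l\<close>, cannot both be small in the mean: a bounded second moment of \<open>l\<close> keeps \<open>Q\<close> from escaping
  to a set of small \<open>P\<close>-mass. Indeed, integrating \<open>l \<le> l Z0 + l Z1\<close> and splitting
  \<open>l Z0 \<le> l\<^sup>2 / (4 C) + C Z0\<close> bounds the two risks jointly from below.
\<close>

lemma two_point_affinity:
  fixes P :: "'a measure" and l :: "'a \<Rightarrow> real" and Z0 Z1 :: "'a \<Rightarrow> ennreal" and C :: real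
  assumes l[measurable]: "l \<in> borel_measurable P" and l0: "\<And>x. 0 \<le> l x"
    and mass: "(\<integral>\<^sup>+x. ennreal (l x) \<partial>P) = 1"
    and second: "(\<integral>\<^sup>+x. ennreal ((l x)\<^sup>2) \<partial>P) \<le> ennreal C" and C: "C \<ge> 1"
    and Z[measurable]: "Z0 \<in> borel_measurable P" "Z1 \<in> borel_measurable P"
    and Z0: "\<And>x. Z0 x \<le> 1" and Z01: "\<And>x. x \<in> space P \<Longrightarrow> 1 \<le> Z0 x + Z1 x"
  shows "ennreal (3/4) \<le> ennreal C * (\<integral>\<^sup>+x. Z0 x \<partial>P) + (\<integral>\<^sup>+x. Z1 x \<partial>density P (\<lambda>x. ennreal (l x)))"
proof -
  have pt: "ennreal (l x) \<le> ennreal (1/(4*C)) * ennreal ((l x)\<^sup>2) + ennreal C * Z0 x + ennreal (l x) * Z1 x"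
    if x: "x \<in> space P" for x
  proof -
    obtain z where z: "Z0 x = ennreal z" "0 \<le> z" "z \<le> 1"
      using Z0[of x] by (cases "Z0 x") (auto simp: top_unique)
    have sq: "l x * z = 2 * (l x / (2 * C)) * z * C" using C by simp
    also have "\<dots> \<le> ((l x / (2*C))\<^sup>2 + z\<^sup>2) * C"
      using C by (intro mult_right_mono sum_squares_bound) auto
    also have "\<dots> = 1/(4*C) * (l x)\<^sup>2 + C * z\<^sup>2"
      using C by (simp add: power2_eq_square field_simps)
    also have "\<dots> \<le> 1/(4*C) * (l x)\<^sup>2 + C * z"
      using z C by (simp add: power2_eq_square mult_left_le)
    finally have "ennreal (l x) * Z0 x \<le> ennreal (1/(4*C)) * ennreal ((l x)\<^sup>2) + ennreal C * Z0 x"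
      using C z l0[of x] by (simp add: ennreal_mult[symmetric] ennreal_plus[symmetric] del: ennreal_plus)
    then have "ennreal (l x) * Z0 x + ennreal (l x) * Z1 x
        \<le> ennreal (1/(4*C)) * ennreal ((l x)\<^sup>2) + ennreal C * Z0 x + ennreal (l x) * Z1 x"
      by (rule add_right_mono)
    moreover have "ennreal (l x) \<le> ennreal (l x) * (Z0 x + Z1 x)"
      using mult_left_mono[OF Z01[OF x], of "ennreal (l x)"] by simp
    moreover have "ennreal (l x) * (Z0 x + Z1 x) = ennreal (l x) * Z0 x + ennreal (l x) * Z1 x"
      by (rule distrib_left)
    ultimately show ?thesis
      by (simp only:)
  qed
  have "1 = (\<integral>\<^sup>+x. ennreal (l x) \<partial>P)" by (simp add: mass)
  also have "\<dots> \<le> (\<integral>\<^sup>+x. ennreal (1/(4*C)) * ennreal ((l x)\<^sup>2) + ennreal C * Z0 x + ennreal (l x) * Z1 x \<partial>P)"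
    by (intro nn_integral_mono pt)
  also have "\<dots> = ennreal (1/(4*C)) * (\<integral>\<^sup>+x. ennreal ((l x)\<^sup>2) \<partial>P) + ennreal C * (\<integral>\<^sup>+x. Z0 x \<partial>P)
      + (\<integral>\<^sup>+x. ennreal (l x) * Z1 x \<partial>P)"
    by (simp add: nn_integral_add nn_integral_cmult)
  also have "\<dots> \<le> ennreal (1/(4*C)) * ennreal C + ennreal C * (\<integral>\<^sup>+x. Z0 x \<partial>P)
      + (\<integral>\<^sup>+x. ennreal (l x) * Z1 x \<partial>P)"
    by (intro add_mono mult_left_mono second) auto
  also have "ennreal (1/(4*C)) * ennreal C = ennreal (1/4)"
    using C by (subst ennreal_mult[symmetric]) auto
  finally have *: "1 \<le> ennreal (1/4) + (ennreal C * (\<integral>\<^sup>+x. Z0 x \<partial>P) + (\<integral>\<^sup>+x. ennreal (l x) * Z1 x \<partial>P))"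
    by (simp add: add.assoc)
  have "ennreal (1/4) + ennreal (3/4) = 1" by (subst ennreal_plus[symmetric]) auto
  then have "ennreal (3/4) \<le> ennreal C * (\<integral>\<^sup>+x. Z0 x \<partial>P) + (\<integral>\<^sup>+x. ennreal (l x) * Z1 x \<partial>P)"
    using * ennreal_add_left_cancel_le[of "ennreal (1/4)" "ennreal (3/4)"
      "ennreal C * (\<integral>\<^sup>+x. Z0 x \<partial>P) + (\<integral>\<^sup>+x. ennreal (l x) * Z1 x \<partial>P)"]
    by (simp only: infinity_ennreal_def ennreal_neq_top simp_thms)
  then show ?thesis by (simp add: nn_integral_density)
qed

lemma PiM_density:
  fixes P :: "'a measure" and l :: "'a \<Rightarrow> ennreal"
  assumes P: "sigma_finite_measure P" and Q: "sigma_finite_measure (density P l)"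
    and l[measurable]: "l \<in> borel_measurable P" and I: "finite I"
  shows "PiM I (\<lambda>_. density P l) = density (PiM I (\<lambda>_. P)) (\<lambda>s. \<Prod>i\<in>I. l (s i))"
proof -
  interpret P: product_sigma_finite "\<lambda>_. P" using P by (simp add: product_sigma_finite_def)
  interpret Q: product_sigma_finite "\<lambda>_. density P l" using Q by (simp add: product_sigma_finite_def)
  show ?thesis
  proof (rule sym, rule Q.PiM_eqI[OF I])
    show "sets (density (PiM I (\<lambda>_. P)) (\<lambda>s. \<Prod>i\<in>I. l (s i))) = sets (PiM I (\<lambda>_. density P l))"
      by (auto intro!: sets_PiM_cong)
  next
    fix A assume "\<And>i. i \<in> I \<Longrightarrow> A i \<in> sets (density P l)"
    then have A[measurable]: "\<And>i. i \<in> I \<Longrightarrow> A i \<in> sets P" by simp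
    have m: "Pi\<^sub>E I A \<in> sets (PiM I (\<lambda>_. P))" using A I by (intro sets_PiM_I_finite)
    have "emeasure (density (PiM I (\<lambda>_. P)) (\<lambda>s. \<Prod>i\<in>I. l (s i))) (Pi\<^sub>E I A)
       = (\<integral>\<^sup>+s. (\<Prod>i\<in>I. l (s i)) * indicator (Pi\<^sub>E I A) s \<partial>PiM I (\<lambda>_. P))"
      by (intro emeasure_density m) measurable
    also have "\<dots> = (\<integral>\<^sup>+s. (\<Prod>i\<in>I. l (s i) * indicator (A i) (s i)) \<partial>PiM I (\<lambda>_. P))"
    proof (rule nn_integral_cong)
      fix s assume s: "s \<in> space (PiM I (\<lambda>_. P))"
      have "indicator (Pi\<^sub>E I A) s = (\<Prod>i\<in>I. indicator (A i) (s i) :: ennreal)"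
      proof (cases "\<forall>i\<in>I. s i \<in> A i")
        case True
        then show ?thesis using s by (auto simp: space_PiM PiE_def)
      next
        case False
        then have "(\<Prod>i\<in>I. indicator (A i) (s i) :: ennreal) = 0"
          using I by (intro prod_zero) (auto simp: indicator_eq_0_iff)
        moreover have "s \<notin> Pi\<^sub>E I A" using False by auto
        ultimately show ?thesis by simp
      qed
      then show "(\<Prod>i\<in>I. l (s i)) * indicator (Pi\<^sub>E I A) s = (\<Prod>i\<in>I. l (s i) * indicator (A i) (s i))"
        by (simp add: prod.distrib)
    qed
    also have "\<dots> = (\<Prod>i\<in>I. \<integral>\<^sup>+x. l x * indicator (A i) x \<partial>P)"
      using I by (intro P.product_nn_integral_prod) measurable
    also have "\<dots> = (\<Prod>i\<in>I. emeasure (density P l) (A i))"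
      using A by (intro prod.cong refl emeasure_density[symmetric]) auto
    finally show "emeasure (density (PiM I (\<lambda>_. P)) (\<lambda>s. \<Prod>i\<in>I. l (s i))) (Pi\<^sub>E I A) =
      (\<Prod>i\<in>I. emeasure (density P l) (A i))" .
  qed
qed

text \<open>
  For samples the second moment of the likelihood ratio is the \<open>n\<close>-th power of the
  one-observation moment, hence at most \<open>exp 1 \<le> 3\<close> if the latter exceeds 1 by at most \<open>1 / n\<close>.
\<close>

lemma two_point_affinity_iid:
  fixes P :: "'a measure" and l :: "'a \<Rightarrow> real" and Z0 Z1 :: "(nat \<Rightarrow> 'a) \<Rightarrow> ennreal" and x :: real
  assumes P: "emeasure P (space P) = 1"
    and l[measurable]: "l \<in> borel_measurable P" and l0: "\<And>x. 0 \<le> l x"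
    and mass: "(\<integral>\<^sup>+x. ennreal (l x) \<partial>P) = 1"
    and second: "(\<integral>\<^sup>+x. ennreal ((l x)\<^sup>2) \<partial>P) \<le> ennreal (1 + x)" and x: "x \<ge> 0" "real n * x \<le> 1"
    and Z[measurable]: "Z0 \<in> borel_measurable (PiM {1..n} (\<lambda>_. P))" "Z1 \<in> borel_measurable (PiM {1..n} (\<lambda>_. P))"
    and Z0: "\<And>x. Z0 x \<le> 1" and Z01: "\<And>x. x \<in> space (PiM {1..n} (\<lambda>_. P)) \<Longrightarrow> 1 \<le> Z0 x + Z1 x"
  shows "ennreal (1/4) \<le> (\<integral>\<^sup>+s. Z0 s \<partial>PiM {1..n} (\<lambda>_. P))
     + (\<integral>\<^sup>+s. Z1 s \<partial>PiM {1..n} (\<lambda>_. density P (\<lambda>x. ennreal (l x))))"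
proof -
  have sP: "sigma_finite_measure P"
    using P by (rule sigma_finite_if_mass_1)
  have "emeasure (density P (\<lambda>x. ennreal (l x))) (space P) = 1"
    by (subst emeasure_density) (auto simp: mass[symmetric] intro!: nn_integral_cong)
  then have sQ: "sigma_finite_measure (density P (\<lambda>x. ennreal (l x)))"
    by (intro sigma_finite_if_mass_1) simp
  interpret P: product_sigma_finite "\<lambda>_. P" using sP by (simp add: product_sigma_finite_def)
  let ?PP = "PiM {1..n} (\<lambda>_. P)"
  let ?l = "\<lambda>s. \<Prod>i\<in>{1..n}. l (s i)"
  have eq: "PiM {1..n} (\<lambda>_. density P (\<lambda>x. ennreal (l x))) = density ?PP (\<lambda>s. ennreal (?l s))"
    by (subst PiM_density[OF sP sQ]) (auto simp: prod_ennreal l0)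
  have e3: "(1 + x) ^ n \<le> 3"
  proof -
    have "(1 + x) ^ n \<le> exp x ^ n"
      using x by (intro power_mono) auto
    also have "\<dots> = exp (real n * x)" by (simp add: exp_of_nat_mult)
    also have "\<dots> \<le> exp 1" using x by simp
    also have "\<dots> \<le> 3" by (rule exp_le)
    finally show ?thesis .
  qed
  have "ennreal (3/4) \<le> ennreal 3 * (\<integral>\<^sup>+s. Z0 s \<partial>?PP) + (\<integral>\<^sup>+s. Z1 s \<partial>density ?PP (\<lambda>s. ennreal (?l s)))"
  proof (rule two_point_affinity)
    have "(\<integral>\<^sup>+s. ennreal (?l s) \<partial>?PP) = (\<integral>\<^sup>+s. (\<Prod>i\<in>{1..n}. ennreal (l (s i))) \<partial>?PP)"
      by (simp add: prod_ennreal l0)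
    also have "\<dots> = (\<Prod>i\<in>{1..n}. \<integral>\<^sup>+x. ennreal (l x) \<partial>P)"
      by (rule P.product_nn_integral_prod) auto
    finally show "(\<integral>\<^sup>+s. ennreal (?l s) \<partial>?PP) = 1" by (simp add: mass)
    have "(\<integral>\<^sup>+s. ennreal ((?l s)\<^sup>2) \<partial>?PP) = (\<integral>\<^sup>+s. (\<Prod>i\<in>{1..n}. ennreal ((l (s i))\<^sup>2)) \<partial>?PP)"
      by (simp add: prod_ennreal l0 prod_power_distrib)
    also have "\<dots> = (\<Prod>i\<in>{1..n}. \<integral>\<^sup>+x. ennreal ((l x)\<^sup>2) \<partial>P)"
      by (rule P.product_nn_integral_prod) auto
    also have "\<dots> \<le> ennreal (1 + x) ^ n"
      using power_mono[OF second, of n] by simp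
    also have "\<dots> \<le> ennreal 3"
      using x ennreal_leI[OF e3] by (simp add: ennreal_power del: ennreal_plus)
    finally show "(\<integral>\<^sup>+s. ennreal ((?l s)\<^sup>2) \<partial>?PP) \<le> ennreal 3" .
  qed (use l0 Z0 Z01 Z in \<open>auto intro!: prod_nonneg\<close>)
  also have "\<dots> \<le> ennreal 3 * ((\<integral>\<^sup>+s. Z0 s \<partial>?PP) + (\<integral>\<^sup>+s. Z1 s \<partial>density ?PP (\<lambda>s. ennreal (?l s))))"
    unfolding distrib_left
    using mult_right_mono[of 1 "ennreal 3" "\<integral>\<^sup>+s. Z1 s \<partial>density ?PP (\<lambda>s. ennreal (?l s))"]
    by (intro add_left_mono) simp
  finally have "ennreal (1/3) * ennreal (3/4) \<le> ennreal (1/3) * (ennreal 3 * ((\<integral>\<^sup>+s. Z0 s \<partial>?PP) + (\<integral>\<^sup>+s. Z1 s \<partial>density ?PP (\<lambda>s. ennreal (?l s)))))"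
    by (rule mult_left_mono) auto
  moreover have "ennreal (1/3) * ennreal (3/4) = ennreal (1/4)" "ennreal (1/3) * ennreal 3 = 1"
    by (subst ennreal_mult[symmetric]; simp)+
  ultimately show ?thesis unfolding eq by (simp only: mult.assoc[symmetric] mult_1_left)
qed

section \<open>Assouad's argument in probability\<close>

text \<open>
  Pairing each \<open>\<omega>\<close> with \<open>insert b \<omega>\<close>, the two-point bound shows that the losses truncated at
  the mass \<open>\<sigma>\<close> of one signal have, on average over \<open>\<omega>\<close>, expectation at least \<open>\<sigma> / 8\<close> in every
  box \<open>b\<close>. Some \<open>\<omega>\<close> reaches this average for the sum over all boxes. Truncation
  bounds that sum by \<open>card B * \<sigma>\<close>, and so a lower bound on its expectation turns into a lower bound on
  a probability.
\<close>

lemma assouad_in_probability: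
  fixes M :: "'a measure" and B :: "'b set" and p0 :: "'a \<Rightarrow> real" and g :: "'b \<Rightarrow> 'a \<Rightarrow> real"
    and \<kappa> \<sigma> \<theta> :: real and n :: nat and phat :: "(nat \<Rightarrow> 'a) \<Rightarrow> 'a \<Rightarrow> real"
  defines "p \<equiv> \<lambda>\<omega> w. p0 w + (\<Sum>b\<in>\<omega>. g b w)"
  assumes M: "sigma_finite_measure M" and B: "finite B" "B \<noteq> {}"
    and p0: "integrable M p0" "(LINT w|M. p0 w) = 1" "\<And>w. 0 \<le> p0 w"
    and g: "\<And>b. b \<in> B \<Longrightarrow> integrable M (g b)" "\<And>b. b \<in> B \<Longrightarrow> (LINT w|M. g b w) = 0"
      "\<And>b. b \<in> B \<Longrightarrow> (LINT w|M. \<bar>g b w\<bar>) = \<sigma>"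
    and sum_dom: "\<And>w. (\<Sum>b\<in>B. \<bar>g b w\<bar>) \<le> \<kappa> * p0 w"
    and disj: "\<And>b b' w. w \<in> space M \<Longrightarrow> b \<in> B \<Longrightarrow> b' \<in> B \<Longrightarrow> g b w \<noteq> 0 \<Longrightarrow> g b' w \<noteq> 0 \<Longrightarrow> b = b'"
    and \<kappa>: "0 \<le> \<kappa>" "\<kappa> \<le> 1/2" and \<sigma>: "\<sigma> > 0" and small: "real n * (2 * \<kappa> * \<sigma>) \<le> 1"
    and \<theta>: "\<theta> \<le> real (card B) * \<sigma> / 16"
    and phat: "(\<lambda>(s, w). phat s w) \<in> borel_measurable (PiM {1..n} (\<lambda>_. M) \<Otimes>\<^sub>M M)"
  shows "\<exists>\<omega>\<subseteq>B. ennreal (1/16) \<le> emeasure (PiM {1..n} (\<lambda>_. density M (\<lambda>w. ennreal (p \<omega> w))))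
     {s \<in> space (PiM {1..n} (\<lambda>_. density M (\<lambda>w. ennreal (p \<omega> w)))).
        ennreal \<theta> \<le> (\<integral>\<^sup>+w. ennreal \<bar>phat s w - p \<omega> w\<bar> \<partial>M)}"
proof -
  interpret M: sigma_finite_measure M by fact
  let ?MM = "PiM {1..n} (\<lambda>_. M)"
  define P where "P \<omega> = density M (\<lambda>w. ennreal (p \<omega> w))" for \<omega>
  define PP where "PP \<omega> = PiM {1..n} (\<lambda>_. P \<omega>)" for \<omega>
  have setsPP: "sets (PP \<omega>) = sets ?MM" for \<omega>
    unfolding PP_def P_def by (intro sets_PiM_cong) auto
  have spacePP: "space (PP \<omega>) = space ?MM" for \<omega>
    using setsPP by (rule sets_eq_imp_space_eq)
  have p0m[measurable]: "p0 \<in> borel_measurable M" using p0(1) by (rule borel_measurable_integrable)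
  have gm[measurable]: "b \<in> B \<Longrightarrow> g b \<in> borel_measurable M" for b using g(1) by (intro borel_measurable_integrable)
  have fin: "finite \<omega>" if "\<omega> \<subseteq> B" for \<omega> using that B finite_subset by blast
  have pm: "p \<omega> \<in> borel_measurable M" if "\<omega> \<subseteq> B" for \<omega>
    unfolding p_def by (intro borel_measurable_add borel_measurable_sum p0m gm) (use that in blast)
  have on_supp: "p \<omega> w = p0 w + (if b \<in> \<omega> then g b w else 0)" if "w \<in> space M" "\<omega> \<subseteq> B" "b \<in> B" "g b w \<noteq> 0" for \<omega> b w
  proof -
    have "(\<Sum>b'\<in>\<omega>. g b' w) = (\<Sum>b'\<in>\<omega>. if b' = b then g b w else 0)"
      using that disj by (intro sum.cong refl) (metis subsetD)
    then show ?thesis using fin[OF that(2)] by (simp add: p_def)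
  qed
  have p_lower: "p0 w \<le> 2 * p \<omega> w" if "\<omega> \<subseteq> B" for \<omega> w
  proof -
    have "\<bar>\<Sum>b\<in>\<omega>. g b w\<bar> \<le> (\<Sum>b\<in>\<omega>. \<bar>g b w\<bar>)" by (rule sum_abs)
    also have "\<dots> \<le> (\<Sum>b\<in>B. \<bar>g b w\<bar>)" using that B by (intro sum_mono2) auto
    also have "\<dots> \<le> 1/2 * p0 w"
      using sum_dom[of w] mult_right_mono[OF \<kappa>(2) p0(3)[of w]] by linarith
    finally have "- (\<Sum>b\<in>\<omega>. g b w) \<le> 1/2 * p0 w" by (rule abs_le_D2)
    then show ?thesis by (simp add: p_def)
  qed
  have dom: "\<bar>g b w\<bar> \<le> \<kappa> * p0 w" if "b \<in> B" for b w
    using order_trans[OF member_le_sum[of b B "\<lambda>b. \<bar>g b w\<bar>"] sum_dom[of w]] that B by simp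
  have p_nonneg: "0 \<le> p \<omega> w" if "\<omega> \<subseteq> B" for \<omega> w
    using p_lower[OF that, of w] p0(3)[of w] by linarith
  have p_int: "integrable M (p \<omega>)" "(LINT w|M. p \<omega> w) = 1" if "\<omega> \<subseteq> B" for \<omega>
    unfolding p_def using that p0 g by (auto simp: subset_iff)
  have mass: "(\<integral>\<^sup>+w. ennreal (p \<omega> w) \<partial>M) = 1" if "\<omega> \<subseteq> B" for \<omega>
    using p_int[OF that] p_nonneg[OF that] by (subst nn_integral_eq_integral) auto
  have P1: "emeasure (P \<omega>) (space (P \<omega>)) = 1" if "\<omega> \<subseteq> B" for \<omega>
    using pm[OF that] mass[OF that] unfolding P_def
    by (simp add: emeasure_density cong: nn_integral_cong)
  \<comment> \<open>the loss on the support of signal \<open>b\<close> if the truth contains (\<open>v\<close>) or lacks (\<open>\<not> v\<close>) this signal\<close>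
  define D where "D b v s = (\<integral>\<^sup>+w. ennreal \<bar>phat s w - (p0 w + (if v then g b w else 0))\<bar>
      * indicator {w. g b w \<noteq> 0} w \<partial>M)" for b v s
  define Z where "Z b v s = min 1 (D b v s / ennreal \<sigma>)" for b v s
  have phat2[measurable]: "(\<lambda>x. phat (fst x) (snd x)) \<in> borel_measurable (?MM \<Otimes>\<^sub>M M)"
    using phat by (simp add: case_prod_unfold)
  have Dm: "D b v \<in> borel_measurable ?MM" if b[measurable]: "b \<in> B" for b v
  proof -
    have [measurable]: "{w \<in> space M. g b w \<noteq> 0} \<in> sets M" by measurable
    have "D b v = (\<lambda>s. \<integral>\<^sup>+w. ennreal \<bar>phat s w - (p0 w + (if v then g b w else 0))\<bar>
      * indicator {w \<in> space M. g b w \<noteq> 0} w \<partial>M)"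
      unfolding D_def by (intro ext nn_integral_cong) (auto simp: indicator_def)
    also have "\<dots> \<in> borel_measurable ?MM"
      by (intro M.borel_measurable_nn_integral, unfold case_prod_unfold, measurable)
    finally show ?thesis .
  qed
  have Zm[measurable]: "Z b v \<in> borel_measurable ?MM" if "b \<in> B" for b v
    using Dm[OF that] unfolding Z_def by measurable
  have phs: "phat s \<in> borel_measurable M" if "s \<in> space ?MM" for s
    using measurable_compose[OF measurable_Pair1'[OF that] phat] by simp
  have D2: "ennreal \<sigma> \<le> D b False s + D b True s" if b: "b \<in> B" and s: "s \<in> space ?MM" for b s
  proof -
    have [measurable]: "phat s \<in> borel_measurable M" "g b \<in> borel_measurable M"
      "{w \<in> space M. g b w \<noteq> 0} \<in> sets M"
      using phs[OF s] gm[OF b] by measurable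
    have eq: "D b v s = (\<integral>\<^sup>+w. ennreal \<bar>phat s w - (p0 w + (if v then g b w else 0))\<bar>
      * indicator {w \<in> space M. g b w \<noteq> 0} w \<partial>M)" for v
      unfolding D_def by (intro nn_integral_cong) (auto simp: indicator_def)
    have "ennreal \<sigma> = (\<integral>\<^sup>+w. ennreal \<bar>g b w\<bar> \<partial>M)"
      using g[OF b] by (subst nn_integral_eq_integral) auto
    also have "\<dots> \<le> (\<integral>\<^sup>+w. ennreal \<bar>phat s w - (p0 w + (if False then g b w else 0))\<bar>
        * indicator {w \<in> space M. g b w \<noteq> 0} w
        + ennreal \<bar>phat s w - (p0 w + (if True then g b w else 0))\<bar>
        * indicator {w \<in> space M. g b w \<noteq> 0} w \<partial>M)"
      by (intro nn_integral_mono)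
         (auto simp: indicator_def ennreal_plus[symmetric] simp del: ennreal_plus intro!: ennreal_leI)
    also have "\<dots> = D b False s + D b True s"
      unfolding eq by (intro nn_integral_add) measurable
    finally show ?thesis .
  qed
  have Z2: "1 \<le> Z b False s + Z b True s" if b: "b \<in> B" and s: "s \<in> space ?MM" for b s
  proof -
    have "1 = ennreal \<sigma> / ennreal \<sigma>" using \<sigma> by (simp add: ennreal_divide_self)
    also have "\<dots> \<le> (D b False s + D b True s) / ennreal \<sigma>"
      using D2[OF b s] by (rule divide_right_mono_ennreal)
    also have "\<dots> = D b False s / ennreal \<sigma> + D b True s / ennreal \<sigma>"
      by (rule add_divide_distrib_ennreal)
    finally show ?thesis unfolding Z_def min_def by (auto intro: order_trans add_increasing add_increasing2)
  qed
  have pair: "ennreal (1/4) \<le> (\<integral>\<^sup>+s. Z b False s \<partial>PP \<omega>) + (\<integral>\<^sup>+s. Z b True s \<partial>PP (insert b \<omega>))"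
    if b: "b \<in> B" and \<omega>: "\<omega> \<subseteq> B - {b}" for b \<omega>
  proof -
    \<comment> \<open>where \<open>p \<omega>\<close> vanishes so does \<open>g b\<close>, and any value of the ratio will do there\<close>
    define l where "l w = (if p \<omega> w = 0 then 1 else p (insert b \<omega>) w / p \<omega> w)" for w
    have \<omega>B: "\<omega> \<subseteq> B" "insert b \<omega> \<subseteq> B" "b \<notin> \<omega>" using b \<omega> by auto
    note [measurable] = pm[OF \<omega>B(1)] pm[OF \<omega>B(2)] gm[OF b]
    have step: "p (insert b \<omega>) w = p \<omega> w + g b w" for w
      using \<omega>B fin[OF \<omega>B(1)] by (simp add: p_def)
    have zero: "g b w = 0" if "p \<omega> w = 0" for w
      using that p_lower[OF \<omega>B(1), of w] p0(3)[of w] dom[OF b, of w] by auto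
    have lm[measurable]: "l \<in> borel_measurable M" unfolding l_def by measurable
    have l0: "0 \<le> l w" for w
      using p_nonneg[OF \<omega>B(1), of w] p_nonneg[OF \<omega>B(2), of w] by (auto simp: l_def)
    have pl: "p \<omega> w * l w = p (insert b \<omega>) w" for w
      using zero[of w] by (auto simp: l_def step)
    have dens: "density (P \<omega>) (\<lambda>w. ennreal (l w)) = P (insert b \<omega>)"
      unfolding P_def using p_nonneg[OF \<omega>B(1)] l0
      by (subst density_density_eq) (auto simp: ennreal_mult[symmetric] pl)
    have second: "(\<integral>\<^sup>+w. ennreal ((l w)\<^sup>2) \<partial>P \<omega>) \<le> ennreal (1 + 2 * \<kappa> * \<sigma>)"
    proof -
      have pt: "p \<omega> w * (l w)\<^sup>2 \<le> p \<omega> w + 2 * g b w + 2 * \<kappa> * \<bar>g b w\<bar>" for w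
      proof (cases "p \<omega> w = 0")
        case True
        then show ?thesis using zero[of w] by simp
      next
        case False
        then have pos: "p \<omega> w > 0" using p_nonneg[OF \<omega>B(1), of w] by simp
        have "(g b w)\<^sup>2 \<le> \<bar>g b w\<bar> * (\<kappa> * p0 w)"
          using mult_left_mono[OF dom[OF b, of w], of "\<bar>g b w\<bar>"] by (simp add: power2_eq_square)
        also have "\<dots> \<le> \<bar>g b w\<bar> * (\<kappa> * (2 * p \<omega> w))"
          using p_lower[OF \<omega>B(1)] \<kappa> by (intro mult_left_mono) auto
        finally have "(g b w)\<^sup>2 / p \<omega> w \<le> 2 * \<kappa> * \<bar>g b w\<bar>"
          using pos by (simp add: field_simps)
        moreover have "p \<omega> w * (l w)\<^sup>2 = p \<omega> w + 2 * g b w + (g b w)\<^sup>2 / p \<omega> w"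
          using pos by (simp add: l_def step power2_eq_square field_simps)
        ultimately show ?thesis by simp
      qed
      have "(\<integral>\<^sup>+w. ennreal ((l w)\<^sup>2) \<partial>P \<omega>) = (\<integral>\<^sup>+w. ennreal (p \<omega> w * (l w)\<^sup>2) \<partial>M)"
        unfolding P_def using p_nonneg[OF \<omega>B(1)] by (subst nn_integral_density) (auto simp: ennreal_mult)
      also have "\<dots> \<le> (\<integral>\<^sup>+w. ennreal (p \<omega> w + 2 * g b w + 2 * \<kappa> * \<bar>g b w\<bar>) \<partial>M)"
        by (intro nn_integral_mono ennreal_leI pt)
      also have "\<dots> = ennreal (LINT w|M. p \<omega> w + 2 * g b w + 2 * \<kappa> * \<bar>g b w\<bar>)"
      proof (rule nn_integral_eq_integral)
        show "AE w in M. 0 \<le> p \<omega> w + 2 * g b w + 2 * \<kappa> * \<bar>g b w\<bar>"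
          using p_nonneg[OF \<omega>B(1)] by (intro AE_I2 order_trans[OF _ pt]) simp
      qed (use p_int[OF \<omega>B(1)] g[OF b] in auto)
      also have "(LINT w|M. p \<omega> w + 2 * g b w + 2 * \<kappa> * \<bar>g b w\<bar>) = 1 + 2 * \<kappa> * \<sigma>"
        using p_int[OF \<omega>B(1)] g[OF b] by simp
      finally show ?thesis .
    qed
    have PPM: "borel_measurable (PiM {1..n} (\<lambda>_. P \<omega>)) = borel_measurable ?MM"
      using setsPP[of \<omega>] unfolding PP_def by (intro measurable_cong_sets) auto
    have "ennreal (1/4) \<le> (\<integral>\<^sup>+s. Z b False s \<partial>PiM {1..n} (\<lambda>_. P \<omega>))
       + (\<integral>\<^sup>+s. Z b True s \<partial>PiM {1..n} (\<lambda>_. density (P \<omega>) (\<lambda>w. ennreal (l w))))"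
    proof (rule two_point_affinity_iid)
      show "emeasure (P \<omega>) (space (P \<omega>)) = 1" by (rule P1[OF \<omega>B(1)])
      show "l \<in> borel_measurable (P \<omega>)" unfolding P_def by simp
      have "(\<integral>\<^sup>+w. ennreal (l w) \<partial>P \<omega>) = (\<integral>\<^sup>+w. ennreal (p (insert b \<omega>) w) \<partial>M)"
        unfolding P_def using p_nonneg[OF \<omega>B(1)]
        by (subst nn_integral_density) (auto simp: ennreal_mult[symmetric] l0 pl)
      then show "(\<integral>\<^sup>+w. ennreal (l w) \<partial>P \<omega>) = 1" using mass[OF \<omega>B(2)] by simp
      show "Z b False \<in> borel_measurable (PiM {1..n} (\<lambda>_. P \<omega>))"
        "Z b True \<in> borel_measurable (PiM {1..n} (\<lambda>_. P \<omega>))"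
        unfolding PPM by (rule Zm[OF b])+
      show "1 \<le> Z b False s + Z b True s" if "s \<in> space (PiM {1..n} (\<lambda>_. P \<omega>))" for s
        using Z2[OF b] that spacePP[of \<omega>] by (simp add: PP_def)
    qed (use second l0 small \<kappa> \<sigma> in \<open>auto simp: Z_def\<close>)
    then show ?thesis by (simp add: PP_def dens)
  qed
  let ?N = "card B"
  have N: "?N > 0" using B by (simp add: card_gt_0_iff)
  have total: "of_nat ?N * (2 ^ (?N - 1) * ennreal (1/4)) \<le> (\<Sum>\<omega>\<in>Pow B. \<Sum>b\<in>B. \<integral>\<^sup>+s. Z b (b \<in> \<omega>) s \<partial>PP \<omega>)"
  proof -
    have "2 ^ (?N - 1) * ennreal (1/4) \<le> (\<Sum>\<omega>\<in>Pow B. \<integral>\<^sup>+s. Z b (b \<in> \<omega>) s \<partial>PP \<omega>)" if b: "b \<in> B" for b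
    proof -
      have PB: "Pow B = Pow (B - {b}) \<union> insert b ` Pow (B - {b})"
        using Pow_insert[of b "B - {b}"] b by (simp add: insert_absorb)
      have inj: "inj_on (insert b) (Pow (B - {b}))"
        by (intro inj_onI) (metis Diff_insert_absorb PowD insert_absorb subset_Diff_insert)
      have "2 ^ (?N - 1) * ennreal (1/4) = (\<Sum>\<omega>\<in>Pow (B - {b}). ennreal (1/4))"
        using b B by (simp add: card_Pow)
      also have "\<dots> \<le> (\<Sum>\<omega>\<in>Pow (B - {b}). (\<integral>\<^sup>+s. Z b False s \<partial>PP \<omega>) + (\<integral>\<^sup>+s. Z b True s \<partial>PP (insert b \<omega>)))"
        by (intro sum_mono pair[OF b]) auto
      also have "\<dots> = (\<Sum>\<omega>\<in>Pow (B - {b}). \<integral>\<^sup>+s. Z b (b \<in> \<omega>) s \<partial>PP \<omega>)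
          + (\<Sum>\<omega>\<in>Pow (B - {b}). \<integral>\<^sup>+s. Z b (b \<in> insert b \<omega>) s \<partial>PP (insert b \<omega>))"
      proof -
        have "(\<integral>\<^sup>+s. Z b (b \<in> \<omega>) s \<partial>PP \<omega>) = (\<integral>\<^sup>+s. Z b False s \<partial>PP \<omega>)" if "\<omega> \<in> Pow (B - {b})" for \<omega>
        proof -
          have "b \<notin> \<omega>" using that by blast
          then show ?thesis by simp
        qed
        then show ?thesis by (simp add: sum.distrib)
      qed
      also have "(\<Sum>\<omega>\<in>Pow (B - {b}). \<integral>\<^sup>+s. Z b (b \<in> insert b \<omega>) s \<partial>PP (insert b \<omega>))
         = (\<Sum>\<omega>\<in>insert b ` Pow (B - {b}). \<integral>\<^sup>+s. Z b (b \<in> \<omega>) s \<partial>PP \<omega>)"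
        by (subst sum.reindex[OF inj]) simp
      also have "(\<Sum>\<omega>\<in>Pow (B - {b}). \<integral>\<^sup>+s. Z b (b \<in> \<omega>) s \<partial>PP \<omega>) + \<dots>
         = (\<Sum>\<omega>\<in>Pow B. \<integral>\<^sup>+s. Z b (b \<in> \<omega>) s \<partial>PP \<omega>)"
        unfolding PB using B by (subst sum.union_disjoint) auto
      finally show ?thesis .
    qed
    then have "(\<Sum>b\<in>B. 2 ^ (?N - 1) * ennreal (1/4)) \<le> (\<Sum>b\<in>B. \<Sum>\<omega>\<in>Pow B. \<integral>\<^sup>+s. Z b (b \<in> \<omega>) s \<partial>PP \<omega>)"
      by (intro sum_mono) auto
    then show ?thesis by (subst sum.swap) simp
  qed
  have "\<exists>\<omega>\<in>Pow B. ennreal (?N / 8) \<le> (\<Sum>b\<in>B. \<integral>\<^sup>+s. Z b (b \<in> \<omega>) s \<partial>PP \<omega>)"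
  proof (rule ccontr)
    assume "\<not> ?thesis"
    then have lt: "(\<Sum>b\<in>B. \<integral>\<^sup>+s. Z b (b \<in> \<omega>) s \<partial>PP \<omega>) < ennreal (?N / 8)" if "\<omega> \<in> Pow B" for \<omega>
      using that by (auto simp: not_le)
    have "\<exists>r. (\<Sum>b\<in>B. \<integral>\<^sup>+s. Z b (b \<in> \<omega>) s \<partial>PP \<omega>) = ennreal r \<and> 0 \<le> r \<and> r < ?N / 8" if "\<omega> \<in> Pow B" for \<omega>
      using lt[OF that] by (cases "(\<Sum>b\<in>B. \<integral>\<^sup>+s. Z b (b \<in> \<omega>) s \<partial>PP \<omega>)") (auto simp: ennreal_less_iff)
    then obtain r where r: "\<And>\<omega>. \<omega> \<in> Pow B \<Longrightarrow> (\<Sum>b\<in>B. \<integral>\<^sup>+s. Z b (b \<in> \<omega>) s \<partial>PP \<omega>) = ennreal (r \<omega>)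
        \<and> 0 \<le> r \<omega> \<and> r \<omega> < ?N / 8"
      by metis
    have "(\<Sum>\<omega>\<in>Pow B. r \<omega>) < (\<Sum>\<omega>\<in>Pow B. ?N / 8)"
      using r B by (intro sum_strict_mono) auto
    also have "\<dots> = ?N * (2 ^ (?N - 1) * (1/4))"
    proof -
      have "(2::real) ^ ?N = 2 * 2 ^ (?N - 1)" using N by (metis Suc_pred' power_Suc)
      then show ?thesis using B by (simp add: card_Pow)
    qed
    finally have "(\<Sum>\<omega>\<in>Pow B. r \<omega>) < ?N * (2 ^ (?N - 1) * (1/4))" .
    moreover have "ennreal (?N * (2 ^ (?N - 1) * (1/4))) \<le> ennreal (\<Sum>\<omega>\<in>Pow B. r \<omega>)"
    proof -
      have "ennreal (?N * (2 ^ (?N - 1) * (1/4))) = of_nat ?N * (2 ^ (?N - 1) * ennreal (1/4))"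
      proof -
        have "ennreal (2 ^ (?N - 1)) = 2 ^ (?N - 1)" using ennreal_power[of 2 "?N - 1"] by simp
        moreover have "ennreal (?N * (2 ^ (?N - 1) * (1/4)))
            = ennreal (real ?N) * (ennreal (2 ^ (?N - 1)) * ennreal (1/4))"
          by (simp only: ennreal_mult[symmetric] of_nat_0_le_iff zero_le_power zero_le_numeral mult_nonneg_nonneg
            zero_le_divide_1_iff)
        ultimately show ?thesis by (simp add: ennreal_of_nat_eq_real_of_nat)
      qed
      also note total
      also have "(\<Sum>\<omega>\<in>Pow B. \<Sum>b\<in>B. \<integral>\<^sup>+s. Z b (b \<in> \<omega>) s \<partial>PP \<omega>) = (\<Sum>\<omega>\<in>Pow B. ennreal (r \<omega>))"
        using r by (intro sum.cong) auto
      also have "\<dots> = ennreal (\<Sum>\<omega>\<in>Pow B. r \<omega>)" using r by (subst sum_ennreal) auto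
      finally show ?thesis .
    qed
    moreover have "0 \<le> (\<Sum>\<omega>\<in>Pow B. r \<omega>)" using r by (intro sum_nonneg) auto
    ultimately show False by (auto simp: ennreal_le_iff)
  qed
  then obtain \<omega> where \<omega>: "\<omega> \<subseteq> B" and large: "ennreal (?N / 8) \<le> (\<Sum>b\<in>B. \<integral>\<^sup>+s. Z b (b \<in> \<omega>) s \<partial>PP \<omega>)"
    by auto
  note [measurable] = pm[OF \<omega>]
  have Zm': "Z b v \<in> borel_measurable (PP \<omega>)" if "b \<in> B" for b v
    using Zm[OF that] setsPP[of \<omega>] measurable_cong_sets by blast
  define X where "X s = (\<Sum>b\<in>B. Z b (b \<in> \<omega>) s)" for s
  have Xm[measurable]: "X \<in> borel_measurable (PP \<omega>)" unfolding X_def using Zm' by measurable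
  have X_le: "X s \<le> ennreal ?N" for s
  proof -
    have "X s \<le> (\<Sum>b\<in>B. 1)" unfolding X_def by (intro sum_mono) (simp add: Z_def)
    then show ?thesis by (simp add: ennreal_of_nat_eq_real_of_nat)
  qed
  have EX: "ennreal (?N / 8) \<le> (\<integral>\<^sup>+s. X s \<partial>PP \<omega>)"
    using large Zm' unfolding X_def by (subst nn_integral_sum) auto
  have PP1: "emeasure (PP \<omega>) (space (PP \<omega>)) = 1"
  proof -
    interpret product_sigma_finite "\<lambda>_. P \<omega>"
      using sigma_finite_if_mass_1[OF P1[OF \<omega>]] by (simp add: product_sigma_finite_def)
    show ?thesis unfolding PP_def space_PiM by (subst emeasure_PiM) (auto simp: P1[OF \<omega>])
  qed
  \<comment> \<open>\<open>X\<close> is bounded by \<open>?N\<close> and has mean at least \<open>?N / 8\<close>, hence reaches \<open>?N / 16\<close> with probability at least \<open>1/16\<close>\<close>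
  define A where "A = {s \<in> space (PP \<omega>). ennreal (?N / 16) \<le> X s}"
  have A[measurable]: "A \<in> sets (PP \<omega>)" unfolding A_def by measurable
  have "(\<integral>\<^sup>+s. X s \<partial>PP \<omega>) \<le> (\<integral>\<^sup>+s. ennreal ?N * indicator A s + ennreal (?N / 16) \<partial>PP \<omega>)"
    using X_le by (intro nn_integral_mono) (auto simp: A_def indicator_def not_le intro: add_increasing2)
  also have "\<dots> = ennreal ?N * emeasure (PP \<omega>) A + ennreal (?N / 16)"
    by (subst nn_integral_add) (auto simp: nn_integral_cmult_indicator PP1)
  finally have *: "ennreal (?N / 8) \<le> ennreal ?N * emeasure (PP \<omega>) A + ennreal (?N / 16)"
    using EX by (rule order_trans[rotated])
  have prob: "ennreal (1/16) \<le> emeasure (PP \<omega>) A"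
  proof -
    have "emeasure (PP \<omega>) A \<le> 1" using emeasure_space[of "PP \<omega>" A] PP1 by simp
    then obtain a where a: "emeasure (PP \<omega>) A = ennreal a" "0 \<le> a"
      by (cases "emeasure (PP \<omega>) A") (auto simp: top_unique)
    have "?N / 8 \<le> ?N * a + ?N / 16"
      using * a by (simp add: ennreal_mult[symmetric] ennreal_plus[symmetric] del: ennreal_plus)
    then have "real ?N * (1/16) \<le> ?N * a" by simp
    then have "1/16 \<le> a" using N by (subst (asm) mult_le_cancel_left_pos) auto
    then show ?thesis using a by (simp add: ennreal_leI)
  qed
  have loss: "ennreal \<sigma> * X s \<le> (\<integral>\<^sup>+w. ennreal \<bar>phat s w - p \<omega> w\<bar> \<partial>M)" if s: "s \<in> space ?MM" for s
  proof -
    note [measurable] = phs[OF s]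
    have sc: "ennreal \<sigma> * Z b v s \<le> D b v s" for b v
    proof -
      have "ennreal \<sigma> * Z b v s \<le> ennreal \<sigma> * (D b v s / ennreal \<sigma>)"
        unfolding Z_def by (intro mult_left_mono) auto
      also have "\<dots> = (D b v s * ennreal \<sigma>) / ennreal \<sigma>"
        by (simp only: ennreal_times_divide mult.commute)
      also have "\<dots> = D b v s"
        using \<sigma> by (intro ennreal_mult_divide_eq) auto
      finally show ?thesis .
    qed
    have [measurable]: "{w \<in> space M. g b w \<noteq> 0} \<in> sets M" if "b \<in> B" for b using that by measurable
    have "ennreal \<sigma> * X s \<le> (\<Sum>b\<in>B. D b (b \<in> \<omega>) s)"
      unfolding X_def sum_distrib_left by (intro sum_mono sc)
    also have "\<dots> = (\<Sum>b\<in>B. \<integral>\<^sup>+w. ennreal \<bar>phat s w - p \<omega> w\<bar> * indicator {w \<in> space M. g b w \<noteq> 0} w \<partial>M)"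
      unfolding D_def using on_supp[OF _ \<omega>]
      by (intro sum.cong refl nn_integral_cong) (auto simp: indicator_def)
    also have "\<dots> = (\<integral>\<^sup>+w. (\<Sum>b\<in>B. ennreal \<bar>phat s w - p \<omega> w\<bar> * indicator {w \<in> space M. g b w \<noteq> 0} w) \<partial>M)"
      by (subst nn_integral_sum) auto
    also have "\<dots> \<le> (\<integral>\<^sup>+w. ennreal \<bar>phat s w - p \<omega> w\<bar> \<partial>M)"
    proof (rule nn_integral_mono)
      fix w assume w: "w \<in> space M"
      have "(\<Sum>b\<in>B. indicator {w \<in> space M. g b w \<noteq> 0} w) \<le> (1::ennreal)"
      proof (cases "\<exists>b\<in>B. g b w \<noteq> 0")
        case True
        then obtain b where b: "b \<in> B" "g b w \<noteq> 0" by auto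
        have "(\<Sum>b'\<in>B. indicator {w \<in> space M. g b' w \<noteq> 0} w) \<le> (\<Sum>b'\<in>B. if b' = b then 1 else (0::ennreal))"
        proof (rule sum_mono)
          fix b' assume b': "b' \<in> B"
          show "indicator {w \<in> space M. g b' w \<noteq> 0} w \<le> (if b' = b then 1 else (0::ennreal))"
            using disj[OF w b' b(1)] b(2) by (cases "b' = b") (auto simp: indicator_def)
        qed
        then show ?thesis using B b by simp
      next
        case False
        then show ?thesis by (simp add: indicator_def)
      qed
      then have "ennreal \<bar>phat s w - p \<omega> w\<bar> * (\<Sum>b\<in>B. indicator {w \<in> space M. g b w \<noteq> 0} w)
          \<le> ennreal \<bar>phat s w - p \<omega> w\<bar> * 1"
        by (rule mult_left_mono) simp
      then show "(\<Sum>b\<in>B. ennreal \<bar>phat s w - p \<omega> w\<bar> * indicator {w \<in> space M. g b w \<noteq> 0} w)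
          \<le> ennreal \<bar>phat s w - p \<omega> w\<bar>"
        by (simp only: sum_distrib_left mult_1_right)
    qed
    finally show ?thesis .
  qed
  have "A \<subseteq> {s \<in> space (PP \<omega>). ennreal \<theta> \<le> (\<integral>\<^sup>+w. ennreal \<bar>phat s w - p \<omega> w\<bar> \<partial>M)}"
  proof
    fix s assume s: "s \<in> A"
    then have sp: "s \<in> space ?MM" by (auto simp: A_def spacePP)
    have "ennreal \<theta> \<le> ennreal (?N * \<sigma> / 16)" using \<theta> by (rule ennreal_leI)
    also have "ennreal (?N * \<sigma> / 16) = ennreal \<sigma> * ennreal (?N / 16)"
      using \<sigma> by (simp add: ennreal_mult[symmetric] mult.commute)
    also have "\<dots> \<le> ennreal \<sigma> * X s" using s by (intro mult_left_mono) (auto simp: A_def)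
    also note loss[OF sp]
    finally show "s \<in> {s \<in> space (PP \<omega>). ennreal \<theta> \<le> (\<integral>\<^sup>+w. ennreal \<bar>phat s w - p \<omega> w\<bar> \<partial>M)}"
      using s by (simp add: A_def)
  qed
  moreover have "{s \<in> space (PP \<omega>). ennreal \<theta> \<le> (\<integral>\<^sup>+w. ennreal \<bar>phat s w - p \<omega> w\<bar> \<partial>M)} \<in> sets (PP \<omega>)"
  proof -
    have "(\<lambda>s. \<integral>\<^sup>+w. ennreal \<bar>phat s w - p \<omega> w\<bar> \<partial>M) \<in> borel_measurable ?MM"
      by (intro M.borel_measurable_nn_integral, unfold case_prod_unfold, measurable)
    then have "(\<lambda>s. \<integral>\<^sup>+w. ennreal \<bar>phat s w - p \<omega> w\<bar> \<partial>M) \<in> borel_measurable (PP \<omega>)"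
      using setsPP[of \<omega>] measurable_cong_sets by blast
    then show ?thesis by measurable
  qed
  ultimately have "emeasure (PP \<omega>) A
     \<le> emeasure (PP \<omega>) {s \<in> space (PP \<omega>). ennreal \<theta> \<le> (\<integral>\<^sup>+w. ennreal \<bar>phat s w - p \<omega> w\<bar> \<partial>M)}"
    by (rule emeasure_mono)
  then show ?thesis
    using \<omega> prob unfolding PP_def P_def by (meson order_trans)
qed

section \<open>A compactly supported bump\<close>

lemma pderiv_dvd_lower:
  fixes p r :: "real poly"
  assumes "r ^ Suc m dvd p"
  shows "r ^ m dvd pderiv p"
proof -
  obtain q where "p = r ^ Suc m * q" using assms by (elim dvdE)
  then have "pderiv p = r ^ m * (smult (of_nat (Suc m)) (pderiv r) * q + r * pderiv q)"
    by (simp only: pderiv_mult pderiv_power_Suc) (simp add: algebra_simps)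
  then show ?thesis by simp
qed

text \<open>
  A double root at both ends of the unit interval makes the derivative continue by zero.
\<close>

lemma deriv_cutoff:
  fixes p :: "real poly"
  assumes "([:0,1:] * [:1,-1:])\<^sup>2 dvd p"
  shows "((\<lambda>t. if 0 < t \<and> t < 1 then poly p t else 0) has_real_derivative
     (if 0 < t \<and> t < 1 then poly (pderiv p) t else 0)) (at t)"
proof -
  obtain q where q: "p = ([:0,1:] * [:1,-1:])\<^sup>2 * q" using assms by (elim dvdE)
  let ?f = "\<lambda>t. if 0 < t \<and> t < 1 then poly p t else (0::real)"
  consider "t < 0 \<or> t > 1" | "0 < t" "t < 1" | "t = 0 \<or> t = 1" by linarith
  then show ?thesis
  proof cases
    case 1
    have "eventually (\<lambda>x. x < 0 \<or> x > 1) (nhds t)"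
      using 1 by (intro eventually_nhds_in_open[where s="{..<0} \<union> {1<..}", simplified]) auto
    then have "eventually (\<lambda>x. ?f x = 0) (nhds t)" by eventually_elim auto
    then show ?thesis using 1
      by (subst DERIV_cong_ev[OF refl _ refl, where g="\<lambda>_. 0"]) auto
  next
    case 2
    have "eventually (\<lambda>x. x \<in> {0<..<1}) (nhds t)"
      using 2 by (intro eventually_nhds_in_open) auto
    then have "eventually (\<lambda>x. ?f x = poly p x) (nhds t)" by eventually_elim auto
    then show ?thesis using 2
      by (subst DERIV_cong_ev[OF refl _ refl, where g="poly p"]) (auto intro: poly_DERIV)
  next
    case 3
    have p: "poly p x = (x * (1 - x))\<^sup>2 * poly q x" for x by (simp add: q algebra_simps)
    have pd: "poly (pderiv p) t = 0"
    proof -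
      have "([:0,1:] * [:1,-1:]) ^ 1 dvd pderiv p"
        using assms by (intro pderiv_dvd_lower) (simp add: numeral_2_eq_2)
      then obtain r where "pderiv p = ([:0,1:] * [:1,-1:]) * r" by (auto elim: dvdE)
      then show ?thesis using 3 by auto
    qed
    have "poly p t = 0" using 3 by (auto simp: p)
    then have lim: "((\<lambda>x. (poly p x - 0) / (x - t)) \<longlongrightarrow> 0) (at t)"
      using poly_DERIV[of p t] unfolding pd has_field_derivative_iff by simp
    have "((\<lambda>x. (?f x - ?f t) / (x - t)) \<longlongrightarrow> 0) (at t)"
    proof (rule tendsto_0_le[OF lim, where K=1], rule always_eventually, rule allI)
      fix x show "norm ((?f x - ?f t) / (x - t)) \<le> norm ((poly p x - 0) / (x - t)) * 1"
        using 3 by auto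
    qed
    then show ?thesis using 3 unfolding has_field_derivative_iff by auto
  qed
qed

text \<open>
  The function \<open>\<psi> k\<close> is the \<open>k\<close>-th derivative of the bump \<open>\<psi> 0\<close>. Only derivatives of order up to \<open>Suc K\<close>
  are ever used, so that the bump need not be infinitely differentiable.
\<close>

definition bump_function :: "nat \<Rightarrow> real \<Rightarrow> real \<Rightarrow> (nat \<Rightarrow> real \<Rightarrow> real) \<Rightarrow> bool" where
  "bump_function K S c \<psi> \<longleftrightarrow>
     (\<forall>k\<le>K. \<forall>t. (\<psi> k has_real_derivative \<psi> (Suc k) t) (at t)) \<and>
     (\<forall>k t. \<psi> k t \<noteq> 0 \<longrightarrow> 0 < t \<and> t < 1) \<and>
     (\<forall>k\<le>Suc K. \<forall>t. \<bar>\<psi> k t\<bar> \<le> S) \<and>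
     (\<forall>t. 0 \<le> \<psi> 0 t) \<and>
     (\<forall>t. 1/3 \<le> t \<longrightarrow> t \<le> 2/3 \<longrightarrow> c \<le> \<psi> 0 t) \<and>
     integrable lborel (\<psi> 0) \<and> (LINT t|lborel. \<psi> 0 t) = 1 \<and> c > 0"

text \<open>
  The bump is \<open>(t (1 - t)) ^ (K + 2)\<close> on the unit interval, normalised: each derivative of order at
  most \<open>K\<close> still has double roots at the end points.
\<close>

lemma ex_bump_function: "\<exists>S c \<psi>. bump_function K S c \<psi>"
proof -
  define p :: "real poly" where "p = ([:0,1:] * [:1,-1:]) ^ (K + 2)"
  define f where "f = (\<lambda>k t. if 0 < t \<and> t < 1 then poly ((pderiv ^^ k) p) t else (0::real))"
  have dv: "([:0,1:] * [:1,-1:]) ^ (K + 2 - k) dvd (pderiv ^^ k) p" if "k \<le> K + 2" for k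
    using that
  proof (induction k)
    case 0 then show ?case by (simp add: p_def)
  next
    case (Suc k)
    have "K + 2 - k = Suc (K + 2 - Suc k)" using Suc.prems by simp
    then show ?case using Suc pderiv_dvd_lower[of _ "K + 2 - Suc k" "(pderiv ^^ k) p"] by simp
  qed
  have d: "(f k has_real_derivative f (Suc k) t) (at t)" if "k \<le> K" for k t
  proof -
    have "([:0,1:] * [:1,-1:])\<^sup>2 dvd ([:0,1:] * [:1,-1:] :: real poly) ^ (K + 2 - k)"
      using that by (intro le_imp_power_dvd) simp
    then have "([:0,1:] * [:1,-1:])\<^sup>2 dvd (pderiv ^^ k) p"
      using dv[of k] that by (meson dvd_trans le_add1 le_trans)
    from deriv_cutoff[OF this, of t] show ?thesis unfolding f_def by (simp only: funpow.simps o_apply)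
  qed
  have f0: "f 0 t = (if 0 < t \<and> t < 1 then (t * (1 - t)) ^ (K + 2) else 0)" for t
    by (simp add: f_def p_def poly_power) (simp add: algebra_simps)
  have "\<exists>S. \<forall>k\<le>Suc K. \<forall>t. \<bar>f k t\<bar> \<le> S"
  proof -
    have "\<exists>M. \<forall>t. \<bar>f k t\<bar> \<le> M" for k
    proof -
      have "compact (poly ((pderiv ^^ k) p) ` {0..1::real})"
        by (intro compact_continuous_image continuous_intros) auto
      then obtain M where M: "\<forall>y\<in>poly ((pderiv ^^ k) p) ` {0..1}. norm y \<le> M"
        using compact_imp_bounded bounded_iff by metis
      have "\<bar>f k t\<bar> \<le> max M 0" for t
        using M by (auto simp: f_def le_max_iff_disj)
      then show ?thesis by blast
    qed
    then obtain M where M: "\<And>k t. \<bar>f k t\<bar> \<le> M k" by metis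
    have "\<bar>f k t\<bar> \<le> Max (M ` {..Suc K})" if "k \<le> Suc K" for k t
      using M[of k t] that by (meson Max_ge atMost_iff finite_atMost finite_imageI imageI order_trans)
    then show ?thesis by blast
  qed
  then obtain S where S: "\<And>k t. k \<le> Suc K \<Longrightarrow> \<bar>f k t\<bar> \<le> S" by blast
  have fn: "0 \<le> f 0 t" for t unfolding f0 by auto
  have lower: "(2/9) ^ (K + 2) \<le> f 0 t" if "1/3 \<le> t" "t \<le> 2/3" for t
  proof -
    have "0 \<le> (t - 1/3) * (2/3 - t)" using that by (intro mult_nonneg_nonneg) auto
    then have "2/9 \<le> t * (1 - t)" by (simp add: field_simps)
    then have "(2/9) ^ (K + 2) \<le> (t * (1 - t)) ^ (K + 2)" by (intro power_mono) auto
    also have "\<dots> = f 0 t" unfolding f0 using that by (subst if_P) auto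
    finally show ?thesis .
  qed
  have int: "integrable lborel (f 0)"
  proof -
    have "f 0 \<in> borel_measurable borel"
      by (intro borel_measurable_continuous_onI continuous_at_imp_continuous_on ballI DERIV_isCont[OF d]) simp
    then have m: "f 0 \<in> borel_measurable lborel" by simp
    show ?thesis
    proof (rule Bochner_Integration.integrable_bound[where f="\<lambda>t. S * indicator {0..1::real} t"])
      show "AE x in lborel. norm (f 0 x) \<le> norm (S * indicator {0..1} x)"
      proof (intro AE_I2)
        fix x
        have "\<bar>f 0 x\<bar> \<le> S" by (rule S) simp
        moreover have "f 0 x = 0" if "x \<notin> {0..1}" using that by (auto simp: f_def)
        ultimately show "norm (f 0 x) \<le> norm (S * indicator {0..1} x)"
          by (cases "x \<in> {0..1}") auto
      qed
    qed (use m in auto)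
  qed
  define I where "I = (LINT t|lborel. f 0 t)"
  have "I \<ge> (LINT t|lborel. (2/9) ^ (K + 2) * indicator {1/3..2/3::real} t)"
    unfolding I_def
  proof (rule integral_mono[OF _ int])
    show "integrable lborel (\<lambda>t. (2/9 :: real) ^ (K + 2) * indicator {1/3..2/3::real} t)"
      by (intro integrable_mult_right integrable_real_indicator) auto
    show "(2/9) ^ (K + 2) * indicator {1/3..2/3::real} t \<le> f 0 t" for t
      using lower[of t] fn[of t] by (cases "t \<in> {1/3..2/3}") auto
  qed
  then have I: "I > 0" by (rule less_le_trans[rotated]) (simp add: measure_def)
  have "bump_function K (S / I) ((2/9) ^ (K + 2) / I) (\<lambda>k t. f k t / I)"
    unfolding bump_function_def
  proof (intro conjI allI impI)
    fix k t assume "k \<le> K"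
    then show "((\<lambda>t. f k t / I) has_real_derivative f (Suc k) t / I) (at t)"
      by (intro DERIV_cdivide d)
  next
    fix k t assume "f k t / I \<noteq> 0" then show "0 < t" "t < 1" by (auto simp: f_def split: if_splits)
  next
    fix k t assume "k \<le> Suc K" then show "\<bar>f k t / I\<bar> \<le> S / I"
      using I S by (simp add: divide_right_mono)
  next
    fix t :: real assume "1/3 \<le> t" "t \<le> 2/3"
    then show "(2/9) ^ (K + 2) / I \<le> f 0 t / I" using I by (intro divide_right_mono lower) auto
  qed (use I fn int in \<open>auto simp: divide_right_mono I_def\<close>)
  then show ?thesis by blast
qed

section \<open>Smoothness of sums of products\<close>

text \<open>
  A jet is a family of functions indexed by multi-indices in which raising the entry \<open>i\<close> means
  differentiating in coordinate \<open>i\<close>. Jets of sums and products are explicit, whereas \<^const>\<open>mixed_partial\<close>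
  has to be computed one differentiation at a time.
\<close>

definition has_jet :: "nat \<Rightarrow> nat \<Rightarrow> ((nat \<Rightarrow> nat) \<Rightarrow> vec \<Rightarrow> real) \<Rightarrow> bool" where
  "has_jet d K D \<longleftrightarrow> (\<forall>k z. \<forall>i\<in>{1..d}. (\<forall>l\<in>{1..d}. k l \<le> K) \<longrightarrow>
     ((\<lambda>t. D k (z(i := t))) has_real_derivative D (k(i := Suc (k i))) z) (at (z i)))"

text \<open>
  The Hoelder condition of \<^const>\<open>smooth_class\<close>, with mixed partial derivatives replaced by the members of a jet.
\<close>

definition holder_jet ::
    "nat \<Rightarrow> (nat \<Rightarrow> real) \<Rightarrow> real \<Rightarrow> ((nat \<Rightarrow> nat) \<Rightarrow> vec \<Rightarrow> real) \<Rightarrow> bool" where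
  "holder_jet d \<beta> L D \<longleftrightarrow> (\<forall>k z u. weighted_order d \<beta> k < 1 \<longrightarrow>
     (\<forall>j\<in>{1..d}. weighted_order d \<beta> k + 1 / \<beta> j < 1 \<longrightarrow> u j = 0) \<longrightarrow>
     \<bar>D k (\<lambda>i\<in>{1..d}. z i + u i) - D k z\<bar>
       \<le> L * (\<Sum>j\<in>{1..d}. \<bar>u j\<bar> powr (\<beta> j * (1 - weighted_order d \<beta> k))))"

lemma has_jet_add: "has_jet d K D \<Longrightarrow> has_jet d K E \<Longrightarrow> has_jet d K (\<lambda>k z. D k z + E k z)"
  unfolding has_jet_def by (auto intro!: DERIV_add)

lemma holder_jet_add:
  assumes "holder_jet d \<beta> L D" "holder_jet d \<beta> L' E"
  shows "holder_jet d \<beta> (L + L') (\<lambda>k z. D k z + E k z)"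
  unfolding holder_jet_def
proof (intro allI impI)
  fix k and z u :: vec assume *: "weighted_order d \<beta> k < 1"
    "\<forall>j\<in>{1..d}. weighted_order d \<beta> k + 1 / \<beta> j < 1 \<longrightarrow> u j = 0"
  let ?s = "\<Sum>j\<in>{1..d}. \<bar>u j\<bar> powr (\<beta> j * (1 - weighted_order d \<beta> k))"
  let ?z = "\<lambda>i\<in>{1..d}. z i + u i"
  have "\<bar>D k ?z - D k z\<bar> \<le> L * ?s" "\<bar>E k ?z - E k z\<bar> \<le> L' * ?s"
    using assms * unfolding holder_jet_def by blast+
  then show "\<bar>D k ?z + E k ?z - (D k z + E k z)\<bar> \<le> (L + L') * ?s"
    unfolding distrib_right by linarith
qed

lemma has_jet_partial_deriv:
  assumes "has_jet d K D" "i \<in> {1..d}" "\<forall>l\<in>{1..d}. k l \<le> K"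
  shows "partial_deriv i (D k) = D (k(i := Suc (k i)))"
  using assms unfolding has_jet_def partial_deriv_def by (auto intro!: ext DERIV_imp_deriv)

lemma has_jet_iterated_partial_deriv:
  assumes "has_jet d K D" "i \<in> {1..d}" "\<forall>l\<in>{1..d}. k l \<le> K" "k i + m \<le> K"
  shows "(partial_deriv i ^^ m) (D k) = D (k(i := k i + m))"
  using assms(4)
proof (induction m)
  case 0 then show ?case by simp
next
  case (Suc m)
  have "\<forall>l\<in>{1..d}. (k(i := k i + m)) l \<le> K" using assms Suc.prems by auto
  then have "partial_deriv i (D (k(i := k i + m))) = D (k(i := k i + Suc m))"
    using has_jet_partial_deriv[OF assms(1,2), of "k(i := k i + m)"] by simp
  moreover have "(partial_deriv i ^^ m) (D k) = D (k(i := k i + m))"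
    using Suc.prems by (intro Suc.IH) simp
  ultimately show ?case by (simp only: funpow.simps o_apply)
qed

lemma has_jet_mixed_partial:
  assumes D: "has_jet d K D" and k: "\<forall>l\<in>{1..d}. k l \<le> K"
  shows "mixed_partial d k (D (\<lambda>_. 0)) = D (\<lambda>l. if 1 \<le> l \<and> l \<le> d then k l else 0)"
proof -
  have "foldr (\<lambda>i. partial_deriv i ^^ k i) [j..<Suc d] (D (\<lambda>_. 0))
      = D (\<lambda>l. if j \<le> l \<and> l \<le> d then k l else 0)" if "1 \<le> j" "j \<le> Suc d" for j
    using that(2,1)
  proof (induction rule: inc_induct)
    case base
    have "(\<lambda>l. if Suc d \<le> l \<and> l \<le> d then k l else 0) = (\<lambda>_. 0)" by auto
    then show ?case by simp
  next
    case (step j)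
    let ?k = "\<lambda>l. if Suc j \<le> l \<and> l \<le> d then k l else 0"
    have "foldr (\<lambda>i. partial_deriv i ^^ k i) [j..<Suc d] (D (\<lambda>_. 0)) = (partial_deriv j ^^ k j) (D ?k)"
      using step by (simp add: upt_conv_Cons del: upt_Suc)
    also have "\<dots> = D (?k(j := ?k j + k j))"
      using step k by (intro has_jet_iterated_partial_deriv[OF D]) auto
    also have "?k(j := ?k j + k j) = (\<lambda>l. if j \<le> l \<and> l \<le> d then k l else 0)"
      using step by auto
    finally show ?case .
  qed
  from this[of 1] show ?thesis unfolding mixed_partial_def by simp
qed

lemma has_jet_mixed_partial_exists:
  assumes D: "has_jet d K D" and k: "\<forall>l\<in>{1..d}. k l \<le> K"
  shows "mixed_partial_exists d k (D (\<lambda>_. 0))"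
  unfolding mixed_partial_exists_def
proof (intro ballI allI impI)
  fix i m assume i: "i \<in> {1..d}" and m: "m < k i"
  let ?k = "\<lambda>l. if l < i then 0 else if l = i then m else k l"
  have k': "\<forall>l\<in>{1..d}. ?k l \<le> K" using k i m by (auto intro: less_imp_le order_trans[of m "k i"])
  let ?k' = "\<lambda>l. if 1 \<le> l \<and> l \<le> d then ?k l else 0"
  have "\<forall>l\<in>{1..d}. ?k' l \<le> K" using k' by auto
  then show "partially_differentiable d i (mixed_partial d ?k (D (\<lambda>_. 0)))"
    unfolding has_jet_mixed_partial[OF D k'] partially_differentiable_def field_differentiable_def
    using D[unfolded has_jet_def, THEN spec, of ?k', THEN spec, THEN bspec, OF i, THEN mp]
    by blast
qed

text \<open>
  Every derivative that the smoothness class inspects has order below \<open>\<beta>\<^sub>l\<close> in coordinate \<open>l\<close>, so a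
  bump with finitely many derivatives suffices.
\<close>

lemma order_le_if_weighted_order_less_1:
  assumes \<beta>: "\<And>i. i \<in> {1..d} \<Longrightarrow> 0 < \<beta> i \<and> \<beta> i \<le> real K"
    and w: "weighted_order d \<beta> k < 1" and l: "l \<in> {1..d}"
  shows "k l \<le> K"
proof -
  have "real (k l) / \<beta> l \<le> weighted_order d \<beta> k"
    unfolding weighted_order_def
    using \<beta> l by (intro member_le_sum[of l _ "\<lambda>i. real (k i) / \<beta> i"]) (auto intro!: divide_nonneg_pos)
  then have "real (k l) / \<beta> l < 1" using w by simp
  then have "real (k l) < real K" using \<beta>[OF l] by (simp add: field_simps)
  then show ?thesis by simp
qed

lemma smooth_classI:
  assumes D: "has_jet d K D" and H: "holder_jet d \<beta> L D"
    and \<beta>: "\<And>i. i \<in> {1..d} \<Longrightarrow> 0 < \<beta> i \<and> \<beta> i \<le> real K"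
  shows "D (\<lambda>_. 0) \<in> smooth_class d \<beta> (\<lambda>_ _. L)"
proof -
  have "mixed_partial_exists d k (D (\<lambda>_. 0)) \<and>
     (\<forall>z\<in>vecs {1..d}. \<forall>u\<in>vecs {1..d}.
        (\<forall>j\<in>{1..d}. weighted_order d \<beta> k + 1 / \<beta> j < 1 \<longrightarrow> u j = 0) \<longrightarrow>
        \<bar>mixed_partial d k (D (\<lambda>_. 0)) (\<lambda>i\<in>{1..d}. z i + u i) - mixed_partial d k (D (\<lambda>_. 0)) z\<bar>
          \<le> L * (\<Sum>j\<in>{1..d}. \<bar>u j\<bar> powr (\<beta> j * (1 - weighted_order d \<beta> k))))"
    if w: "weighted_order d \<beta> k < 1" for k
  proof -
    have k: "\<forall>l\<in>{1..d}. k l \<le> K"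
      using order_le_if_weighted_order_less_1[of d \<beta> K, OF \<beta> w] by blast
    let ?k = "\<lambda>l. if 1 \<le> l \<and> l \<le> d then k l else 0"
    have "weighted_order d \<beta> ?k = weighted_order d \<beta> k"
      unfolding weighted_order_def by (intro sum.cong) auto
    then have wk: "weighted_order d \<beta> ?k = weighted_order d \<beta> k" .
    show ?thesis
      unfolding has_jet_mixed_partial[OF D k]
      using has_jet_mixed_partial_exists[OF D k] H[unfolded holder_jet_def, rule_format, of ?k, unfolded wk, OF w]
      by blast
  qed
  then show ?thesis unfolding smooth_class_def by blast
qed

lemma abs_prod_diff_le:
  fixes x y :: "'i \<Rightarrow> real"
  assumes "finite I"
  shows "\<bar>(\<Prod>i\<in>I. x i) - (\<Prod>i\<in>I. y i)\<bar> \<le> (\<Sum>j\<in>I. \<bar>x j - y j\<bar> * (\<Prod>i\<in>I - {j}. \<bar>x i\<bar> + \<bar>y i\<bar>))"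
  using assms
proof (induction I)
  case empty then show ?case by simp
next
  case (insert a I)
  have "\<bar>(\<Prod>i\<in>insert a I. x i) - (\<Prod>i\<in>insert a I. y i)\<bar>
      = \<bar>x a * ((\<Prod>i\<in>I. x i) - (\<Prod>i\<in>I. y i)) + (x a - y a) * (\<Prod>i\<in>I. y i)\<bar>"
    using insert by (simp add: algebra_simps)
  also have "\<dots> \<le> \<bar>x a\<bar> * \<bar>(\<Prod>i\<in>I. x i) - (\<Prod>i\<in>I. y i)\<bar> + \<bar>x a - y a\<bar> * \<bar>\<Prod>i\<in>I. y i\<bar>"
    by (rule order_trans[OF abs_triangle_ineq]) (simp add: abs_mult)
  also have "\<dots> \<le> (\<bar>x a\<bar> + \<bar>y a\<bar>) * (\<Sum>j\<in>I. \<bar>x j - y j\<bar> * (\<Prod>i\<in>I - {j}. \<bar>x i\<bar> + \<bar>y i\<bar>))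
      + \<bar>x a - y a\<bar> * (\<Prod>i\<in>I. \<bar>x i\<bar> + \<bar>y i\<bar>)"
  proof -
    have "\<bar>\<Prod>i\<in>I. y i\<bar> \<le> (\<Prod>i\<in>I. \<bar>x i\<bar> + \<bar>y i\<bar>)"
      unfolding abs_prod by (intro prod_mono) auto
    then show ?thesis using insert.IH by (intro add_mono mult_mono) auto
  qed
  also have "(\<bar>x a\<bar> + \<bar>y a\<bar>) * (\<Sum>j\<in>I. \<bar>x j - y j\<bar> * (\<Prod>i\<in>I - {j}. \<bar>x i\<bar> + \<bar>y i\<bar>))
      = (\<Sum>j\<in>I. \<bar>x j - y j\<bar> * (\<Prod>i\<in>insert a I - {j}. \<bar>x i\<bar> + \<bar>y i\<bar>))"
    unfolding sum_distrib_left
  proof (rule sum.cong[OF refl])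
    fix j assume j: "j \<in> I"
    then have "insert a I - {j} = insert a (I - {j})" using insert by auto
    then show "(\<bar>x a\<bar> + \<bar>y a\<bar>) * (\<bar>x j - y j\<bar> * (\<Prod>i\<in>I - {j}. \<bar>x i\<bar> + \<bar>y i\<bar>))
       = \<bar>x j - y j\<bar> * (\<Prod>i\<in>insert a I - {j}. \<bar>x i\<bar> + \<bar>y i\<bar>)"
      using insert by simp
  qed
  also have "\<dots> + \<bar>x a - y a\<bar> * (\<Prod>i\<in>I. \<bar>x i\<bar> + \<bar>y i\<bar>)
      = (\<Sum>j\<in>insert a I. \<bar>x j - y j\<bar> * (\<Prod>i\<in>insert a I - {j}. \<bar>x i\<bar> + \<bar>y i\<bar>))"
    using insert by simp
  finally show ?case .
qed

text \<open>
  The mean value theorem applied to the single function \<open>\<Sum>a\<in>B. \<plusminus> f a\<close> with the signs of the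
  increments: the bound for a family does not grow with the number of its members.
\<close>

lemma family_increment_le:
  fixes f f' :: "'a \<Rightarrow> real \<Rightarrow> real"
  assumes "\<And>a t. a \<in> B \<Longrightarrow> (f a has_real_derivative f' a t) (at t)"
    and "\<And>t. (\<Sum>a\<in>B. \<bar>f' a t\<bar>) \<le> M"
  shows "(\<Sum>a\<in>B. \<bar>f a t - f a s\<bar>) \<le> M * \<bar>t - s\<bar>"
proof -
  define \<sigma> where "\<sigma> a = sgn (f a t - f a s)" for a
  have "norm ((\<Sum>a\<in>B. \<sigma> a * f a t) - (\<Sum>a\<in>B. \<sigma> a * f a s)) \<le> M * norm (t - s)"
  proof (rule field_differentiable_bound[where S=UNIV])
    fix x
    show "((\<lambda>t. \<Sum>a\<in>B. \<sigma> a * f a t) has_real_derivative (\<Sum>a\<in>B. \<sigma> a * f' a x)) (at x within UNIV)"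
      using assms(1) by (intro DERIV_sum DERIV_cmult) auto
    have "\<bar>\<sigma> a * f' a x\<bar> \<le> \<bar>f' a x\<bar>" for a by (auto simp: \<sigma>_def sgn_real_def)
    then have "\<bar>\<Sum>a\<in>B. \<sigma> a * f' a x\<bar> \<le> (\<Sum>a\<in>B. \<bar>f' a x\<bar>)"
      by (intro order_trans[OF sum_abs] sum_mono)
    then show "norm (\<Sum>a\<in>B. \<sigma> a * f' a x) \<le> M" using assms(2)[of x] by simp
  qed auto
  moreover have "(\<Sum>a\<in>B. \<sigma> a * f a t) - (\<Sum>a\<in>B. \<sigma> a * f a s) = (\<Sum>a\<in>B. \<bar>f a t - f a s\<bar>)"
    unfolding sum_subtractf[symmetric]
    by (intro sum.cong refl) (auto simp: \<sigma>_def sgn_real_def algebra_simps)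
  ultimately show ?thesis by simp
qed

definition separable_jet ::
    "nat \<Rightarrow> (nat \<Rightarrow> 'a set) \<Rightarrow> ((nat \<Rightarrow> 'a) \<Rightarrow> real) \<Rightarrow> (nat \<Rightarrow> 'a \<Rightarrow> nat \<Rightarrow> real \<Rightarrow> real) \<Rightarrow>
      (nat \<Rightarrow> nat) \<Rightarrow> vec \<Rightarrow> real" where
  "separable_jet d B c \<phi> k z = (\<Sum>a\<in>PiE {1..d} B. c a * (\<Prod>i\<in>{1..d}. \<phi> i (a i) (k i) (z i)))"

lemma has_jet_separable:
  assumes d: "\<And>i a k t. i \<in> {1..d} \<Longrightarrow> a \<in> B i \<Longrightarrow> k \<le> K \<Longrightarrow>
      (\<phi> i a k has_real_derivative \<phi> i a (Suc k) t) (at t)"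
  shows "has_jet d K (separable_jet d B c \<phi>)"
  unfolding has_jet_def
proof (intro allI ballI impI)
  fix k z i assume i: "i \<in> {1..d}" and k: "\<forall>l\<in>{1..d}. k l \<le> K"
  have split: "(\<Prod>l\<in>{1..d}. \<phi> l (a l) (k' l) (z' l)) =
      \<phi> i (a i) (k' i) (z' i) * (\<Prod>l\<in>{1..d} - {i}. \<phi> l (a l) (k' l) (z' l))" for a k' z'
    using i by (intro prod.remove) auto
  have rest: "(\<Prod>l\<in>{1..d} - {i}. \<phi> l (a l) (k l) ((z(i := t)) l))
      = (\<Prod>l\<in>{1..d} - {i}. \<phi> l (a l) (k l) (z l))"
    "(\<Prod>l\<in>{1..d} - {i}. \<phi> l (a l) ((k(i := Suc (k i))) l) (z l))
      = (\<Prod>l\<in>{1..d} - {i}. \<phi> l (a l) (k l) (z l))" for a t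
    by (intro prod.cong; simp)+
  show "((\<lambda>t. separable_jet d B c \<phi> k (z(i := t))) has_real_derivative
       separable_jet d B c \<phi> (k(i := Suc (k i))) z) (at (z i))"
    unfolding separable_jet_def split rest
  proof (intro DERIV_sum DERIV_cmult)
    fix a assume a: "a \<in> PiE {1..d} B"
    have "(\<phi> i (a i) (k i) has_real_derivative \<phi> i (a i) (Suc (k i)) (z i)) (at (z i))"
      using k i by (intro d[OF i PiE_mem[OF a i]]) blast
    from DERIV_cmult_right[OF this, of "\<Prod>l\<in>{1..d} - {i}. \<phi> l (a l) (k l) (z l)"]
    show "((\<lambda>t. \<phi> i (a i) (k i) ((z(i := t)) i) * (\<Prod>l\<in>{1..d} - {i}. \<phi> l (a l) (k l) (z l)))
        has_real_derivative
         \<phi> i (a i) ((k(i := Suc (k i))) i) (z i) * (\<Prod>l\<in>{1..d} - {i}. \<phi> l (a l) (k l) (z l))) (at (z i))"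
      by simp
  qed
qed

text \<open>
  Changing coordinate \<open>j\<close> by \<open>u\<close> changes a product with widths \<open>h\<close> and amplitude \<open>A\<close> by at most
  \<open>A (\<Prod>i. h\<^sub>i powr - k\<^sub>i) min 1 (\<bar>u\<bar> / h\<^sub>j)\<close> up to constants. As the exponent \<open>e = \<beta>\<^sub>j (1 - w)\<close> that the class asks for is at
  most 1 whenever \<open>u\<close> may be nonzero, the minimum is at most \<open>(\<bar>u\<bar> / h\<^sub>j) powr e\<close>; inserting
  \<open>h\<^sub>i \<ge> \<delta> powr (1 / \<beta>\<^sub>i)\<close>, all powers of \<open>\<delta>\<close> combine to \<open>1 / \<delta>\<close>. The sum over all multi-indices costs nothing
  because it factorises over the coordinates.
\<close>

lemma holder_jet_separable:
  fixes \<phi> :: "nat \<Rightarrow> 'a \<Rightarrow> nat \<Rightarrow> real \<Rightarrow> real"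
  assumes B: "\<And>i. i \<in> {1..d} \<Longrightarrow> finite (B i)"
    and d: "\<And>i a k t. i \<in> {1..d} \<Longrightarrow> a \<in> B i \<Longrightarrow> k \<le> K \<Longrightarrow>
      (\<phi> i a k has_real_derivative \<phi> i a (Suc k) t) (at t)"
    and bound: "\<And>i k t. i \<in> {1..d} \<Longrightarrow> k \<le> Suc K \<Longrightarrow> (\<Sum>a\<in>B i. \<bar>\<phi> i a k t\<bar>) \<le> S / h i ^ k"
    and c: "\<And>a. \<bar>c a\<bar> \<le> A" and S: "S \<ge> 0"
    and \<delta>: "\<delta> > 0" and h: "\<And>i. i \<in> {1..d} \<Longrightarrow> h i \<ge> \<delta> powr (1 / \<beta> i)"
    and \<beta>: "\<And>i. i \<in> {1..d} \<Longrightarrow> 0 < \<beta> i \<and> \<beta> i \<le> real K"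
  shows "holder_jet d \<beta> (A * (2 * S) ^ d / \<delta>) (separable_jet d B c \<phi>)"
  unfolding holder_jet_def
proof (intro allI impI)
  fix k and z u :: vec
  define w where "w = weighted_order d \<beta> k"
  assume "weighted_order d \<beta> k < 1"
    and "\<forall>j\<in>{1..d}. weighted_order d \<beta> k + 1 / \<beta> j < 1 \<longrightarrow> u j = 0"
  then have w1: "w < 1" and u: "\<And>j. j \<in> {1..d} \<Longrightarrow> w + 1 / \<beta> j < 1 \<Longrightarrow> u j = 0" by (auto simp: w_def)
  have A: "A \<ge> 0" using c[of undefined] by linarith
  have hpos: "h i > 0" if "i \<in> {1..d}" for i
    using \<delta> by (intro less_le_trans[OF _ h[OF that]]) simp
  have kK: "k l \<le> K" if l: "l \<in> {1..d}" for l
    using \<beta> w1 l unfolding w_def by (rule order_le_if_weighted_order_less_1)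
  let ?z = "\<lambda>i\<in>{1..d}. z i + u i"
  define x where "x i a = \<phi> i a (k i) (z i + u i)" for i a
  define y where "y i a = \<phi> i a (k i) (z i)" for i a
  let ?PB = "PiE {1..d} B"
  let ?r = "\<lambda>j. min 1 (\<bar>u j\<bar> / h j)"
  have inc: "(\<Sum>a\<in>B j. \<bar>x j a - y j a\<bar>) \<le> 2 * S / h j ^ k j * ?r j" if j: "j \<in> {1..d}" for j
  proof -
    have 1: "(\<Sum>a\<in>B j. \<bar>x j a - y j a\<bar>) \<le> S / h j ^ Suc (k j) * \<bar>(z j + u j) - z j\<bar>"
      unfolding x_def y_def
      by (intro family_increment_le[where f'="\<lambda>a. \<phi> j a (Suc (k j))"] d[OF j _ kK[OF j]] bound[OF j])
         (simp_all add: kK[OF j])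
    have "(\<Sum>a\<in>B j. \<bar>x j a - y j a\<bar>) \<le> (\<Sum>a\<in>B j. \<bar>x j a\<bar>) + (\<Sum>a\<in>B j. \<bar>y j a\<bar>)"
      unfolding sum.distrib[symmetric] by (intro sum_mono) linarith
    also have "\<dots> \<le> S / h j ^ k j + S / h j ^ k j"
      unfolding x_def y_def using kK[OF j] bound[OF j] by (intro add_mono) auto
    finally have 2: "(\<Sum>a\<in>B j. \<bar>x j a - y j a\<bar>) \<le> 2 * S / h j ^ k j" by simp
    have 3: "S / h j ^ Suc (k j) * \<bar>(z j + u j) - z j\<bar> \<le> 2 * S / h j ^ k j * (\<bar>u j\<bar> / h j)"
      using hpos[OF j] S by (simp add: field_simps)
    show ?thesis
    proof (cases "1 \<le> \<bar>u j\<bar> / h j")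
      case True
      then have "?r j = 1" by simp
      then show ?thesis using 2 by simp
    next
      case False
      then have "?r j = \<bar>u j\<bar> / h j" by simp
      then show ?thesis using order_trans[OF 1 3] by (simp only:)
    qed
  qed
  have sum2: "(\<Sum>a\<in>B i. \<bar>x i a\<bar> + \<bar>y i a\<bar>) \<le> 2 * S / h i ^ k i" if i: "i \<in> {1..d}" for i
    using add_mono[OF bound[OF i, of "k i" "z i + u i"] bound[OF i, of "k i" "z i"]] kK[OF i]
    by (simp add: x_def y_def sum.distrib)
  have "\<bar>separable_jet d B c \<phi> k ?z - separable_jet d B c \<phi> k z\<bar>
     = \<bar>\<Sum>a\<in>?PB. c a * ((\<Prod>i\<in>{1..d}. x i (a i)) - (\<Prod>i\<in>{1..d}. y i (a i)))\<bar>"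
  proof -
    have "(\<Prod>i\<in>{1..d}. \<phi> i (a i) (k i) (?z i)) = (\<Prod>i\<in>{1..d}. x i (a i))" for a
      unfolding x_def by (intro prod.cong) auto
    then show ?thesis
      unfolding separable_jet_def y_def by (simp only: sum_subtractf[symmetric] right_diff_distrib)
  qed
  also have "\<dots> \<le> (\<Sum>a\<in>?PB. A * (\<Sum>j\<in>{1..d}. \<bar>x j (a j) - y j (a j)\<bar> *
       (\<Prod>i\<in>{1..d} - {j}. \<bar>x i (a i)\<bar> + \<bar>y i (a i)\<bar>)))"
    by (rule order_trans[OF sum_abs], rule sum_mono, unfold abs_mult, intro mult_mono abs_prod_diff_le c)
       (use A in auto)
  also have "\<dots> = A * (\<Sum>j\<in>{1..d}. \<Sum>a\<in>?PB. \<bar>x j (a j) - y j (a j)\<bar> *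
       (\<Prod>i\<in>{1..d} - {j}. \<bar>x i (a i)\<bar> + \<bar>y i (a i)\<bar>))"
    unfolding sum_distrib_left[symmetric] by (subst sum.swap) simp
  also have "\<dots> \<le> A * (\<Sum>j\<in>{1..d}. (\<Prod>i\<in>{1..d}. 2 * S / h i ^ k i) * ?r j)"
  proof (intro mult_left_mono sum_mono A)
    fix j assume j: "j \<in> {1..d}"
    \<comment> \<open>the summand is a product over all coordinates, so the sum over multi-indices factorises\<close>
    let ?f = "\<lambda>i a. if i = j then \<bar>x j a - y j a\<bar> else \<bar>x i a\<bar> + \<bar>y i a\<bar>"
    have "(\<Sum>a\<in>?PB. \<bar>x j (a j) - y j (a j)\<bar> * (\<Prod>i\<in>{1..d} - {j}. \<bar>x i (a i)\<bar> + \<bar>y i (a i)\<bar>))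
        = (\<Sum>a\<in>?PB. \<Prod>i\<in>{1..d}. ?f i (a i))"
    proof (rule sum.cong[OF refl])
      fix a
      have "(\<Prod>i\<in>{1..d}. ?f i (a i)) = ?f j (a j) * (\<Prod>i\<in>{1..d} - {j}. ?f i (a i))"
        using j by (intro prod.remove) auto
      also have "(\<Prod>i\<in>{1..d} - {j}. ?f i (a i)) = (\<Prod>i\<in>{1..d} - {j}. \<bar>x i (a i)\<bar> + \<bar>y i (a i)\<bar>)"
        by (intro prod.cong) auto
      finally show "\<bar>x j (a j) - y j (a j)\<bar> * (\<Prod>i\<in>{1..d} - {j}. \<bar>x i (a i)\<bar> + \<bar>y i (a i)\<bar>)
          = (\<Prod>i\<in>{1..d}. ?f i (a i))" by simp
    qed
    also have "\<dots> = (\<Prod>i\<in>{1..d}. \<Sum>a\<in>B i. ?f i a)"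
      using B by (intro prod_sum_PiE[symmetric]) auto
    also have "\<dots> \<le> (\<Prod>i\<in>{1..d}. 2 * S / h i ^ k i * (if i = j then ?r j else 1))"
    proof (intro prod_mono conjI)
      fix i assume i: "i \<in> {1..d}"
      show "0 \<le> (\<Sum>a\<in>B i. ?f i a)" by (intro sum_nonneg) auto
      show "(\<Sum>a\<in>B i. ?f i a) \<le> 2 * S / h i ^ k i * (if i = j then ?r j else 1)"
        using inc[OF i] sum2[OF i] by auto
    qed
    also have "\<dots> = (\<Prod>i\<in>{1..d}. 2 * S / h i ^ k i) * ?r j"
      using j by (simp only: prod.distrib) (simp add: prod.delta)
    finally show "(\<Sum>a\<in>?PB. \<bar>x j (a j) - y j (a j)\<bar> * (\<Prod>i\<in>{1..d} - {j}. \<bar>x i (a i)\<bar> + \<bar>y i (a i)\<bar>))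
        \<le> (\<Prod>i\<in>{1..d}. 2 * S / h i ^ k i) * ?r j" .
  qed
  also have "\<dots> \<le> A * (\<Sum>j\<in>{1..d}. ((2 * S) ^ d / \<delta> powr w) * (\<bar>u j\<bar> powr (\<beta> j * (1 - w)) / \<delta> powr (1 - w)))"
  proof (intro mult_left_mono sum_mono A mult_mono)
    fix j assume j: "j \<in> {1..d}"
    have "\<delta> powr w = (\<Prod>i\<in>{1..d}. \<delta> powr (real (k i) / \<beta> i))"
      unfolding w_def weighted_order_def using \<delta> by (intro powr_sum) auto
    also have "\<dots> \<le> (\<Prod>i\<in>{1..d}. h i ^ k i)"
    proof (intro prod_mono conjI)
      fix i assume i: "i \<in> {1..d}"
      have "\<delta> powr (real (k i) / \<beta> i) = (\<delta> powr (1 / \<beta> i)) ^ k i"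
        using \<delta> by (simp add: powr_powr powr_realpow[symmetric])
      also have "\<dots> \<le> h i ^ k i" by (intro power_mono h i) auto
      finally show "\<delta> powr (real (k i) / \<beta> i) \<le> h i ^ k i" .
    qed auto
    finally have "(2 * S) ^ d / (\<Prod>i\<in>{1..d}. h i ^ k i) \<le> (2 * S) ^ d / \<delta> powr w"
      using \<delta> S by (intro divide_left_mono) (auto intro!: mult_pos_pos prod_pos zero_less_power hpos)
    then show "(\<Prod>i\<in>{1..d}. 2 * S / h i ^ k i) \<le> (2 * S) ^ d / \<delta> powr w"
      by (simp add: prod_dividef)
    define e where "e = \<beta> j * (1 - w)"
    show "?r j \<le> \<bar>u j\<bar> powr (\<beta> j * (1 - w)) / \<delta> powr (1 - w)"
    proof (cases "u j = 0")
      case True then show ?thesis by simp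
    next
      case False
      have b: "\<beta> j > 0" using \<beta>[OF j] by simp
      have "w + 1 / \<beta> j \<ge> 1" using u[OF j] False by force
      then have e: "0 < e" "e \<le> 1" using w1 b by (auto simp: e_def field_simps)
      have "?r j \<le> (\<bar>u j\<bar> / h j) powr e"
      proof (cases "\<bar>u j\<bar> / h j \<ge> 1")
        case True
        then show ?thesis using e ge_one_powr_ge_zero[of "\<bar>u j\<bar> / h j" e] by simp
      next
        case F: False
        then have "(\<bar>u j\<bar> / h j) powr 1 \<le> (\<bar>u j\<bar> / h j) powr e"
          using e hpos[OF j] by (intro powr_mono') auto
        then show ?thesis using F hpos[OF j] False by simp
      qed
      also have "\<dots> = \<bar>u j\<bar> powr e / h j powr e"
        using hpos[OF j] by (simp add: powr_divide)
      also have "\<dots> \<le> \<bar>u j\<bar> powr e / \<delta> powr (1 - w)"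
      proof (intro divide_left_mono)
        have "\<delta> powr (1 - w) = (\<delta> powr (1 / \<beta> j)) powr e" using b by (simp add: powr_powr e_def)
        also have "\<dots> \<le> h j powr e" using e by (intro powr_mono2 h j) auto
        finally show "\<delta> powr (1 - w) \<le> h j powr e" .
      qed (use \<delta> hpos[OF j] in auto)
      finally show ?thesis by (simp add: e_def)
    qed
  qed (use S \<delta> hpos in \<open>auto intro!: divide_nonneg_pos simp: less_imp_le\<close>)
  also have "\<dots> = A * (2 * S) ^ d / (\<delta> powr w * \<delta> powr (1 - w)) * (\<Sum>j\<in>{1..d}. \<bar>u j\<bar> powr (\<beta> j * (1 - w)))"
    by (simp add: sum_distrib_left sum_distrib_right mult.assoc)
  also have "\<delta> powr w * \<delta> powr (1 - w) = \<delta>"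
    using \<delta> by (simp add: powr_add[symmetric])
  finally show "\<bar>separable_jet d B c \<phi> k ?z - separable_jet d B c \<phi> k z\<bar>
       \<le> A * (2 * S) ^ d / \<delta> * (\<Sum>j\<in>{1..d}. \<bar>u j\<bar> powr (\<beta> j * (1 - weighted_order d \<beta> k)))"
    by (simp only: w_def)
qed

section \<open>Discretisation of sums of products\<close>

text \<open>
  The effect of discretisation on one factor of a product: cell integrals in the discrete coordinates,
  point values in the continuous ones.
\<close>

definition observed :: "nat \<Rightarrow> (nat \<Rightarrow> nat) \<Rightarrow> nat \<Rightarrow> (real \<Rightarrow> real) \<Rightarrow> real \<Rightarrow> real" where
  "observed dy N i f v = (if i \<le> dy then LINT t:cell1 (N i) v|lborel. f t else f v)"

text \<open>
  Integration against the factor of \<^const>\<open>obs_measure\<close> that belongs to coordinate \<open>i\<close>.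
\<close>

definition coordinate_total :: "nat \<Rightarrow> (nat \<Rightarrow> nat) \<Rightarrow> nat \<Rightarrow> (real \<Rightarrow> real) \<Rightarrow> real" where
  "coordinate_total dy N i F = (if i \<le> dy then (\<Sum>v\<in>support_points1 (N i). F v) else LINT t|lborel. F t)"

abbreviation joined :: "nat \<Rightarrow> nat \<Rightarrow> vec \<times> vec \<Rightarrow> vec" where
  "joined dy dx \<equiv> merge {1..dy} {dy+1..dy+dx}"

lemma product_lborel: "product_sigma_finite (\<lambda>_. lborel :: real measure)"
  by (simp add: product_sigma_finite_def lborel.sigma_finite_measure_axioms)

lemma cell1_measurable [measurable]: "cell1 M v \<in> sets borel"
  unfolding cell1_def by auto

lemma prod_joined:
  "(\<Prod>i\<in>{1..dy+dx}. f i (joined dy dx (y, x) i)) = (\<Prod>i\<in>{1..dy}. f i (y i)) * (\<Prod>i\<in>{dy+1..dy+dx}. f i (x i))"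
proof -
  have "{1..dy+dx} = {1..dy} \<union> {dy+1..dy+dx}" by auto
  then have "(\<Prod>i\<in>{1..dy+dx}. f i (joined dy dx (y, x) i)) =
     (\<Prod>i\<in>{1..dy}. f i (joined dy dx (y, x) i)) * (\<Prod>i\<in>{dy+1..dy+dx}. f i (joined dy dx (y, x) i))"
    by (simp add: prod.union_disjoint)
  also have "(\<Prod>i\<in>{1..dy}. f i (joined dy dx (y, x) i)) = (\<Prod>i\<in>{1..dy}. f i (y i))"
    by (intro prod.cong) (auto simp: merge_def)
  also have "(\<Prod>i\<in>{dy+1..dy+dx}. f i (joined dy dx (y, x) i)) = (\<Prod>i\<in>{dy+1..dy+dx}. f i (x i))"
    by (intro prod.cong) (auto simp: merge_def)
  finally show ?thesis .
qed

lemma prod_indicator_PiE: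
  assumes "finite I" "z \<in> vecs I"
  shows "indicator (PiE I A) z = (\<Prod>i\<in>I. indicator (A i) (z i) :: real)"
proof (cases "\<forall>i\<in>I. z i \<in> A i")
  case True
  then show ?thesis using assms by (auto simp: vecs_def PiE_def)
next
  case False
  then have "(\<Prod>i\<in>I. indicator (A i) (z i) :: real) = 0"
    using assms by (intro prod_zero) (auto simp: indicator_eq_0_iff)
  moreover have "z \<notin> PiE I A" using False by auto
  ultimately show ?thesis by simp
qed

lemma integrable_on_cell: "integrable lborel f \<Longrightarrow> set_integrable lborel (cell1 M v) (f :: real \<Rightarrow> real)"
  unfolding set_integrable_def by (intro integrable_mult_indicator) auto

text \<open>
  Integration over a product cell acts on each factor separately, by Fubini. The first claim is what
  additivity of the discretisation requires.
\<close>

lemma discretize_separable: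
  assumes B: "\<And>i. i \<in> {1..dy+dx} \<Longrightarrow> finite (B i)"
    and int: "\<And>i a. i \<in> {1..dy+dx} \<Longrightarrow> a \<in> B i \<Longrightarrow> integrable lborel (\<phi> i a (k i))"
  shows "set_integrable (lborel_vec {1..dy}) (cell dy N (fst w))
      (\<lambda>z. separable_jet (dy+dx) B c \<phi> k (joined dy dx (z, snd w)))"
    and "discretize dy dx N (separable_jet (dy+dx) B c \<phi> k) w =
    (\<Sum>a\<in>PiE {1..dy+dx} B. c a * (\<Prod>i\<in>{1..dy+dx}. observed dy N i (\<phi> i (a i) (k i)) (joined dy dx w i)))"
proof -
  interpret product_sigma_finite "\<lambda>_. lborel :: real measure" by (rule product_lborel)
  obtain y x where w: "w = (y, x)" by (cases w)
  let ?PB = "PiE {1..dy+dx} B"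
  let ?X = "\<lambda>a. \<Prod>i\<in>{dy+1..dy+dx}. \<phi> i (a i) (k i) (x i)"
  let ?f = "\<lambda>a i t. indicator (cell1 (N i) (y i)) t * \<phi> i (a i) (k i) t"
  have fi: "integrable lborel (?f a i)" if "a \<in> ?PB" "i \<in> {1..dy}" for a i
  proof -
    have i: "i \<in> {1..dy+dx}" using that by auto
    show ?thesis
      using integrable_on_cell[OF int[OF i PiE_mem[OF that(1) i]], of "N i" "y i"]
      by (simp add: set_integrable_def)
  qed
  have slice: "indicator (cell dy N y) z *\<^sub>R separable_jet (dy+dx) B c \<phi> k (joined dy dx (z, x))
      = (\<Sum>a\<in>?PB. c a * ?X a * (\<Prod>i\<in>{1..dy}. ?f a i (z i)))"
    if "z \<in> space (PiM {1..dy} (\<lambda>_. lborel))" for z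
  proof -
    have z: "z \<in> vecs {1..dy}" using that by (simp add: space_PiM vecs_def)
    have ind: "indicator (cell dy N y) z = (\<Prod>i\<in>{1..dy}. indicator (cell1 (N i) (y i)) (z i) :: real)"
      unfolding cell_def using z by (intro prod_indicator_PiE) auto
    show ?thesis
      unfolding separable_jet_def prod_joined[where f="\<lambda>i. \<phi> i (_ i) (k i)"] ind real_scaleR_def
        sum_distrib_left prod.distrib
      by (intro sum.cong refl) (simp only: ac_simps)
  qed
  have summand: "integrable (PiM {1..dy} (\<lambda>_. lborel)) (\<lambda>z. c a * ?X a * (\<Prod>i\<in>{1..dy}. ?f a i (z i)))"
    if "a \<in> ?PB" for a
    using fi[OF that] by (intro integrable_mult_right product_integrable_prod) auto
  have "integrable (PiM {1..dy} (\<lambda>_. lborel)) (\<lambda>z. indicator (cell dy N y) z *\<^sub>R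
      separable_jet (dy+dx) B c \<phi> k (joined dy dx (z, x)))"
    by (subst Bochner_Integration.integrable_cong[OF refl slice])
       (auto simp only: intro!: Bochner_Integration.integrable_sum summand)
  then show "set_integrable (lborel_vec {1..dy}) (cell dy N (fst w))
      (\<lambda>z. separable_jet (dy+dx) B c \<phi> k (joined dy dx (z, snd w)))"
    by (simp only: set_integrable_def lborel_vec_def w fst_conv snd_conv)
  have "discretize dy dx N (separable_jet (dy+dx) B c \<phi> k) w
     = (LINT z|PiM {1..dy} (\<lambda>_. lborel). (\<Sum>a\<in>?PB. c a * ?X a * (\<Prod>i\<in>{1..dy}. ?f a i (z i))))"
    unfolding w discretize_def prod.case set_lebesgue_integral_def lborel_vec_def
    by (rule Bochner_Integration.integral_cong[OF refl slice])
  also have "\<dots> = (\<Sum>a\<in>?PB. c a * ?X a * (\<Prod>i\<in>{1..dy}. LINT t|lborel. ?f a i t))"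
  proof (subst Bochner_Integration.integral_sum[OF summand])
    show "(\<Sum>a\<in>?PB. LINT z|PiM {1..dy} (\<lambda>_. lborel). c a * ?X a * (\<Prod>i\<in>{1..dy}. ?f a i (z i)))
      = (\<Sum>a\<in>?PB. c a * ?X a * (\<Prod>i\<in>{1..dy}. LINT t|lborel. ?f a i t))"
    proof (rule sum.cong[OF refl])
      fix a assume "a \<in> ?PB"
      from fi[OF this] show "(LINT z|PiM {1..dy} (\<lambda>_. lborel). c a * ?X a * (\<Prod>i\<in>{1..dy}. ?f a i (z i)))
         = c a * ?X a * (\<Prod>i\<in>{1..dy}. LINT t|lborel. ?f a i t)"
        by (subst integral_mult_right_zero, subst product_integral_prod) auto
    qed
  qed
  also have "\<dots> = (\<Sum>a\<in>?PB. c a * (\<Prod>i\<in>{1..dy+dx}. observed dy N i (\<phi> i (a i) (k i)) (joined dy dx w i)))"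
  proof (rule sum.cong[OF refl])
    fix a
    have "(\<Prod>i\<in>{1..dy}. observed dy N i (\<phi> i (a i) (k i)) (y i)) = (\<Prod>i\<in>{1..dy}. LINT t|lborel. ?f a i t)"
      by (intro prod.cong) (auto simp: observed_def set_lebesgue_integral_def)
    moreover have "(\<Prod>i\<in>{dy+1..dy+dx}. observed dy N i (\<phi> i (a i) (k i)) (x i)) = ?X a"
      by (intro prod.cong) (auto simp: observed_def)
    ultimately show "c a * ?X a * (\<Prod>i\<in>{1..dy}. LINT t|lborel. ?f a i t)
      = c a * (\<Prod>i\<in>{1..dy+dx}. observed dy N i (\<phi> i (a i) (k i)) (joined dy dx w i))"
      unfolding w prod_joined[where f="\<lambda>i. observed dy N i (\<phi> i (a i) (k i))"] by simp
  qed
  finally show "discretize dy dx N (separable_jet (dy+dx) B c \<phi> k) w =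
    (\<Sum>a\<in>?PB. c a * (\<Prod>i\<in>{1..dy+dx}. observed dy N i (\<phi> i (a i) (k i)) (joined dy dx w i)))" .
qed

lemma discretize_add:
  assumes "set_integrable (lborel_vec {1..dy}) (cell dy N (fst w)) (\<lambda>z. f (joined dy dx (z, snd w)))"
    and "set_integrable (lborel_vec {1..dy}) (cell dy N (fst w)) (\<lambda>z. g (joined dy dx (z, snd w)))"
  shows "discretize dy dx N (\<lambda>z. f z + g z) w = discretize dy dx N f w + discretize dy dx N g w"
  using set_integral_add(2)[OF assms] by (simp add: discretize_def case_prod_unfold)

lemma separable_jet_integral:
  assumes B: "\<And>i. i \<in> {1..d} \<Longrightarrow> finite (B i)"
    and int: "\<And>i a. i \<in> {1..d} \<Longrightarrow> a \<in> B i \<Longrightarrow> integrable lborel (\<phi> i a (k i))"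
  shows "integrable (lborel_vec {1..d}) (separable_jet d B c \<phi> k)"
    and "(LINT z|lborel_vec {1..d}. separable_jet d B c \<phi> k z) =
      (\<Sum>a\<in>PiE {1..d} B. c a * (\<Prod>i\<in>{1..d}. LINT t|lborel. \<phi> i (a i) (k i) t))"
proof -
  interpret product_sigma_finite "\<lambda>_. lborel :: real measure" by (rule product_lborel)
  have i: "integrable lborel (\<phi> i (a i) (k i))" if "a \<in> PiE {1..d} B" "i \<in> {1..d}" for a i
    by (rule int[OF that(2) PiE_mem[OF that]])
  have summand: "integrable (PiM {1..d} (\<lambda>_. lborel)) (\<lambda>z. c a * (\<Prod>i\<in>{1..d}. \<phi> i (a i) (k i) (z i)))"
    if "a \<in> PiE {1..d} B" for a
    by (intro integrable_mult_right product_integrable_prod i[OF that]) auto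
  show "integrable (lborel_vec {1..d}) (separable_jet d B c \<phi> k)"
    unfolding separable_jet_def[abs_def] lborel_vec_def by (intro Bochner_Integration.integrable_sum summand)
  have "(LINT z|lborel_vec {1..d}. separable_jet d B c \<phi> k z) =
    (\<Sum>a\<in>PiE {1..d} B. LINT z|PiM {1..d} (\<lambda>_. lborel). c a * (\<Prod>i\<in>{1..d}. \<phi> i (a i) (k i) (z i)))"
    unfolding separable_jet_def lborel_vec_def by (rule Bochner_Integration.integral_sum[OF summand])
  also have "\<dots> = (\<Sum>a\<in>PiE {1..d} B. c a * (\<Prod>i\<in>{1..d}. LINT t|lborel. \<phi> i (a i) (k i) t))"
  proof (rule sum.cong[OF refl])
    fix a assume "a \<in> PiE {1..d} B"
    from i[OF this] show "(LINT z|PiM {1..d} (\<lambda>_. lborel). c a * (\<Prod>i\<in>{1..d}. \<phi> i (a i) (k i) (z i)))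
        = c a * (\<Prod>i\<in>{1..d}. LINT t|lborel. \<phi> i (a i) (k i) t)"
      by (subst integral_mult_right_zero, subst product_integral_prod) auto
  qed
  finally show "(LINT z|lborel_vec {1..d}. separable_jet d B c \<phi> k z) =
      (\<Sum>a\<in>PiE {1..d} B. c a * (\<Prod>i\<in>{1..d}. LINT t|lborel. \<phi> i (a i) (k i) t))" .
qed

lemma finite_support_points1: "finite (support_points1 M)"
  by (simp add: support_points1_def)

lemma finite_support_points: "finite (support_points dy N)"
  unfolding support_points_def by (intro finite_PiE finite_support_points1) auto

lemma sigma_finite_lborel_vec: "finite I \<Longrightarrow> sigma_finite_measure (lborel_vec I)"
  unfolding lborel_vec_def
  by (rule product_sigma_finite.sigma_finite[OF product_lborel])

lemma pair_sigma_finite_obs: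
  "pair_sigma_finite (count_space (support_points dy N)) (lborel_vec {dy+1..dy+dx})"
  by (simp add: pair_sigma_finite_def sigma_finite_lborel_vec
      sigma_finite_measure_count_space_finite finite_support_points)

lemma sigma_finite_obs_measure: "sigma_finite_measure (obs_measure dy dx N)"
proof -
  interpret pair_sigma_finite "count_space (support_points dy N)" "lborel_vec {dy+1..dy+dx}"
    by (rule pair_sigma_finite_obs)
  show ?thesis unfolding obs_measure_def by (rule sigma_finite_measure_axioms)
qed

lemma obs_integral_prod:
  assumes F: "\<And>i. i \<in> {dy+1..dy+dx} \<Longrightarrow> integrable lborel (F i)"
  shows "integrable (obs_measure dy dx N) (\<lambda>w. \<Prod>i\<in>{1..dy+dx}. F i (joined dy dx w i))"
    and "(LINT w|obs_measure dy dx N. (\<Prod>i\<in>{1..dy+dx}. F i (joined dy dx w i))) =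
      (\<Prod>i\<in>{1..dy+dx}. coordinate_total dy N i (F i))"
proof -
  interpret product_sigma_finite "\<lambda>_. lborel :: real measure" by (rule product_lborel)
  let ?Y = "support_points dy N" and ?M = "lborel_vec {dy+1..dy+dx}"
  interpret P: pair_sigma_finite "count_space ?Y" ?M by (rule pair_sigma_finite_obs)
  let ?A = "\<lambda>y. \<Prod>i\<in>{1..dy}. F i (y i)" and ?B = "\<lambda>x. \<Prod>i\<in>{dy+1..dy+dx}. F i (x i)"
  have eq: "(\<lambda>w. \<Prod>i\<in>{1..dy+dx}. F i (joined dy dx w i)) = (\<lambda>(y, x). ?A y * ?B x)"
    by (auto simp only: prod_joined prod.case)
  have Bi: "integrable ?M ?B"
    unfolding lborel_vec_def using F by (intro product_integrable_prod) auto
  have [measurable]: "?B \<in> borel_measurable ?M" using Bi by (rule borel_measurable_integrable)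
  have m: "(\<lambda>(y, x). ?A y * ?B x) \<in> borel_measurable (count_space ?Y \<Otimes>\<^sub>M ?M)"
  proof -
    have "?A \<in> borel_measurable (count_space ?Y)" by simp
    note [measurable] = this
    have "(\<lambda>w. ?A (fst w) * ?B (snd w)) \<in> borel_measurable (count_space ?Y \<Otimes>\<^sub>M ?M)"
      by (intro borel_measurable_times measurable_compose[OF measurable_fst \<open>?A \<in> _\<close>]
            measurable_compose[OF measurable_snd \<open>?B \<in> _\<close>])
    then show ?thesis by (simp only: case_prod_unfold)
  qed
  have i: "integrable (count_space ?Y \<Otimes>\<^sub>M ?M) (\<lambda>(y, x). ?A y * ?B x)"
    using Bi by (intro P.Fubini_integrable m integrable_count_space finite_support_points) auto
  then show "integrable (obs_measure dy dx N) (\<lambda>w. \<Prod>i\<in>{1..dy+dx}. F i (joined dy dx w i))"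
    unfolding eq obs_measure_def .
  have "(LINT w|obs_measure dy dx N. (\<Prod>i\<in>{1..dy+dx}. F i (joined dy dx w i))) =
     (LINT y|count_space ?Y. LINT x|?M. ?A y * ?B x)"
    unfolding eq obs_measure_def using P.integral_fst'[OF i] by simp
  also have "\<dots> = (\<Sum>y\<in>?Y. ?A y) * (LINT x|?M. ?B x)"
    by (subst lebesgue_integral_count_space_finite[OF finite_support_points])
       (simp add: sum_distrib_right)
  also have "(LINT x|?M. ?B x) = (\<Prod>i\<in>{dy+1..dy+dx}. LINT t|lborel. F i t)"
    unfolding lborel_vec_def using F by (intro product_integral_prod) auto
  also have "(\<Sum>y\<in>?Y. ?A y) = (\<Prod>i\<in>{1..dy}. \<Sum>v\<in>support_points1 (N i). F i v)"
    unfolding support_points_def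
    by (intro prod_sum_PiE[symmetric] finite_support_points1) auto
  also have "(\<Prod>i\<in>{1..dy}. \<Sum>v\<in>support_points1 (N i). F i v) * (\<Prod>i\<in>{dy+1..dy+dx}. LINT t|lborel. F i t)
    = (\<Prod>i\<in>{1..dy}. coordinate_total dy N i (F i)) * (\<Prod>i\<in>{dy+1..dy+dx}. coordinate_total dy N i (F i))"
    by (intro arg_cong2[where f="(*)"] prod.cong) (auto simp: coordinate_total_def)
  also have "\<dots> = (\<Prod>i\<in>{1..dy+dx}. coordinate_total dy N i (F i))"
    by (subst prod.union_disjoint[symmetric]) (auto intro!: prod.cong)
  finally show "(LINT w|obs_measure dy dx N. (\<Prod>i\<in>{1..dy+dx}. F i (joined dy dx w i))) =
      (\<Prod>i\<in>{1..dy+dx}. coordinate_total dy N i (F i))" .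
qed

lemma tv_dist_eq_nn_integral:
  assumes "p \<in> borel_measurable (obs_measure dy dx N)" "q \<in> borel_measurable (obs_measure dy dx N)"
  shows "tv_dist dy dx N p q = (\<integral>\<^sup>+w. ennreal \<bar>p w - q w\<bar> \<partial>obs_measure dy dx N)"
proof -
  interpret P: pair_sigma_finite "count_space (support_points dy N)" "lborel_vec {dy+1..dy+dx}"
    by (rule pair_sigma_finite_obs)
  have "(\<lambda>w. ennreal \<bar>p w - q w\<bar>) \<in> borel_measurable (obs_measure dy dx N)" using assms by measurable
  from P.M2.nn_integral_fst[OF this[unfolded obs_measure_def]] show ?thesis
    unfolding tv_dist_def obs_measure_def
    by (simp add: nn_integral_count_space_finite finite_support_points)
qed

lemma mem_cell1_iff:
  assumes M: "M \<ge> 2" and k: "k \<in> {1..M}"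
  shows "t \<in> cell1 M ((real k - 1/2) / real M) \<longleftrightarrow>
     (k = 1 \<or> real k - 1 < t * real M) \<and> (k = M \<or> t * real M \<le> real k)"
proof -
  have M0: "real M > 0" using M by simp
  have 1: "(real k - 1/2) / real M = (1/2) / real M \<longleftrightarrow> k = 1" using M0 by (auto simp: field_simps)
  have 2: "(real k - 1/2) / real M = 1 - (1/2) / real M \<longleftrightarrow> k = M" using M0 by (auto simp: field_simps)
  have hi: "(real k - 1/2) / real M + (1/2) / real M = real k / real M"
    "(real k - 1/2) / real M - (1/2) / real M = (real k - 1) / real M"
    using M0 by (simp_all add: field_simps)
  have le: "t \<le> real k / real M \<longleftrightarrow> t * real M \<le> real k" "(real k - 1) / real M < t \<longleftrightarrow> real k - 1 < t * real M"
    using M0 by (simp_all add: field_simps)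
  show ?thesis unfolding cell1_def 1 2 hi using M le by auto
qed

text \<open>
  The cells partition the line, the two outer ones being half-lines. With a single support point
  the definition of the cell yields a half-line only, hence the assumption \<open>M \<ge> 2\<close>.
\<close>

lemma sum_cells:
  fixes f :: "real \<Rightarrow> real"
  assumes M: "M \<ge> 2" and f: "integrable lborel f"
  shows "(\<Sum>v\<in>support_points1 M. LINT t:cell1 M v|lborel. f t) = (LINT t|lborel. f t)"
proof -
  let ?v = "\<lambda>k. (real k - 1/2) / real M"
  have inj: "inj_on ?v {1..M}" using M by (auto simp: inj_on_def)
  have "(\<Sum>v\<in>support_points1 M. LINT t:cell1 M v|lborel. f t) = (\<Sum>k\<in>{1..M}. LINT t:cell1 M (?v k)|lborel. f t)"
    unfolding support_points1_def by (subst sum.reindex[OF inj]) simp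
  also have "\<dots> = (LINT t:(\<Union>k\<in>{1..M}. cell1 M (?v k))|lborel. f t)"
  proof (rule set_integral_finite_Union[symmetric])
    have "cell1 M (?v k) \<inter> cell1 M (?v l) = {}" if "k \<in> {1..M}" "l \<in> {1..M}" "k < l" for k l
    proof -
      have "real k \<le> real l - 1" using that(3) by linarith
      then show ?thesis using mem_cell1_iff[OF M that(1)] mem_cell1_iff[OF M that(2)] that by fastforce
    qed
    then show "disjoint_family_on (\<lambda>k. cell1 M (?v k)) {1..M}"
      unfolding disjoint_family_on_def by (metis Int_commute linorder_neqE_nat)
  qed (use f in \<open>auto intro!: integrable_on_cell\<close>)
  also have "(\<Union>k\<in>{1..M}. cell1 M (?v k)) = UNIV"
  proof -
    have "\<exists>k\<in>{1..M}. t \<in> cell1 M (?v k)" for t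
    proof -
      consider "t * real M \<le> 1" | "t * real M > real M - 1" | "1 < t * real M" "t * real M \<le> real M - 1" by linarith
      then show ?thesis
      proof cases
        case 1
        then show ?thesis using mem_cell1_iff[OF M, of 1 t] M by (intro bexI[of _ 1]) auto
      next
        case 2
        then show ?thesis using mem_cell1_iff[OF M, of M t] M by (intro bexI[of _ M]) auto
      next
        case 3
        have "real_of_int \<lceil>t * real M\<rceil> - 1 < t * real M" "t * real M \<le> real_of_int \<lceil>t * real M\<rceil>"
          using ceiling_correct[of "t * real M"] by auto
        then obtain z :: int where z: "real_of_int z - 1 < t * real M" "t * real M \<le> real_of_int z" by blast
        have "1 \<le> z" "z \<le> int M" using z 3 by linarith+
        then have k: "nat z \<in> {1..M}" "real (nat z) - 1 < t * real M" "t * real M \<le> real (nat z)"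
          using z by auto
        then show ?thesis using mem_cell1_iff[OF M k(1), of t] by (intro bexI[of _ "nat z"]) auto
      qed
    qed
    then show ?thesis by blast
  qed
  also have "(LINT t:UNIV|lborel. f t) = (LINT t|lborel. f t)" by (simp add: set_lebesgue_integral_def)
  finally show ?thesis .
qed

lemma coordinate_total_observed:
  assumes "i \<le> dy \<Longrightarrow> N i \<ge> 2" "integrable lborel f"
  shows "coordinate_total dy N i (observed dy N i f) = (LINT t|lborel. f t)"
  using assms unfolding coordinate_total_def observed_def by (auto intro: sum_cells)

lemma sum_observed_le:
  fixes f :: "'a \<Rightarrow> real \<Rightarrow> real"
  assumes "finite B" "\<And>a. a \<in> B \<Longrightarrow> integrable lborel (f a)" "integrable lborel g"
    and le: "\<And>t. (\<Sum>a\<in>B. \<bar>f a t\<bar>) \<le> C * g t"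
  shows "(\<Sum>a\<in>B. \<bar>observed dy N i (f a) v\<bar>) \<le> C * observed dy N i g v"
proof (cases "i \<le> dy")
  case True
  let ?c = "cell1 (N i) v"
  have "(\<Sum>a\<in>B. \<bar>observed dy N i (f a) v\<bar>) \<le> (\<Sum>a\<in>B. LINT t:?c|lborel. \<bar>f a t\<bar>)"
  proof (rule sum_mono)
    fix a assume "a \<in> B"
    from set_integral_norm_bound[OF integrable_on_cell[OF assms(2)[OF this]], of "N i" v]
    show "\<bar>observed dy N i (f a) v\<bar> \<le> (LINT t:?c|lborel. \<bar>f a t\<bar>)"
      using True by (simp add: observed_def)
  qed
  also have "\<dots> = (LINT t:?c|lborel. (\<Sum>a\<in>B. \<bar>f a t\<bar>))"
    unfolding set_lebesgue_integral_def scaleR_sum_right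
  proof (rule Bochner_Integration.integral_sum[symmetric])
    fix a assume "a \<in> B"
    then have "integrable lborel (\<lambda>t. \<bar>f a t\<bar>)" using assms(2) by auto
    from integrable_on_cell[OF this] show "integrable lborel (\<lambda>t. indicator ?c t *\<^sub>R \<bar>f a t\<bar>)"
      by (simp add: set_integrable_def)
  qed
  also have "\<dots> \<le> (LINT t:?c|lborel. C * g t)"
    using assms by (intro set_integral_mono integrable_on_cell le) auto
  also have "\<dots> = C * observed dy N i g v" using True by (simp add: observed_def)
  finally show ?thesis .
next
  case False
  then show ?thesis using le by (simp add: observed_def)
qed

lemma sum_prod_PiE_le:
  fixes F :: "nat \<Rightarrow> 'a \<Rightarrow> real \<Rightarrow> real"
  assumes B: "\<And>i. i \<in> {1..d} \<Longrightarrow> finite (B i)"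
    and le: "\<And>i t. i \<in> {1..d} \<Longrightarrow> (\<Sum>a\<in>B i. \<bar>F i a t\<bar>) \<le> C * G i t"
  shows "(\<Sum>a\<in>PiE {1..d} B. \<bar>\<Prod>i\<in>{1..d}. F i (a i) (z i)\<bar>) \<le> C ^ d * (\<Prod>i\<in>{1..d}. G i (z i))"
proof -
  have "(\<Sum>a\<in>PiE {1..d} B. \<bar>\<Prod>i\<in>{1..d}. F i (a i) (z i)\<bar>) = (\<Prod>i\<in>{1..d}. \<Sum>a\<in>B i. \<bar>F i a (z i)\<bar>)"
    unfolding abs_prod using B by (intro prod_sum_PiE[symmetric]) auto
  also have "\<dots> \<le> (\<Prod>i\<in>{1..d}. C * G i (z i))"
    using le by (intro prod_mono) (auto intro: sum_nonneg)
  also have "\<dots> = C ^ d * (\<Prod>i\<in>{1..d}. G i (z i))" by (simp add: prod.distrib)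
  finally show ?thesis .
qed

section \<open>Waves and the base density in one coordinate\<close>

lemma integral_rescaled:
  fixes f :: "real \<Rightarrow> real"
  assumes f: "integrable lborel f" and h: "h > 0"
  shows "integrable lborel (\<lambda>t. f (t / h - b))" "(LINT t|lborel. f (t / h - b)) = h * (LINT t|lborel. f t)"
proof -
  have eq: "(\<lambda>t. f (t / h - b)) = (\<lambda>t. f (- b + (1 / h) * t))" by (simp add: add.commute)
  show "integrable lborel (\<lambda>t. f (t / h - b))"
    unfolding eq using f h by (intro lborel_integrable_real_affine) auto
  have "(LINT t|lborel. f t) = \<bar>1 / h\<bar> *\<^sub>R (LINT t|lborel. f (- b + (1 / h) * t))"
    using h by (intro lborel_integral_real_affine) auto
  then show "(LINT t|lborel. f (t / h - b)) = h * (LINT t|lborel. f t)"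
    unfolding eq using h by simp
qed

text \<open>
  The \<open>k\<close>-th derivative of the \<open>a\<close>-th wave of half-width \<open>h\<close>, which lives on \<open>(2 a h, (2 a + 2) h)\<close>.
\<close>

definition wave :: "(nat \<Rightarrow> real \<Rightarrow> real) \<Rightarrow> real \<Rightarrow> nat \<Rightarrow> nat \<Rightarrow> real \<Rightarrow> real" where
  "wave \<psi> h a k t = (\<psi> k (t / h - real (2 * a)) - \<psi> k (t / h - real (2 * a + 1))) / h ^ k"

text \<open>
  The \<open>k\<close>-th derivative of the bump stretched to width \<open>\<rho>\<close>. The shift by \<open>1/3\<close> puts the unit interval into
  the middle third of the bump if \<open>\<rho> \<ge> 3\<close>, where the bump is bounded away from zero.
\<close>

definition base :: "(nat \<Rightarrow> real \<Rightarrow> real) \<Rightarrow> real \<Rightarrow> nat \<Rightarrow> real \<Rightarrow> real" where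
  "base \<psi> \<rho> k t = \<psi> k (t / \<rho> + 1/3) / \<rho> ^ Suc k"

lemma bump_function_S_nonneg: "bump_function K S c \<psi> \<Longrightarrow> 0 \<le> S"
  unfolding bump_function_def by (meson abs_ge_zero le0 order_trans)

lemma DERIV_rescaled:
  assumes "\<And>t. (f has_real_derivative f' t) (at t)"
  shows "((\<lambda>t. f (t / h + b)) has_real_derivative f' (t / h + b) / h) (at t)"
proof -
  have "((\<lambda>t. t / h + b) has_real_derivative 1 / h + 0) (at t)"
    by (intro DERIV_add DERIV_cdivide DERIV_ident DERIV_const)
  from DERIV_chain2[OF assms this] show ?thesis by simp
qed

text \<open>
  All \<open>m\<close> waves of half-width \<open>h\<close> fit into the unit interval; in a discrete coordinate every half-wave
  spans exactly \<open>q\<close> cells.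
\<close>

definition well_placed :: "nat \<Rightarrow> (nat \<Rightarrow> nat) \<Rightarrow> nat \<Rightarrow> real \<Rightarrow> nat \<Rightarrow> bool" where
  "well_placed dy N i h m \<longleftrightarrow> h > 0 \<and> 2 * real m * h \<le> 1 \<and>
     (i \<le> dy \<longrightarrow> N i \<ge> 2 \<and> (\<exists>q\<ge>1. h = real q / real (N i) \<and> 2 * m * q \<le> N i))"

context
  fixes K :: nat and S c :: real and \<psi> :: "nat \<Rightarrow> real \<Rightarrow> real"
  assumes bump: "bump_function K S c \<psi>"
begin

lemma bump_facts:
  shows "k \<le> K \<Longrightarrow> (\<psi> k has_real_derivative \<psi> (Suc k) t) (at t)"
    and "\<psi> k t \<noteq> 0 \<Longrightarrow> 0 < t \<and> t < 1"
    and "k \<le> Suc K \<Longrightarrow> \<bar>\<psi> k t\<bar> \<le> S"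
    and "0 \<le> \<psi> 0 t" and "1/3 \<le> t \<Longrightarrow> t \<le> 2/3 \<Longrightarrow> c \<le> \<psi> 0 t"
    and "integrable lborel (\<psi> 0)" and "(LINT t|lborel. \<psi> 0 t) = 1" and "c > 0"
  using bump unfolding bump_function_def by auto

lemma DERIV_wave: "k \<le> K \<Longrightarrow> (wave \<psi> h a k has_real_derivative wave \<psi> h a (Suc k) t) (at t)"
proof -
  assume k: "k \<le> K"
  have *: "((\<lambda>t. \<psi> k (t / h - b)) has_real_derivative \<psi> (Suc k) (t / h - b) / h) (at t)" for b
    using DERIV_rescaled[OF bump_facts(1)[OF k], of h "- b" t] by simp
  have "((\<lambda>t. (\<psi> k (t / h - real (2 * a)) - \<psi> k (t / h - real (2 * a + 1))) / h ^ k) has_real_derivative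
     (\<psi> (Suc k) (t / h - real (2 * a)) / h - \<psi> (Suc k) (t / h - real (2 * a + 1)) / h) / h ^ k) (at t)"
    by (intro DERIV_cdivide DERIV_diff *)
  then show ?thesis by (simp add: wave_def[abs_def] diff_divide_distrib)
qed

lemma DERIV_base: "k \<le> K \<Longrightarrow> (base \<psi> \<rho> k has_real_derivative base \<psi> \<rho> (Suc k) t) (at t)"
proof -
  assume k: "k \<le> K"
  have "((\<lambda>t. \<psi> k (t / \<rho> + 1/3) / \<rho> ^ Suc k) has_real_derivative
     (\<psi> (Suc k) (t / \<rho> + 1/3) / \<rho>) / \<rho> ^ Suc k) (at t)"
    by (intro DERIV_cdivide DERIV_rescaled bump_facts(1)[OF k])
  then show ?thesis by (simp add: base_def[abs_def])
qed

lemma wave_support: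
  assumes "wave \<psi> h a k t \<noteq> 0"
  shows "real (2 * a) < t / h" "t / h < real (2 * a + 2)"
proof -
  have "\<psi> k (t / h - real (2 * a)) \<noteq> 0 \<or> \<psi> k (t / h - real (2 * a + 1)) \<noteq> 0"
    using assms by (auto simp: wave_def)
  then show "real (2 * a) < t / h" "t / h < real (2 * a + 2)"
    using bump_facts(2)[of k "t / h - real (2 * a)"] bump_facts(2)[of k "t / h - real (2 * a + 1)"] by auto
qed

lemma wave_index:
  assumes "wave \<psi> h a k t \<noteq> 0"
  shows "a = nat \<lfloor>t / h / 2\<rfloor>"
proof -
  have "\<lfloor>t / h / 2\<rfloor> = int a"
    using wave_support[OF assms] by (intro floor_unique) auto
  then show ?thesis by simp
qed

lemma abs_wave_le:
  assumes h: "h > 0" and k: "k \<le> Suc K"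
  shows "\<bar>wave \<psi> h a k t\<bar> \<le> S / h ^ k"
proof -
  let ?x = "\<psi> k (t / h - real (2 * a))" and ?y = "\<psi> k (t / h - real (2 * a + 1))"
  have "?x = 0 \<or> ?y = 0"
    using bump_facts(2)[of k "t / h - real (2 * a)"] bump_facts(2)[of k "t / h - real (2 * a + 1)"] by force
  moreover have "\<bar>?x\<bar> \<le> S" "\<bar>?y\<bar> \<le> S" by (intro bump_facts(3) k)+
  ultimately have "\<bar>?x - ?y\<bar> \<le> S" by auto
  then show ?thesis using h by (simp add: wave_def divide_right_mono)
qed

lemma sum_abs_wave_le:
  assumes h: "h > 0" and k: "k \<le> Suc K"
  shows "(\<Sum>a<m. \<bar>wave \<psi> h a k t\<bar>) \<le> S / h ^ k"
proof -
  let ?a = "nat \<lfloor>t / h / 2\<rfloor>"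
  have S: "0 \<le> S / h ^ k" using bump_function_S_nonneg[OF bump] h by simp
  have "(\<Sum>a<m. \<bar>wave \<psi> h a k t\<bar>) \<le> (\<Sum>a<m. if a = ?a then S / h ^ k else 0)"
  proof (rule sum_mono)
    fix a
    show "\<bar>wave \<psi> h a k t\<bar> \<le> (if a = ?a then S / h ^ k else 0)"
      using wave_index[of h a k t] abs_wave_le[OF h k, of a t] by (cases "wave \<psi> h a k t = 0") (use S in auto)
  qed
  also have "\<dots> \<le> S / h ^ k" using S by (subst sum.delta) auto
  finally show ?thesis .
qed

lemma wave_integrals:
  assumes h: "h > 0"
  shows "integrable lborel (wave \<psi> h a 0)" "(LINT t|lborel. wave \<psi> h a 0 t) = 0"
    "(LINT t|lborel. \<bar>wave \<psi> h a 0 t\<bar>) = 2 * h"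
proof -
  note r = integral_rescaled[OF bump_facts(6) h]
  have w: "wave \<psi> h a 0 = (\<lambda>t. \<psi> 0 (t / h - real (2 * a)) - \<psi> 0 (t / h - real (2 * a + 1)))"
    by (simp add: wave_def fun_eq_iff)
  show "integrable lborel (wave \<psi> h a 0)" unfolding w by (intro Bochner_Integration.integrable_diff r)
  show "(LINT t|lborel. wave \<psi> h a 0 t) = 0"
    unfolding w by (subst Bochner_Integration.integral_diff) (auto simp only: r bump_facts(7))
  have abs: "\<bar>wave \<psi> h a 0 t\<bar> = \<psi> 0 (t / h - real (2 * a)) + \<psi> 0 (t / h - real (2 * a + 1))" for t
  proof -
    have "\<psi> 0 (t / h - real (2 * a)) = 0 \<or> \<psi> 0 (t / h - real (2 * a + 1)) = 0"
      using bump_facts(2)[of 0 "t / h - real (2 * a)"] bump_facts(2)[of 0 "t / h - real (2 * a + 1)"] by force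
    then show ?thesis
      using bump_facts(4)[of "t / h - real (2 * a)"] bump_facts(4)[of "t / h - real (2 * a + 1)"]
      unfolding w by auto
  qed
  show "(LINT t|lborel. \<bar>wave \<psi> h a 0 t\<bar>) = 2 * h"
    unfolding abs by (subst Bochner_Integration.integral_add) (auto simp only: r bump_facts(7))
qed

lemma base_nonneg: "\<rho> > 0 \<Longrightarrow> 0 \<le> base \<psi> \<rho> 0 t"
  using bump_facts(4) by (simp add: base_def)

lemma base_integrals:
  assumes \<rho>: "\<rho> > 0"
  shows "integrable lborel (base \<psi> \<rho> 0)" "(LINT t|lborel. base \<psi> \<rho> 0 t) = 1"
proof -
  note r = integral_rescaled[OF bump_facts(6) \<rho>, of "- 1/3"]
  have w: "base \<psi> \<rho> 0 = (\<lambda>t. \<psi> 0 (t / \<rho> - (- 1/3)) / \<rho>)"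
    by (simp add: base_def fun_eq_iff)
  show "integrable lborel (base \<psi> \<rho> 0)" unfolding w by (intro integrable_divide r)
  show "(LINT t|lborel. base \<psi> \<rho> 0 t) = 1"
    unfolding w by (subst integral_divide_zero) (use r(2) bump_facts(7) \<rho> in simp)
qed

lemma abs_base_le: "\<rho> > 0 \<Longrightarrow> k \<le> Suc K \<Longrightarrow> \<bar>base \<psi> \<rho> k t\<bar> \<le> (S / \<rho>) / \<rho> ^ k"
  using bump_facts(3)[of k "t / \<rho> + 1/3"]
  by (simp add: base_def abs_mult divide_right_mono abs_divide mult.commute)

text \<open>
  Being pointwise, this bound survives the passage to cell integrals, whatever the cells are.
\<close>

lemma waves_dominated_by_base:
  assumes h: "h > 0" and m: "2 * real m * h \<le> 1" and \<rho>: "\<rho> \<ge> 3"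
  shows "(\<Sum>a<m. \<bar>wave \<psi> h a 0 t\<bar>) \<le> (S * \<rho> / c) * base \<psi> \<rho> 0 t"
proof (cases "\<exists>a<m. wave \<psi> h a 0 t \<noteq> 0")
  case True
  then obtain a where a: "a < m" "wave \<psi> h a 0 t \<noteq> 0" by auto
  have "real a + 1 \<le> real m" using a(1) by linarith
  then have "t / h < 2 * real m" using wave_support[OF a(2)] by simp
  then have "t < 2 * real m * h" using h by (simp add: field_simps)
  moreover have "0 < t / h" using wave_support(1)[OF a(2)] by (rule le_less_trans[rotated]) simp
  then have "0 < t" using h by (simp add: zero_less_divide_iff)
  ultimately have "1/3 \<le> t / \<rho> + 1/3" "t / \<rho> + 1/3 \<le> 2/3"
    using m \<rho> by (auto simp: field_simps)
  then have c: "c \<le> \<psi> 0 (t / \<rho> + 1/3)" by (rule bump_facts(5))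
  have "(\<Sum>a<m. \<bar>wave \<psi> h a 0 t\<bar>) \<le> S" using sum_abs_wave_le[OF h, of 0 t m] by simp
  also have "\<dots> \<le> S * (\<psi> 0 (t / \<rho> + 1/3) / c)"
    using c bump_facts(8) bump_function_S_nonneg[OF bump]
      mult_left_mono[of 1 "\<psi> 0 (t / \<rho> + 1/3) / c" S] by simp
  also have "\<dots> = (S * \<rho> / c) * base \<psi> \<rho> 0 t" using \<rho> by (simp add: base_def)
  finally show ?thesis .
next
  case False
  then have "(\<Sum>a<m. \<bar>wave \<psi> h a 0 t\<bar>) = 0" by simp
  then show ?thesis
    using base_nonneg[of \<rho> t] \<rho> bump_facts(8) bump_function_S_nonneg[OF bump] by simp
qed

text \<open>
  A half-wave is a union of cells, so a cell determines the half-wave that it can meet. The outer cells reach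
  beyond the unit interval, but no half-wave does.
\<close>

lemma half_wave_in_cell:
  assumes M: "M \<ge> 2" and k: "k \<in> {1..M}" and t: "t \<in> cell1 M ((real k - 1/2) / real M)"
    and q: "q \<ge> 1" and j: "(j + 1) * q \<le> M"
    and nz: "\<psi> 0 (t / (real q / real M) - real j) \<noteq> 0"
  shows "j = (k - 1) div q"
proof -
  have M0: "real M > 0" "real q > 0" using M q by auto
  have "0 < t / (real q / real M) - real j" "t / (real q / real M) - real j < 1"
    using bump_facts(2)[OF nz] by auto
  then have lo: "real (j * q) < t * real M" and hi: "t * real M < real ((j + 1) * q)"
    using M0 by (auto simp: field_simps)
  have cell: "k = 1 \<or> real k - 1 < t * real M" "k = M \<or> t * real M \<le> real k"
    using t mem_cell1_iff[OF M k] by auto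
  have "j * q < k"
  proof (cases "k = M")
    case True
    then show ?thesis using j q by simp
  next
    case False
    then have "real (j * q) < real k" using cell lo by linarith
    then show ?thesis by (simp only: of_nat_less_iff)
  qed
  moreover have "k - 1 < (j + 1) * q"
  proof (cases "k = 1")
    case True
    then show ?thesis using q by simp
  next
    case False
    then have "real (k - 1) < real ((j + 1) * q)" using cell hi k by (simp add: of_nat_diff)
    then show ?thesis by (simp only: of_nat_less_iff)
  qed
  ultimately show ?thesis
    using q by (intro div_nat_eqI[symmetric]) (auto simp: mult.commute)
qed

text \<open>
  Hence on a single cell only one wave is present and it has constant sign, given by the parity of the half-wave.
\<close>

lemma wave_on_cell:
  assumes wp: "well_placed dy N i h m" and i: "i \<le> dy" and v: "v \<in> support_points1 (N i)"
  shows "\<exists>a0 s. (s = 1 \<or> s = - 1) \<and> (\<forall>a<m. \<forall>t\<in>cell1 (N i) v. \<bar>wave \<psi> h a 0 t\<bar> = s * wave \<psi> h a 0 t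
      \<and> (wave \<psi> h a 0 t \<noteq> 0 \<longrightarrow> a = a0))"
proof -
  obtain q where N: "N i \<ge> 2" and q: "q \<ge> 1" "h = real q / real (N i)" "2 * m * q \<le> N i"
    using wp i by (auto simp: well_placed_def)
  obtain k where k: "k \<in> {1..N i}" "v = (real k - 1/2) / real (N i)"
    using v by (auto simp: support_points1_def)
  let ?J = "(k - 1) div q"
  have half: "j = ?J" if "j < 2 * m" "t \<in> cell1 (N i) v" "\<psi> 0 (t / h - real j) \<noteq> 0" for j t
  proof (rule half_wave_in_cell[OF N k(1) _ q(1)])
    show "(j + 1) * q \<le> N i"
      using that(1) q(3) by (intro order_trans[OF mult_right_mono[of "j + 1" "2 * m" q]]) auto
  qed (use that k q in auto)
  have "\<bar>wave \<psi> h a 0 t\<bar> = (if even ?J then 1 else - 1) * wave \<psi> h a 0 t \<and> (wave \<psi> h a 0 t \<noteq> 0 \<longrightarrow> a = ?J div 2)"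
    if a: "a < m" and t: "t \<in> cell1 (N i) v" for a t
  proof -
    let ?x = "\<psi> 0 (t / h - real (2 * a))" and ?y = "\<psi> 0 (t / h - real (2 * a + 1))"
    have w: "wave \<psi> h a 0 t = ?x - ?y" by (simp add: wave_def)
    have x: "?x \<noteq> 0 \<Longrightarrow> 2 * a = ?J" and y: "?y \<noteq> 0 \<Longrightarrow> 2 * a + 1 = ?J"
      using half[of "2 * a" t] half[of "2 * a + 1" t] a t by auto
    have nn: "0 \<le> ?x" "0 \<le> ?y" by (rule bump_facts(4))+
    consider "?x = 0" "?y = 0" | "2 * a = ?J" "?y = 0" | "2 * a + 1 = ?J" "?x = 0"
      using x y by (metis n_not_Suc_n Suc_eq_plus1)
    then show ?thesis
    proof cases
      case 1 then show ?thesis unfolding w by simp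
    next
      case 2
      have "even ?J" "a = ?J div 2" unfolding 2(1)[symmetric] by simp_all
      then show ?thesis unfolding w 2(2) using nn by simp
    next
      case 3
      have "odd ?J" "a = ?J div 2" unfolding 3(1)[symmetric] by simp_all
      then show ?thesis unfolding w 3(2) using nn by simp
    qed
  qed
  then show ?thesis by (intro exI[of _ "?J div 2"] exI[of _ "if even ?J then 1 else - 1"]) auto
qed

lemma observed_wave_disjoint:
  assumes wp: "well_placed dy N i h m" and v: "i \<le> dy \<Longrightarrow> v \<in> support_points1 (N i)"
    and a: "a < m" "a' < m"
    and nz: "observed dy N i (wave \<psi> h a 0) v \<noteq> 0" "observed dy N i (wave \<psi> h a' 0) v \<noteq> 0"
  shows "a = a'"
proof (cases "i \<le> dy")
  case True
  obtain a0 where a0: "\<And>a t. a < m \<Longrightarrow> t \<in> cell1 (N i) v \<Longrightarrow> wave \<psi> h a 0 t \<noteq> 0 \<Longrightarrow> a = a0"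
    using wave_on_cell[OF wp True v[OF True]] by blast
  have "a = a0" if "a < m" "observed dy N i (wave \<psi> h a 0) v \<noteq> 0" for a
  proof (rule ccontr)
    assume "a \<noteq> a0"
    then have "(\<lambda>t. indicator (cell1 (N i) v) t *\<^sub>R wave \<psi> h a 0 t) = (\<lambda>_. 0)"
      using a0[OF that(1)] by (auto simp: fun_eq_iff indicator_def)
    then have "observed dy N i (wave \<psi> h a 0) v = 0"
      using True by (simp only: observed_def set_lebesgue_integral_def if_True Bochner_Integration.integral_zero)
    then show False using that(2) by simp
  qed
  then show ?thesis using a nz by blast
next
  case False
  then show ?thesis using nz wave_index[of h a 0 v] wave_index[of h a' 0 v] by (simp add: observed_def)
qed

text \<open>
  No mass is lost by discretisation: without sign changes inside a cell the absolute value may be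
  taken before integrating over the cell.
\<close>

lemma coordinate_total_abs_observed_wave:
  assumes wp: "well_placed dy N i h m" and a: "a < m"
  shows "coordinate_total dy N i (\<lambda>v. \<bar>observed dy N i (wave \<psi> h a 0) v\<bar>) = 2 * h"
proof (cases "i \<le> dy")
  case True
  have h: "h > 0" and N: "N i \<ge> 2" using wp True by (auto simp: well_placed_def)
  have "\<bar>observed dy N i (wave \<psi> h a 0) v\<bar> = observed dy N i (\<lambda>t. \<bar>wave \<psi> h a 0 t\<bar>) v"
    if v: "v \<in> support_points1 (N i)" for v
  proof -
    obtain s where s: "s = 1 \<or> s = - 1" "\<And>t. t \<in> cell1 (N i) v \<Longrightarrow> \<bar>wave \<psi> h a 0 t\<bar> = s * wave \<psi> h a 0 t"
      using wave_on_cell[OF wp True v] a by blast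
    have "(LINT t:cell1 (N i) v|lborel. \<bar>wave \<psi> h a 0 t\<bar>) = (LINT t:cell1 (N i) v|lborel. s * wave \<psi> h a 0 t)"
      by (rule set_lebesgue_integral_cong) (auto simp: s(2))
    also have "\<dots> = s * (LINT t:cell1 (N i) v|lborel. wave \<psi> h a 0 t)" by simp
    finally have eq: "observed dy N i (\<lambda>t. \<bar>wave \<psi> h a 0 t\<bar>) v = s * observed dy N i (wave \<psi> h a 0) v"
      using True by (simp only: observed_def if_True)
    have "0 \<le> observed dy N i (\<lambda>t. \<bar>wave \<psi> h a 0 t\<bar>) v"
      using True by (auto simp: observed_def set_lebesgue_integral_def intro!: integral_nonneg)
    then show ?thesis using eq s(1) by auto
  qed
  then have "coordinate_total dy N i (\<lambda>v. \<bar>observed dy N i (wave \<psi> h a 0) v\<bar>)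
     = coordinate_total dy N i (observed dy N i (\<lambda>t. \<bar>wave \<psi> h a 0 t\<bar>))"
    using True unfolding coordinate_total_def by (auto intro: sum.cong)
  also have "\<dots> = 2 * h"
    using wave_integrals[OF h, of a] N by (subst coordinate_total_observed) auto
  finally show ?thesis .
next
  case False
  then show ?thesis
    using wp wave_integrals[of h a] by (simp add: coordinate_total_def observed_def well_placed_def)
qed

end

section \<open>The rate and the effective sample size\<close>

text \<open>
  In this form the empty index set is no exception.
\<close>

lemma rate_exponent_eq:
  assumes I: "finite I" and \<beta>: "\<And>i. i \<in> I \<Longrightarrow> \<beta> i > 0"
  shows "rate_exponent \<beta> I = 1 / (2 + (\<Sum>i\<in>I. 1 / \<beta> i))"
proof (cases "I = {}")
  case True
  then show ?thesis by (simp add: rate_exponent_def)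
next
  case False
  then have s: "(\<Sum>i\<in>I. 1 / \<beta> i) > 0" using I \<beta> by (intro sum_pos) auto
  have "inverse s / (2 * inverse s + 1) = 1 / (2 + s)" if "s > 0" for s :: real
    using that by (simp add: field_simps)
  from this[OF s] show ?thesis
    using False by (simp only: rate_exponent_def agg_smoothness_def inverse_eq_divide if_False)
qed

context
  fixes dy dx n :: nat and \<beta> :: "nat \<Rightarrow> real" and N :: "nat \<Rightarrow> nat"
  assumes \<beta>: "\<And>i. i \<in> {1..dy+dx} \<Longrightarrow> \<beta> i > 0"
    and N: "\<And>j. j \<in> {1..dy} \<Longrightarrow> N j \<ge> 2" and n: "n \<ge> 1"
begin

lemma rate_le:
  assumes J: "J \<subseteq> {1..dy}"
  shows "rate dy dx \<beta> N n \<le> (real (\<Prod>i\<in>J. N i) / real n) powr (1 / (2 + (\<Sum>i\<in>{1..dy+dx} - J. 1 / \<beta> i)))"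
proof -
  have "rate_exponent \<beta> ({1..dy+dx} - J) = 1 / (2 + (\<Sum>i\<in>{1..dy+dx} - J. 1 / \<beta> i))"
    using \<beta> by (intro rate_exponent_eq) auto
  then show ?thesis unfolding rate_def using J by (intro Min_le) (auto simp del: of_nat_prod intro!: image_eqI[of _ _ J])
qed

lemma rate_pos: "rate dy dx \<beta> N n > 0"
proof -
  have "rate dy dx \<beta> N n \<in> (\<lambda>J. (real (\<Prod>i\<in>J. N i) / real n) powr rate_exponent \<beta> ({1..dy+dx} - J)) ` Pow {1..dy}"
    unfolding rate_def by (intro Min_in) auto
  then obtain J where J: "J \<subseteq> {1..dy}"
    "rate dy dx \<beta> N n = (real (\<Prod>i\<in>J. N i) / real n) powr rate_exponent \<beta> ({1..dy+dx} - J)" by auto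
  have "(\<Prod>i\<in>J. N i) > 0" using N J(1) by (intro prod_pos) (force simp: subset_iff)
  then show ?thesis using J(2) n by (simp del: of_nat_prod)
qed

lemma rate_le_1: "rate dy dx \<beta> N n \<le> 1"
proof -
  have "(\<Sum>i\<in>{1..dy+dx}. 1 / \<beta> i) \<ge> 0" using \<beta> by (intro sum_nonneg) (auto simp: less_imp_le)
  then have "(1 / real n) powr (1 / (2 + (\<Sum>i\<in>{1..dy+dx}. 1 / \<beta> i))) \<le> 1 powr (1 / (2 + (\<Sum>i\<in>{1..dy+dx}. 1 / \<beta> i)))"
    using n by (intro powr_mono2) auto
  then show ?thesis using rate_le[of "{}"] by simp
qed

text \<open>
  The term for \<open>J\<close> in the minimum is the solution \<open>r\<close> of
  \<open>n r powr (2 + (\<Sum>i\<in>J\<^sup>c. 1 / \<beta>\<^sub>i)) = N\<^sub>J\<close>, the left-hand side being increasing in \<open>r\<close>.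
\<close>

lemma sample_size_le_rate:
  assumes J: "J \<subseteq> {1..dy}" and \<delta>: "0 < \<delta>" "\<delta> \<le> rate dy dx \<beta> N n"
  shows "real n * \<delta>\<^sup>2 * (\<Prod>i\<in>{1..dy+dx} - J. \<delta> powr (1 / \<beta> i)) \<le> real (\<Prod>i\<in>J. N i)"
proof -
  let ?s = "\<Sum>i\<in>{1..dy+dx} - J. 1 / \<beta> i" and ?r = "real (\<Prod>i\<in>J. N i) / real n"
  have s: "?s \<ge> 0" using \<beta> by (intro sum_nonneg) (auto simp: less_imp_le)
  have "\<delta> powr (2 + ?s) \<le> (?r powr (1 / (2 + ?s))) powr (2 + ?s)"
    using \<delta> rate_le[OF J] s by (intro powr_mono2) auto
  also have "\<dots> = ?r" using s by (simp add: powr_powr del: of_nat_prod)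
  finally have "real n * \<delta> powr (2 + ?s) \<le> real (\<Prod>i\<in>J. N i)" using n by (simp add: field_simps)
  moreover have "\<delta> powr (2 + ?s) = \<delta>\<^sup>2 * (\<Prod>i\<in>{1..dy+dx} - J. \<delta> powr (1 / \<beta> i))"
    using \<delta> by (simp add: powr_add powr_sum)
  ultimately show ?thesis by (simp add: mult.assoc)
qed

text \<open>
  The widths themselves choose the relevant \<open>J\<close>: the discrete coordinates whose cells are wider than the
  smoothness requires. A number below the minimum lies below the term for this \<open>J\<close>.
\<close>

lemma sample_size_le_widths:
  assumes \<delta>: "0 < \<delta>" "\<delta> \<le> rate dy dx \<beta> N n"
    and h: "\<And>i. i \<in> {1..dy+dx} \<Longrightarrow> 0 < h i \<and>
      h i \<le> 2 * (if i \<le> dy then max (1 / real (N i)) (\<delta> powr (1 / \<beta> i)) else \<delta> powr (1 / \<beta> i))"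
  shows "real n * \<delta>\<^sup>2 * (\<Prod>i\<in>{1..dy+dx}. h i) \<le> 2 ^ (dy+dx)"
proof -
  define J where "J = {i\<in>{1..dy}. \<delta> powr (1 / \<beta> i) < 1 / real (N i)}"
  have J: "J \<subseteq> {1..dy}" by (auto simp: J_def)
  have NJ: "real (\<Prod>i\<in>J. N i) > 0"
  proof -
    have "(\<Prod>i\<in>J. N i) > 0" using N J by (intro prod_pos) (force simp: subset_iff)
    then show ?thesis by (simp del: of_nat_prod)
  qed
  have "(\<Prod>i\<in>{1..dy+dx}. h i) \<le> (\<Prod>i\<in>{1..dy+dx}. 2 * (if i \<in> J then 1 / real (N i) else \<delta> powr (1 / \<beta> i)))"
  proof (intro prod_mono)
    fix i assume i: "i \<in> {1..dy+dx}"
    show "0 \<le> h i \<and> h i \<le> 2 * (if i \<in> J then 1 / real (N i) else \<delta> powr (1 / \<beta> i))"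
      using h[OF i] i by (auto simp: J_def max_def split: if_splits)
  qed
  also have "\<dots> = 2 ^ (dy+dx) * ((\<Prod>i\<in>J. 1 / real (N i)) * (\<Prod>i\<in>{1..dy+dx} - J. \<delta> powr (1 / \<beta> i)))"
  proof -
    have "{1..dy+dx} \<inter> J = J" "{1..dy+dx} \<inter> - J = {1..dy+dx} - J" using J by auto
    then show ?thesis by (simp add: prod.distrib prod.If_cases)
  qed
  finally have "real n * \<delta>\<^sup>2 * (\<Prod>i\<in>{1..dy+dx}. h i) \<le>
     real n * \<delta>\<^sup>2 * (2 ^ (dy+dx) * ((\<Prod>i\<in>J. 1 / real (N i)) * (\<Prod>i\<in>{1..dy+dx} - J. \<delta> powr (1 / \<beta> i))))"
    by (rule mult_left_mono) simp
  also have "\<dots> = 2 ^ (dy+dx) * ((real n * \<delta>\<^sup>2 * (\<Prod>i\<in>{1..dy+dx} - J. \<delta> powr (1 / \<beta> i))) / real (\<Prod>i\<in>J. N i))"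
    by (simp add: prod_dividef)
  also have "\<dots> \<le> 2 ^ (dy+dx) * 1"
    using sample_size_le_rate[OF J \<delta>] NJ by (intro mult_left_mono) (auto simp: divide_le_eq_1)
  finally show ?thesis by simp
qed

end

section \<open>Perturbed densities\<close>

text \<open>
  In a discrete coordinate the half-width is \<open>e\<close> rounded up to a multiple of the cell width \<open>1 / N\<^sub>i\<close>. The bound
  \<open>e \<le> 1/4\<close> leaves room for at least one wave even with two support points only.
\<close>

lemma ex_well_placed:
  assumes e: "0 < e" "e \<le> 1/4" and N: "i \<le> dy \<Longrightarrow> N i \<ge> 2"
  shows "\<exists>h m. well_placed dy N i h m \<and> e \<le> h \<and> 1/4 \<le> real m * h \<and>
     h \<le> 2 * (if i \<le> dy then max (1 / real (N i)) e else e)"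
proof (cases "i \<le> dy")
  case True
  define M where "M = N i"
  have M: "M \<ge> 2" using N[OF True] by (simp add: M_def)
  define q where "q = nat \<lceil>real M * e\<rceil>"
  have Me: "0 < real M * e" "real M * e \<le> real M / 4" using e M by (auto simp: field_simps)
  have c: "real_of_int \<lceil>real M * e\<rceil> - 1 < real M * e" "real M * e \<le> real_of_int \<lceil>real M * e\<rceil>"
    using ceiling_correct[of "real M * e"] by auto
  have c1: "1 \<le> \<lceil>real M * e\<rceil>" using Me by linarith
  then have iq: "int q = \<lceil>real M * e\<rceil>" by (simp add: q_def)
  then have rq: "real q = real_of_int \<lceil>real M * e\<rceil>" by (metis of_int_of_nat_eq)
  have q1: "q \<ge> 1" using c1 unfolding iq[symmetric] by linarith
  have q_lo: "real M * e \<le> real q" and q_hi: "real q < real M * e + 1" using c rq by auto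
  have q2: "2 * q \<le> M"
  proof (cases "M < 4")
    case True
    then have "real q < 2" using q_hi Me by linarith
    then have "q < 2" by simp
    then show ?thesis using M by linarith
  next
    case False
    then have "2 * real q < real M + 1" using q_hi Me by linarith
    then show ?thesis by linarith
  qed
  define m where "m = M div (2 * q)"
  define h where "h = real q / real M"
  have m1: "m \<ge> 1" using q1 q2 by (simp add: m_def div_greater_zero_iff Suc_le_eq)
  have mq: "2 * m * q \<le> M"
    using div_times_less_eq_dividend[of M "2 * q"] by (simp add: m_def mult.assoc mult.left_commute mult.commute)
  have "M < (m + 1) * (2 * q)"
    using q1 dividend_less_div_times[of "2 * q" M] by (simp add: m_def)
  also have "\<dots> \<le> (2 * m) * (2 * q)" using m1 by (intro mult_right_mono) auto
  finally have "real M < real ((2 * m) * (2 * q))" by (simp only: of_nat_less_iff)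
  then have mh: "1/4 \<le> real m * h" using M by (simp add: h_def field_simps)
  have h0: "h > 0" using q1 M by (simp add: h_def)
  have "real (2 * m * q) \<le> real M" using mq by (simp only: of_nat_le_iff)
  then have "2 * real m * h \<le> 1" using M by (simp add: h_def field_simps)
  then have wp: "well_placed dy N i h m"
    using h0 M q1 mq by (auto simp: well_placed_def M_def[symmetric] h_def)
  have eh: "e \<le> h" using q_lo M by (simp add: h_def field_simps)
  have "h \<le> e + 1 / real M" using q_hi M by (simp add: h_def field_simps)
  then have "h \<le> 2 * max (1 / real M) e" by (simp add: max_def split: if_splits)
  then show ?thesis using True wp eh mh by (auto simp: M_def)
next
  case False
  define m where "m = nat \<lfloor>1 / (2 * e)\<rfloor>"
  have f: "real_of_int \<lfloor>1 / (2 * e)\<rfloor> \<le> 1 / (2 * e)" "1 / (2 * e) < real_of_int \<lfloor>1 / (2 * e)\<rfloor> + 1"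
    by linarith+
  have e2: "2 \<le> 1 / (2 * e)" "1 \<le> 1 / (4 * e)" using e by (auto simp: field_simps)
  then have "0 \<le> \<lfloor>1 / (2 * e)\<rfloor>" by linarith
  then have rm: "real m = real_of_int \<lfloor>1 / (2 * e)\<rfloor>" by (simp add: m_def)
  have "real m \<le> 1 / (2 * e)" using f rm by simp
  then have up: "2 * real m * e \<le> 1" using e by (simp add: field_simps)
  have "1 / (2 * e) = 1 / (4 * e) + 1 / (4 * e)" using e by (simp add: field_simps)
  then have "1 / (4 * e) \<le> real m" using f rm e2 by linarith
  then have lo: "1/4 \<le> real m * e" using e by (simp add: field_simps)
  show ?thesis using False e up lo by (intro exI[of _ e] exI[of _ m]) (auto simp: well_placed_def)
qed

lemma holder_jet_mono: "holder_jet d \<beta> L D \<Longrightarrow> L \<le> L' \<Longrightarrow> holder_jet d \<beta> L' D"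
  unfolding holder_jet_def
  by (meson mult_right_mono order_trans powr_ge_zero sum_nonneg)

lemma sum_PiE_singleton:
  fixes F :: "nat \<Rightarrow> nat \<Rightarrow> real"
  shows "(\<Sum>a\<in>PiE {1..d} (\<lambda>_. {0}). \<Prod>i\<in>{1..d}. F i (a i)) = (\<Prod>i\<in>{1..d}. F i 0)"
  using prod_sum_PiE[of "{1..d}" "\<lambda>_. {0}" F] by simp

definition base_jet :: "(nat \<Rightarrow> real \<Rightarrow> real) \<Rightarrow> real \<Rightarrow> nat \<Rightarrow> (nat \<Rightarrow> nat) \<Rightarrow> vec \<Rightarrow> real" where
  "base_jet \<psi> \<rho> d = separable_jet d (\<lambda>_. {0 :: nat}) (\<lambda>_. 1) (\<lambda>_ _. base \<psi> \<rho>)"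

definition wave_jet ::
    "(nat \<Rightarrow> real \<Rightarrow> real) \<Rightarrow> (nat \<Rightarrow> real) \<Rightarrow> (nat \<Rightarrow> nat) \<Rightarrow> real \<Rightarrow> nat \<Rightarrow> (nat \<Rightarrow> nat) set \<Rightarrow>
      (nat \<Rightarrow> nat) \<Rightarrow> vec \<Rightarrow> real" where
  "wave_jet \<psi> h m A d \<omega> =
     separable_jet d (\<lambda>i. {..<m i}) (\<lambda>a. if a \<in> \<omega> then A else 0) (\<lambda>i. wave \<psi> (h i))"

definition perturbed :: "(nat \<Rightarrow> real \<Rightarrow> real) \<Rightarrow> real \<Rightarrow> (nat \<Rightarrow> real) \<Rightarrow> (nat \<Rightarrow> nat) \<Rightarrow> real \<Rightarrow> nat \<Rightarrow>
    (nat \<Rightarrow> nat) set \<Rightarrow> vec \<Rightarrow> real" where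
  "perturbed \<psi> \<rho> h m A d \<omega> z = base_jet \<psi> \<rho> d (\<lambda>_. 0) z + wave_jet \<psi> h m A d \<omega> (\<lambda>_. 0) z"

lemma base_jet_eq: "base_jet \<psi> \<rho> d k z = (\<Prod>i\<in>{1..d}. base \<psi> \<rho> (k i) (z i))"
  unfolding base_jet_def separable_jet_def
  using sum_PiE_singleton[where d=d and F="\<lambda>i _. base \<psi> \<rho> (k i) (z i)"] by simp

context
  fixes K d :: nat and S c \<rho> A :: real and \<psi> :: "nat \<Rightarrow> real \<Rightarrow> real"
    and h :: "nat \<Rightarrow> real" and m :: "nat \<Rightarrow> nat"
  assumes bump: "bump_function K S c \<psi>" and \<rho>: "\<rho> \<ge> 3" and A: "A \<ge> 0"
    and h: "\<And>i. i \<in> {1..d} \<Longrightarrow> h i > 0"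
    and m: "\<And>i. i \<in> {1..d} \<Longrightarrow> 2 * real (m i) * h i \<le> 1"
begin

text \<open>
  The base density is smooth with constant of order \<open>\<rho> powr - d\<close>, by the choice \<open>\<delta> = 1\<close> in
  \<open>holder_jet_separable\<close>; the waves contribute \<open>A / \<delta>\<close> up to a constant.
\<close>

lemma perturbed_smooth:
  assumes \<delta>: "\<delta> > 0" and \<beta>: "\<And>i. i \<in> {1..d} \<Longrightarrow> 0 < \<beta> i \<and> \<beta> i \<le> real K"
    and h_lower: "\<And>i. i \<in> {1..d} \<Longrightarrow> \<delta> powr (1 / \<beta> i) \<le> h i"
    and L: "(2 * (S / \<rho>)) ^ d + A * (2 * S) ^ d / \<delta> \<le> L"
  shows "perturbed \<psi> \<rho> h m A d \<omega> \<in> smooth_class d \<beta> (\<lambda>_ _. L)"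
proof -
  have S: "0 \<le> S" by (rule bump_function_S_nonneg[OF bump])
  have jb: "has_jet d K (base_jet \<psi> \<rho> d)"
    unfolding base_jet_def by (intro has_jet_separable DERIV_base[OF bump])
  have jw: "has_jet d K (wave_jet \<psi> h m A d \<omega>)"
    unfolding wave_jet_def by (intro has_jet_separable DERIV_wave[OF bump])
  have hb: "holder_jet d \<beta> (1 * (2 * (S / \<rho>)) ^ d / 1) (base_jet \<psi> \<rho> d)"
    unfolding base_jet_def
  proof (rule holder_jet_separable[where h="\<lambda>_. \<rho>" and K=K])
    show "(\<Sum>a\<in>{0::nat}. \<bar>base \<psi> \<rho> k t\<bar>) \<le> S / \<rho> / \<rho> ^ k" if "k \<le> Suc K" for k t
      using abs_base_le[OF bump _ that, of \<rho> t] \<rho> by simp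
  qed (use S \<rho> \<beta> in \<open>auto intro: DERIV_base[OF bump]\<close>)
  have hw: "holder_jet d \<beta> (A * (2 * S) ^ d / \<delta>) (wave_jet \<psi> h m A d \<omega>)"
    unfolding wave_jet_def
  proof (rule holder_jet_separable[where h=h and K=K])
    show "(\<Sum>a\<in>{..<m i}. \<bar>wave \<psi> (h i) a k t\<bar>) \<le> S / h i ^ k" if "i \<in> {1..d}" "k \<le> Suc K" for i k t
      using sum_abs_wave_le[OF bump h[OF that(1)] that(2)] .
  qed (use S A \<delta> \<beta> h_lower in \<open>auto intro: DERIV_wave[OF bump]\<close>)
  have "holder_jet d \<beta> L (\<lambda>k z. base_jet \<psi> \<rho> d k z + wave_jet \<psi> h m A d \<omega> k z)"
    using L by (intro holder_jet_mono[OF holder_jet_add[OF hb hw]]) simp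
  from smooth_classI[OF has_jet_add[OF jb jw] this \<beta>]
  show ?thesis by (simp add: perturbed_def[abs_def])
qed

lemma sum_wave_products_le:
  "(\<Sum>a\<in>PiE {1..d} (\<lambda>i. {..<m i}). \<bar>\<Prod>i\<in>{1..d}. wave \<psi> (h i) (a i) 0 (z i)\<bar>)
    \<le> (S * \<rho> / c) ^ d * (\<Prod>i\<in>{1..d}. base \<psi> \<rho> 0 (z i))"
  by (rule sum_prod_PiE_le[where F="\<lambda>i a. wave \<psi> (h i) a 0" and G="\<lambda>_. base \<psi> \<rho> 0"])
     (auto intro!: waves_dominated_by_base[OF bump h m \<rho>] simp del: times_divide_eq_left)

lemma perturbed_nonneg:
  assumes small: "A * (S * \<rho> / c) ^ d \<le> 1"
  shows "0 \<le> perturbed \<psi> \<rho> h m A d \<omega> z"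
proof -
  let ?PB = "PiE {1..d} (\<lambda>i. {..<m i})" and ?g = "\<lambda>a. \<Prod>i\<in>{1..d}. wave \<psi> (h i) (a i) 0 (z i)"
  let ?b = "\<Prod>i\<in>{1..d}. base \<psi> \<rho> 0 (z i)"
  have b: "0 \<le> ?b" using base_nonneg[OF bump] \<rho> by (intro prod_nonneg) auto
  have "\<bar>wave_jet \<psi> h m A d \<omega> (\<lambda>_. 0) z\<bar> \<le> (\<Sum>a\<in>?PB. \<bar>(if a \<in> \<omega> then A else 0) * ?g a\<bar>)"
    unfolding wave_jet_def separable_jet_def by (rule sum_abs)
  also have "\<dots> \<le> (\<Sum>a\<in>?PB. A * \<bar>?g a\<bar>)" using A by (intro sum_mono) (auto simp: abs_mult)
  also have "\<dots> = A * (\<Sum>a\<in>?PB. \<bar>?g a\<bar>)" by (rule sum_distrib_left[symmetric])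
  also have "\<dots> \<le> A * ((S * \<rho> / c) ^ d * ?b)" by (intro mult_left_mono sum_wave_products_le A)
  also have "\<dots> \<le> ?b" using mult_right_mono[OF small b] by (simp add: mult.assoc)
  finally show ?thesis unfolding perturbed_def base_jet_eq by linarith
qed

lemma perturbed_density:
  assumes d: "d \<ge> 1" and small: "A * (S * \<rho> / c) ^ d \<le> 1"
  shows "perturbed \<psi> \<rho> h m A d \<omega> \<in> densities d"
proof -
  have \<rho>0: "\<rho> > 0" using \<rho> by simp
  have ib: "integrable (lborel_vec {1..d}) (base_jet \<psi> \<rho> d (\<lambda>_. 0))"
    unfolding base_jet_def using base_integrals[OF bump \<rho>0] by (intro separable_jet_integral) auto
  have iw: "integrable (lborel_vec {1..d}) (wave_jet \<psi> h m A d \<omega> (\<lambda>_. 0))"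
    unfolding wave_jet_def using wave_integrals[OF bump h] by (intro separable_jet_integral) auto
  have "(LINT z|lborel_vec {1..d}. base_jet \<psi> \<rho> d (\<lambda>_. 0) z) = 1"
    unfolding base_jet_def using base_integrals[OF bump \<rho>0]
      sum_PiE_singleton[where d=d and F="\<lambda>_ _. 1"] by (subst separable_jet_integral) auto
  moreover have "(LINT z|lborel_vec {1..d}. wave_jet \<psi> h m A d \<omega> (\<lambda>_. 0) z) = 0"
    unfolding wave_jet_def using wave_integrals[OF bump h] d
    by (subst separable_jet_integral) (auto intro!: sum.neutral prod_zero)
  ultimately have total: "(LINT z|lborel_vec {1..d}. perturbed \<psi> \<rho> h m A d \<omega> z) = 1"
    unfolding perturbed_def using ib iw by simp
  have int: "integrable (lborel_vec {1..d}) (perturbed \<psi> \<rho> h m A d \<omega>)"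
    unfolding perturbed_def[abs_def] using ib iw by simp
  have "(\<integral>\<^sup>+z. ennreal (perturbed \<psi> \<rho> h m A d \<omega> z) \<partial>lborel_vec {1..d}) = 1"
    using total perturbed_nonneg[OF small] by (subst nn_integral_eq_integral[OF int]) auto
  then show ?thesis
    unfolding densities_def using perturbed_nonneg[OF small] int by auto
qed

end

section \<open>The lower bound\<close>

text \<open>
  Here all constants are explicit. The signal strength is \<open>A = \<epsilon> \<delta>\<close>: dividing by \<open>\<delta>\<close> in the smoothness bound
  leaves \<open>\<epsilon>\<close>, which is fixed once and for all. Each discretised signal has mass \<open>\<sigma> = A (\<Prod>i. 2 h\<^sub>i)\<close> and is dominated by
  \<open>A (S \<rho> / c) ^ d\<close> times the discretised base density.
\<close>

lemma model_lower_bound: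
  fixes dy dx n K :: nat and \<beta> h :: "nat \<Rightarrow> real" and N m :: "nat \<Rightarrow> nat" and S c \<rho> \<epsilon> \<delta> L :: real
    and \<psi> :: "nat \<Rightarrow> real \<Rightarrow> real"
  defines "d \<equiv> dy + dx"
  assumes bump: "bump_function K S c \<psi>" and \<rho>: "\<rho> \<ge> 3" and d: "d \<ge> 1"
    and \<beta>: "\<And>i. i \<in> {1..d} \<Longrightarrow> 0 < \<beta> i \<and> \<beta> i \<le> real K"
    and N: "\<And>j. j \<in> {1..dy} \<Longrightarrow> N j \<ge> 2"
    and \<delta>: "0 < \<delta>" "\<delta> \<le> 1" and \<epsilon>: "0 < \<epsilon>"
    and wp: "\<And>i. i \<in> {1..d} \<Longrightarrow> well_placed dy N i (h i) (m i)"
    and h_lower: "\<And>i. i \<in> {1..d} \<Longrightarrow> \<delta> powr (1 / \<beta> i) \<le> h i"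
    and mh: "\<And>i. i \<in> {1..d} \<Longrightarrow> 1/4 \<le> real (m i) * h i"
    and L: "(2 * (S / \<rho>)) ^ d + \<epsilon> * (2 * S) ^ d \<le> L"
    and small: "\<epsilon> * (S * \<rho> / c) ^ d \<le> 1/2"
    and info: "2 * \<epsilon>\<^sup>2 * (S * \<rho> / c) ^ d * 2 ^ d * (real n * \<delta>\<^sup>2 * (\<Prod>i\<in>{1..d}. h i)) \<le> 1"
    and phat: "phat \<in> estimators dy dx N n"
  shows "\<exists>p\<in>model dy dx \<beta> L N. ennreal (1/16) \<le> emeasure (sample_law dy dx N n p)
     {s \<in> space (sample_law dy dx N n p). ennreal (\<epsilon> * \<delta> / (16 * 2 ^ d)) \<le> tv_dist dy dx N (phat s) p}"
proof -
  have h: "h i > 0" and m: "2 * real (m i) * h i \<le> 1" if "i \<in> {1..d}" for i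
    using wp[OF that] by (auto simp: well_placed_def)
  have \<rho>0: "\<rho> > 0" using \<rho> by simp
  define A where "A = \<epsilon> * \<delta>"
  have A: "A \<ge> 0" "A > 0" using \<epsilon> \<delta> by (auto simp: A_def)
  define C where "C = (S * \<rho> / c) ^ d"
  have C: "C \<ge> 0"
    unfolding C_def using bump_function_S_nonneg[OF bump] bump_facts(8)[OF bump] \<rho>
    by (intro zero_le_power divide_nonneg_pos mult_nonneg_nonneg) auto
  have AC: "A * C \<le> 1/2"
  proof -
    have "A * C = \<delta> * (\<epsilon> * C)" by (simp add: A_def)
    also have "\<dots> \<le> 1 * (\<epsilon> * C)" using \<delta> \<epsilon> C by (intro mult_right_mono) auto
    also have "\<dots> \<le> 1/2" using small by (simp add: C_def)
    finally show ?thesis .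
  qed
  let ?M = "obs_measure dy dx N" and ?w = "joined dy dx"
  define B where "B = PiE {1..d} (\<lambda>i. {..<m i})"
  have finB: "finite B" unfolding B_def by (intro finite_PiE) auto
  define p0 where "p0 w = (\<Prod>i\<in>{1..d}. observed dy N i (base \<psi> \<rho> 0) (?w w i))" for w
  define W where "W a w = (\<Prod>i\<in>{1..d}. observed dy N i (wave \<psi> (h i) (a i) 0) (?w w i))" for a w
  define g where "g a w = A * W a w" for a w
  have f_model: "discretize dy dx N (perturbed \<psi> \<rho> h m A d \<omega>) \<in> model dy dx \<beta> L N" for \<omega>
  proof -
    have "(2 * (S / \<rho>)) ^ d + A * (2 * S) ^ d / \<delta> \<le> L" using L \<delta> by (simp add: A_def)
    then have "perturbed \<psi> \<rho> h m A d \<omega> \<in> smooth_class d \<beta> (\<lambda>_ _. L)"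
      by (intro perturbed_smooth[OF bump \<rho> A(1) h m \<delta>(1) \<beta> h_lower])
    moreover have "perturbed \<psi> \<rho> h m A d \<omega> \<in> densities d"
      using AC by (intro perturbed_density[OF bump \<rho> A(1) h m d]) (simp_all add: C_def)
    ultimately show ?thesis unfolding model_def d_def by blast
  qed
  have p_eq: "discretize dy dx N (perturbed \<psi> \<rho> h m A d \<omega>) w = p0 w + (\<Sum>a\<in>\<omega>. g a w)" if \<omega>: "\<omega> \<subseteq> B" for \<omega> w
  proof -
    have ib: "integrable lborel (base \<psi> \<rho> 0)" by (rule base_integrals[OF bump \<rho>0])
    have iw: "integrable lborel (wave \<psi> (h i) a 0)" if "i \<in> {1..d}" for i a
      by (rule wave_integrals[OF bump h[OF that]])
    note sb = discretize_separable[where dy=dy and dx=dx and B="\<lambda>_. {0::nat}" and \<phi>="\<lambda>_ _. base \<psi> \<rho>"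
        and k="\<lambda>_. 0" and N=N and w=w and c="\<lambda>_. 1", OF _ ib]
    note sw = discretize_separable[where dy=dy and dx=dx and B="\<lambda>i. {..<m i}" and \<phi>="\<lambda>i. wave \<psi> (h i)"
        and k="\<lambda>_. 0" and N=N and w=w and c="\<lambda>a. if a \<in> \<omega> then A else 0", OF _ iw[unfolded d_def]]
    have "discretize dy dx N (perturbed \<psi> \<rho> h m A d \<omega>) w
      = discretize dy dx N (base_jet \<psi> \<rho> d (\<lambda>_. 0)) w + discretize dy dx N (wave_jet \<psi> h m A d \<omega> (\<lambda>_. 0)) w"
      unfolding perturbed_def[abs_def] base_jet_def wave_jet_def d_def
      by (intro discretize_add sb(1) sw(1)) auto
    also have "discretize dy dx N (base_jet \<psi> \<rho> d (\<lambda>_. 0)) w = p0 w"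
      unfolding base_jet_def d_def p0_def
      by (subst sb(2)) (use sum_PiE_singleton[where d="dy + dx" and F="\<lambda>i _. observed dy N i (base \<psi> \<rho> 0) (?w w i)"] in auto)
    also have "discretize dy dx N (wave_jet \<psi> h m A d \<omega> (\<lambda>_. 0)) w = (\<Sum>a\<in>B. (if a \<in> \<omega> then A else 0) * W a w)"
      unfolding wave_jet_def d_def W_def B_def by (subst sw(2)) auto
    also have "\<dots> = (\<Sum>a\<in>\<omega>. g a w)"
      unfolding g_def using \<omega> finB by (intro sum.mono_neutral_cong_right) auto
    finally show ?thesis .
  qed
  have obs_i: "integrable lborel (observed dy N i f)" if "integrable lborel f" "i \<in> {dy+1..dy+dx}" for i f
  proof -
    have "observed dy N i f = f" using that by (auto simp: observed_def fun_eq_iff)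
    then show ?thesis using that by simp
  qed
  have total: "coordinate_total dy N i (observed dy N i f) = (LINT t|lborel. f t)"
    if "i \<in> {1..d}" "integrable lborel f" for i f
    using N that by (intro coordinate_total_observed) auto
  have p0_int: "integrable ?M p0" "(LINT w|?M. p0 w) = 1"
  proof -
    note r = obs_integral_prod[of dy dx "\<lambda>i. observed dy N i (base \<psi> \<rho> 0)" N,
        OF obs_i[OF base_integrals(1)[OF bump \<rho>0]]]
    show "integrable ?M p0" unfolding p0_def[abs_def] d_def by (rule r(1))
    have "(LINT w|?M. p0 w) = (\<Prod>i\<in>{1..d}. coordinate_total dy N i (observed dy N i (base \<psi> \<rho> 0)))"
      unfolding p0_def d_def by (rule r(2))
    also have "\<dots> = (\<Prod>i\<in>{1..d}. 1)"
    proof (rule prod.cong[OF refl])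
      fix i assume "i \<in> {1..d}"
      then show "coordinate_total dy N i (observed dy N i (base \<psi> \<rho> 0)) = 1"
        using base_integrals[OF bump \<rho>0] by (subst total) auto
    qed
    finally show "(LINT w|?M. p0 w) = 1" by simp
  qed
  have obs_base: "0 \<le> observed dy N i (base \<psi> \<rho> 0) v" for i v
    using base_nonneg[OF bump \<rho>0]
    by (auto simp: observed_def set_lebesgue_integral_def intro!: integral_nonneg)
  have p0_nn: "0 \<le> p0 w" for w unfolding p0_def by (intro prod_nonneg obs_base ballI)
  have ow: "integrable lborel (observed dy N i (wave \<psi> (h i) (a i) 0))" if "i \<in> {dy+1..dy+dx}" for i and a :: "nat \<Rightarrow> nat"
    using that by (intro obs_i wave_integrals(1)[OF bump h]) (auto simp: d_def)
  have W_int: "integrable ?M (W a)" for a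
    unfolding W_def[abs_def] d_def by (intro obs_integral_prod(1) ow)
  have g_int: "integrable ?M (g a)" for a unfolding g_def[abs_def] by (intro integrable_mult_right W_int)
  have W0: "(LINT w|?M. W a w) = 0" for a
  proof -
    have "(LINT w|?M. W a w) = (\<Prod>i\<in>{1..d}. coordinate_total dy N i (observed dy N i (wave \<psi> (h i) (a i) 0)))"
      unfolding W_def d_def by (intro obs_integral_prod(2) ow)
    also have "\<dots> = 0"
    proof (rule prod_zero)
      have 1: "1 \<in> {1..d}" using d by simp
      have "coordinate_total dy N 1 (observed dy N 1 (wave \<psi> (h 1) (a 1) 0)) = 0"
        using wave_integrals[OF bump h[OF 1]] by (subst total[OF 1]) auto
      then show "\<exists>i\<in>{1..d}. coordinate_total dy N i (observed dy N i (wave \<psi> (h i) (a i) 0)) = 0"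
        using 1 by blast
    qed simp
    finally show ?thesis .
  qed
  define \<sigma> where "\<sigma> = A * (\<Prod>i\<in>{1..d}. 2 * h i)"
  have W_abs: "(LINT w|?M. \<bar>W a w\<bar>) = (\<Prod>i\<in>{1..d}. 2 * h i)" if a: "a \<in> B" for a
  proof -
    have "(LINT w|?M. \<bar>W a w\<bar>)
        = (LINT w|?M. (\<Prod>i\<in>{1..dy+dx}. (\<lambda>v. \<bar>observed dy N i (wave \<psi> (h i) (a i) 0) v\<bar>) (?w w i)))"
      unfolding W_def d_def abs_prod ..
    also have "\<dots> = (\<Prod>i\<in>{1..d}. coordinate_total dy N i (\<lambda>v. \<bar>observed dy N i (wave \<psi> (h i) (a i) 0) v\<bar>))"
      unfolding d_def by (intro obs_integral_prod(2) integrable_abs ow)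
    also have "\<dots> = (\<Prod>i\<in>{1..d}. 2 * h i)"
    proof (rule prod.cong[OF refl])
      fix i assume i: "i \<in> {1..d}"
      have "a i < m i" using PiE_mem[OF a[unfolded B_def] i] by simp
      then show "coordinate_total dy N i (\<lambda>v. \<bar>observed dy N i (wave \<psi> (h i) (a i) 0) v\<bar>) = 2 * h i"
        by (rule coordinate_total_abs_observed_wave[OF bump wp[OF i]])
    qed
    finally show ?thesis .
  qed
  have hpos: "(\<Prod>i\<in>{1..d}. 2 * h i) > 0" by (intro prod_pos) (use h in auto)
  have \<sigma>: "\<sigma> > 0" unfolding \<sigma>_def by (intro mult_pos_pos A(2) hpos)
  have cardB: "real (card B) = (\<Prod>i\<in>{1..d}. real (m i))" unfolding B_def by (simp add: card_PiE)
  have mpos: "real (m i) > 0" if "i \<in> {1..d}" for i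
    using mh[OF that] by (cases "m i") auto
  have "real (card B) > 0" unfolding cardB by (intro prod_pos mpos)
  then have Bne: "B \<noteq> {}" by auto
  have dom: "(\<Sum>a\<in>B. \<bar>g a w\<bar>) \<le> (A * C) * p0 w" for w
  proof -
    have "(\<Sum>a\<in>B. \<bar>W a w\<bar>) \<le> C * p0 w"
      unfolding W_def B_def C_def p0_def
    proof (rule sum_prod_PiE_le[where F="\<lambda>i a. observed dy N i (wave \<psi> (h i) a 0)"])
      fix i t assume i: "i \<in> {1..d}"
      show "(\<Sum>a\<in>{..<m i}. \<bar>observed dy N i (wave \<psi> (h i) a 0) t\<bar>) \<le> S * \<rho> / c * observed dy N i (base \<psi> \<rho> 0) t"
        by (intro sum_observed_le wave_integrals(1)[OF bump h[OF i]] base_integrals(1)[OF bump \<rho>0]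
          waves_dominated_by_base[OF bump h[OF i] m[OF i] \<rho>]) auto
    qed auto
    then have "A * (\<Sum>a\<in>B. \<bar>W a w\<bar>) \<le> A * (C * p0 w)" by (rule mult_left_mono[OF _ A(1)])
    then show ?thesis using A by (simp add: g_def abs_mult sum_distrib_left mult.assoc)
  qed
  have disj: "b = b'" if w: "w \<in> space ?M" and b: "b \<in> B" "b' \<in> B" and nz: "g b w \<noteq> 0" "g b' w \<noteq> 0" for w b b'
  proof (rule PiE_ext[OF b[unfolded B_def]])
    fix i assume i: "i \<in> {1..d}"
    have nz': "observed dy N i (wave \<psi> (h i) (b i) 0) (?w w i) \<noteq> 0"
      "observed dy N i (wave \<psi> (h i) (b' i) 0) (?w w i) \<noteq> 0"
      using nz i by (auto simp: g_def W_def)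
    have v: "?w w i \<in> support_points1 (N i)" if "i \<le> dy"
    proof -
      have "fst w \<in> support_points dy N" using w by (auto simp: obs_measure_def space_pair_measure)
      then have "fst w i \<in> support_points1 (N i)"
        using i that PiE_mem[of "fst w" "{1..dy}" "\<lambda>j. support_points1 (N j)" i]
        by (simp add: support_points_def)
      then show ?thesis using i that by (cases w) (simp add: merge_def)
    qed
    have lt: "b i < m i" "b' i < m i"
      using PiE_mem[OF b(1)[unfolded B_def] i] PiE_mem[OF b(2)[unfolded B_def] i] by simp_all
    show "b i = b' i"
      by (rule observed_wave_disjoint[OF bump wp[OF i] _ _ _ nz']) (use v lt in auto)
  qed
  have info': "real n * (2 * (A * C) * \<sigma>) \<le> 1"
  proof -
    have "real n * (2 * (A * C) * \<sigma>) = 2 * \<epsilon>\<^sup>2 * C * 2 ^ d * (real n * \<delta>\<^sup>2 * (\<Prod>i\<in>{1..d}. h i))"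
      by (simp add: \<sigma>_def A_def prod.distrib power2_eq_square)
    also have "\<dots> \<le> 1" using info unfolding C_def .
    finally show ?thesis .
  qed
  have thr: "\<epsilon> * \<delta> / (16 * 2 ^ d) \<le> real (card B) * \<sigma> / 16"
  proof -
    have "(1/2) ^ d = (\<Prod>i\<in>{1..d}. 1/2 :: real)" by simp
    also have "\<dots> \<le> (\<Prod>i\<in>{1..d}. 2 * (real (m i) * h i))"
      using mh by (intro prod_mono) force
    also have "\<dots> = real (card B) * (\<Prod>i\<in>{1..d}. 2 * h i)"
      unfolding cardB prod.distrib[symmetric] by (intro prod.cong) auto
    finally have "A * (1/2) ^ d \<le> A * (real (card B) * (\<Prod>i\<in>{1..d}. 2 * h i))"
      by (rule mult_left_mono[OF _ A(1)])
    then show ?thesis by (simp add: \<sigma>_def A_def power_divide mult.commute mult.left_commute)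
  qed
  have ph: "(\<lambda>(s, w). phat s w) \<in> borel_measurable (PiM {1..n} (\<lambda>_. ?M) \<Otimes>\<^sub>M ?M)"
    using phat by (simp add: estimators_def)
  have "\<exists>\<omega>\<subseteq>B. ennreal (1/16) \<le> emeasure (PiM {1..n} (\<lambda>_. density ?M (\<lambda>w. ennreal (p0 w + (\<Sum>b\<in>\<omega>. g b w)))))
     {s \<in> space (PiM {1..n} (\<lambda>_. density ?M (\<lambda>w. ennreal (p0 w + (\<Sum>b\<in>\<omega>. g b w))))).
        ennreal (\<epsilon> * \<delta> / (16 * 2 ^ d)) \<le> (\<integral>\<^sup>+w. ennreal \<bar>phat s w - (p0 w + (\<Sum>b\<in>\<omega>. g b w))\<bar> \<partial>?M)}"
  proof (rule assouad_in_probability[where \<kappa>="A * C" and \<sigma>=\<sigma>])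
    show "(LINT w|?M. g b w) = 0" for b by (simp add: g_def W0)
    show "(LINT w|?M. \<bar>g b w\<bar>) = \<sigma>" if "b \<in> B" for b
      using W_abs[OF that] A by (simp add: g_def abs_mult \<sigma>_def)
    show "b = b'" if "w \<in> space ?M" "b \<in> B" "b' \<in> B" "g b w \<noteq> 0" "g b' w \<noteq> 0" for b b' w
      using that by (rule disj)
    show "0 \<le> A * C" by (rule mult_nonneg_nonneg[OF A(1) C])
  qed (rule sigma_finite_obs_measure finB Bne p0_int p0_nn g_int dom AC \<sigma> info' thr ph)+
  then obtain \<omega> where \<omega>: "\<omega> \<subseteq> B" and
    lower: "ennreal (1/16) \<le> emeasure (PiM {1..n} (\<lambda>_. density ?M (\<lambda>w. ennreal (p0 w + (\<Sum>b\<in>\<omega>. g b w)))))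
     {s \<in> space (PiM {1..n} (\<lambda>_. density ?M (\<lambda>w. ennreal (p0 w + (\<Sum>b\<in>\<omega>. g b w))))).
        ennreal (\<epsilon> * \<delta> / (16 * 2 ^ d)) \<le> (\<integral>\<^sup>+w. ennreal \<bar>phat s w - (p0 w + (\<Sum>b\<in>\<omega>. g b w))\<bar> \<partial>?M)}"
    by blast
  define p where "p = discretize dy dx N (perturbed \<psi> \<rho> h m A d \<omega>)"
  have p: "p = (\<lambda>w. p0 w + (\<Sum>b\<in>\<omega>. g b w))" unfolding p_def using p_eq[OF \<omega>] by (rule ext)
  have pm: "p \<in> borel_measurable ?M"
    unfolding p using p0_int g_int by (intro borel_measurable_add borel_measurable_sum borel_measurable_integrable)
  have law: "sample_law dy dx N n p = PiM {1..n} (\<lambda>_. density ?M (\<lambda>w. ennreal (p0 w + (\<Sum>b\<in>\<omega>. g b w))))"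
    unfolding sample_law_def p ..
  have "{s \<in> space (sample_law dy dx N n p). ennreal (\<epsilon> * \<delta> / (16 * 2 ^ d)) \<le> tv_dist dy dx N (phat s) p}
    = {s \<in> space (sample_law dy dx N n p). ennreal (\<epsilon> * \<delta> / (16 * 2 ^ d))
        \<le> (\<integral>\<^sup>+w. ennreal \<bar>phat s w - (p0 w + (\<Sum>b\<in>\<omega>. g b w))\<bar> \<partial>?M)}"
  proof (rule Collect_cong, rule conj_cong[OF refl])
    fix s assume "s \<in> space (sample_law dy dx N n p)"
    then have s: "s \<in> space (PiM {1..n} (\<lambda>_. ?M))" by (simp add: sample_law_def space_PiM)
    have "phat s \<in> borel_measurable ?M"
      using measurable_compose[OF measurable_Pair1'[OF s] ph] by simp
    from tv_dist_eq_nn_integral[OF this pm]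
    show "(ennreal (\<epsilon> * \<delta> / (16 * 2 ^ d)) \<le> tv_dist dy dx N (phat s) p) =
      (ennreal (\<epsilon> * \<delta> / (16 * 2 ^ d)) \<le> (\<integral>\<^sup>+w. ennreal \<bar>phat s w - (p0 w + (\<Sum>b\<in>\<omega>. g b w))\<bar> \<partial>?M))"
      by (simp only: p)
  qed
  then have "ennreal (1/16) \<le> emeasure (sample_law dy dx N n p)
     {s \<in> space (sample_law dy dx N n p). ennreal (\<epsilon> * \<delta> / (16 * 2 ^ d)) \<le> tv_dist dy dx N (phat s) p}"
    using lower by (simp only: law)
  moreover have "p \<in> model dy dx \<beta> L N" unfolding p_def by (rule f_model)
  ultimately show ?thesis by blast
qed

theorem theorem3p1:
  fixes dy dx :: nat and \<beta> :: "nat \<Rightarrow> real" and L :: real and N :: "nat \<Rightarrow> nat \<Rightarrow> nat"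
  assumes "dy + dx \<ge> 1"
    and "L > 0"
    and "\<And>i. i \<in> {1..dy+dx} \<Longrightarrow> \<beta> i > 0"
    and "\<And>n j. n \<ge> 1 \<Longrightarrow> j \<in> {1..dy} \<Longrightarrow> N n j \<ge> 2"
  shows "\<exists>c::real. \<exists>c'::real. c > 0 \<and> c' > 0 \<and>
    (\<forall>n\<ge>1. (INF phat\<in>estimators dy dx (N n) n. SUP p\<in>model dy dx \<beta> L (N n).
        emeasure (sample_law dy dx (N n) n p)
          {s \<in> space (sample_law dy dx (N n) n p).
             tv_dist dy dx (N n) (phat s) p \<ge> ennreal (c * rate dy dx \<beta> (N n) n)})
      \<ge> ennreal c')"
proof -
  define d where "d = dy + dx"
  have d: "d \<ge> 1" and \<beta>: "\<And>i. i \<in> {1..d} \<Longrightarrow> \<beta> i > 0" using assms by (auto simp: d_def)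
  define b where "b = (\<Sum>i\<in>{1..d}. \<beta> i)"
  define K where "K = nat \<lceil>b\<rceil>"
  have \<beta>b: "\<beta> i \<le> b" if "i \<in> {1..d}" for i
    unfolding b_def using that \<beta> by (intro member_le_sum) (auto simp: less_imp_le)
  have bK: "b \<le> real K" unfolding K_def by linarith
  have \<beta>K: "0 < \<beta> i \<and> \<beta> i \<le> real K" if "i \<in> {1..d}" for i
    using \<beta>[OF that] \<beta>b[OF that] bK by linarith
  obtain S c \<psi> where bump: "bump_function K S c \<psi>" using ex_bump_function by blast
  have c: "c > 0" by (rule bump_facts(8)[OF bump])
  have "c \<le> \<psi> 0 (1/2)" by (rule bump_facts(5)[OF bump]) auto
  also have "\<dots> \<le> S" using bump_facts(3)[OF bump, of 0 "1/2"] by simp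
  finally have S: "S > 0" using c by simp
  \<comment> \<open>\<open>\<rho>\<close> is so large that the base density uses up at most half of the smoothness constant \<open>L\<close>\<close>
  define x where "x = min 1 (L / 2)"
  have x: "0 < x" "x \<le> 1" "x \<le> L / 2" using assms(2) by (auto simp: x_def)
  define \<rho> where "\<rho> = max 3 (2 * S / x)"
  have \<rho>: "\<rho> \<ge> 3" by (simp add: \<rho>_def)
  have "2 * S / x \<le> \<rho>" by (simp add: \<rho>_def)
  then have "2 * (S / \<rho>) \<le> x" using x \<rho> by (simp add: field_simps)
  then have "(2 * (S / \<rho>)) ^ d \<le> x ^ d" using S \<rho> by (intro power_mono) auto
  also have "\<dots> \<le> x ^ 1" using x d by (intro power_decreasing) auto
  finally have L1: "(2 * (S / \<rho>)) ^ d \<le> L / 2" using x by simp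
  define C where "C = (S * \<rho> / c) ^ d"
  have C: "C > 0" unfolding C_def using S \<rho> c by (intro zero_less_power divide_pos_pos mult_pos_pos) auto
  \<comment> \<open>the second entry reserves the other half of \<open>L\<close> for the waves, the third makes a single signal hard to detect\<close>
  define \<epsilon> where "\<epsilon> = min 1 (min (L / (2 * (2 * S) ^ d)) (1 / (2 * C * 4 ^ d)))"
  have \<epsilon>: "\<epsilon> > 0" "\<epsilon> \<le> 1" using assms(2) S C by (auto simp: \<epsilon>_def)
  have "\<epsilon> \<le> L / (2 * (2 * S) ^ d)" by (simp add: \<epsilon>_def)
  then have L2: "\<epsilon> * (2 * S) ^ d \<le> L / 2" using S by (simp add: field_simps)
  have "\<epsilon> \<le> 1 / (2 * C * 4 ^ d)" by (simp add: \<epsilon>_def)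
  then have \<epsilon>C: "\<epsilon> * (2 * C * 4 ^ d) \<le> 1" using C by (simp add: field_simps)
  have small: "\<epsilon> * C \<le> 1/2"
  proof -
    have "\<epsilon> * (2 * C) * 1 \<le> \<epsilon> * (2 * C) * 4 ^ d"
      using \<epsilon> C one_le_power[of "4::real" d] by (intro mult_left_mono) auto
    also have "\<dots> = \<epsilon> * (2 * C * 4 ^ d)" by (simp only: mult.assoc)
    also note \<epsilon>C
    finally show ?thesis by simp
  qed
  \<comment> \<open>this factor makes \<open>\<delta> powr (1 / \<beta> i) \<le> 1/4\<close> in every coordinate, since \<open>b \<ge> \<beta> i\<close>\<close>
  define \<gamma> where "\<gamma> = (1/4 :: real) powr b"
  have \<gamma>: "0 < \<gamma>" "\<gamma> \<le> 1"
  proof -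
    have "0 \<le> b" unfolding b_def using \<beta> by (intro sum_nonneg) (auto simp: less_imp_le)
    then have "(1/4 :: real) powr b \<le> (1/4) powr 0" by (intro powr_mono') auto
    then show "0 < \<gamma>" "\<gamma> \<le> 1" by (auto simp: \<gamma>_def)
  qed
  have \<gamma>\<beta>: "\<gamma> powr (1 / \<beta> i) \<le> 1/4" if i: "i \<in> {1..d}" for i
  proof -
    have "1 \<le> b / \<beta> i" using \<beta>b[OF i] \<beta>[OF i] by simp
    then have "(1/4 :: real) powr (b / \<beta> i) \<le> (1/4) powr 1" by (intro powr_mono') auto
    then show ?thesis by (simp add: \<gamma>_def powr_powr)
  qed
  have main: "ennreal (1/16) \<le> (INF phat\<in>estimators dy dx (N n) n. SUP p\<in>model dy dx \<beta> L (N n).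
        emeasure (sample_law dy dx (N n) n p)
          {s \<in> space (sample_law dy dx (N n) n p).
             tv_dist dy dx (N n) (phat s) p \<ge> ennreal (\<epsilon> * \<gamma> / (16 * 2 ^ d) * rate dy dx \<beta> (N n) n)})"
    if n: "n \<ge> 1" for n
  proof (rule INF_greatest)
    fix phat assume phat: "phat \<in> estimators dy dx (N n) n"
    have Nn: "N n j \<ge> 2" if "j \<in> {1..dy}" for j using assms(4)[OF n that] .
    have \<beta>': "\<And>i. i \<in> {1..dy+dx} \<Longrightarrow> \<beta> i > 0" using assms(3) .
    let ?r = "rate dy dx \<beta> (N n) n"
    have r: "0 < ?r" "?r \<le> 1" using rate_pos[OF \<beta>' Nn n] rate_le_1[OF \<beta>' Nn n] by auto
    define \<delta> where "\<delta> = \<gamma> * ?r"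
    have "0 < \<delta>" "\<delta> \<le> ?r" using \<gamma> r by (auto simp: \<delta>_def)
    then have \<delta>: "0 < \<delta>" "\<delta> \<le> ?r" "\<delta> \<le> 1" using r by auto
    have \<delta>\<beta>: "\<delta> powr (1 / \<beta> i) \<le> 1/4" if i: "i \<in> {1..d}" for i
    proof -
      have "\<delta> \<le> \<gamma>" using \<gamma> r by (simp add: \<delta>_def mult_left_le)
      then have "\<delta> powr (1 / \<beta> i) \<le> \<gamma> powr (1 / \<beta> i)" using \<delta> \<beta>[OF i] by (intro powr_mono2) auto
      then show ?thesis using \<gamma>\<beta>[OF i] by linarith
    qed
    have "\<exists>h m. well_placed dy (N n) i h m \<and> \<delta> powr (1 / \<beta> i) \<le> h \<and> 1/4 \<le> real m * h \<and>
       h \<le> 2 * (if i \<le> dy then max (1 / real (N n i)) (\<delta> powr (1 / \<beta> i)) else \<delta> powr (1 / \<beta> i))"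
      if i: "i \<in> {1..d}" for i
      using \<delta> \<delta>\<beta>[OF i] Nn i by (intro ex_well_placed) auto
    then obtain h m where hm: "\<And>i. i \<in> {1..d} \<Longrightarrow> well_placed dy (N n) i (h i) (m i) \<and> \<delta> powr (1 / \<beta> i) \<le> h i \<and>
       1/4 \<le> real (m i) * h i \<and>
       h i \<le> 2 * (if i \<le> dy then max (1 / real (N n i)) (\<delta> powr (1 / \<beta> i)) else \<delta> powr (1 / \<beta> i))"
      by metis
    have "real n * \<delta>\<^sup>2 * (\<Prod>i\<in>{1..d}. h i) \<le> 2 ^ d"
      unfolding d_def
    proof (rule sample_size_le_widths[OF \<beta>' Nn n \<delta>(1,2)])
      fix i assume i: "i \<in> {1..dy+dx}"
      then show "0 < h i \<and> h i \<le> 2 * (if i \<le> dy then max (1 / real (N n i)) (\<delta> powr (1 / \<beta> i)) else \<delta> powr (1 / \<beta> i))"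
        using hm[of i] by (simp add: well_placed_def d_def)
    qed
    then have "2 * \<epsilon>\<^sup>2 * C * 2 ^ d * (real n * \<delta>\<^sup>2 * (\<Prod>i\<in>{1..d}. h i)) \<le> 2 * \<epsilon>\<^sup>2 * C * 2 ^ d * 2 ^ d"
      using C by (intro mult_left_mono) auto
    also have "\<dots> = \<epsilon> * (\<epsilon> * (2 * C * 4 ^ d))"
      by (simp add: power2_eq_square power_mult_distrib[symmetric])
    also have "\<dots> \<le> 1 * 1" using \<epsilon> \<epsilon>C C by (intro mult_mono) auto
    finally have info: "2 * \<epsilon>\<^sup>2 * C * 2 ^ d * (real n * \<delta>\<^sup>2 * (\<Prod>i\<in>{1..d}. h i)) \<le> 1" by simp
    have "\<exists>p\<in>model dy dx \<beta> L (N n). ennreal (1/16) \<le> emeasure (sample_law dy dx (N n) n p)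
     {s \<in> space (sample_law dy dx (N n) n p).
       ennreal (\<epsilon> * \<delta> / (16 * 2 ^ (dy + dx))) \<le> tv_dist dy dx (N n) (phat s) p}"
      using bump \<rho> d \<beta>K Nn \<delta> \<epsilon> hm L1 L2 small info phat unfolding C_def d_def
      by (intro model_lower_bound[where K=K and S=S and c=c and \<psi>=\<psi> and h=h and m=m and \<rho>=\<rho> and \<epsilon>=\<epsilon> and \<delta>=\<delta>]) auto
    then obtain p where p: "p \<in> model dy dx \<beta> L (N n)" "ennreal (1/16) \<le> emeasure (sample_law dy dx (N n) n p)
     {s \<in> space (sample_law dy dx (N n) n p).
       ennreal (\<epsilon> * \<gamma> / (16 * 2 ^ d) * ?r) \<le> tv_dist dy dx (N n) (phat s) p}"
      by (auto simp: \<delta>_def d_def mult.assoc)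
    then show "ennreal (1/16) \<le> (SUP p\<in>model dy dx \<beta> L (N n).
        emeasure (sample_law dy dx (N n) n p)
          {s \<in> space (sample_law dy dx (N n) n p).
             tv_dist dy dx (N n) (phat s) p \<ge> ennreal (\<epsilon> * \<gamma> / (16 * 2 ^ d) * ?r)})"
      by (intro SUP_upper2)
  qed
  show ?thesis
    using main \<epsilon> \<gamma> by (intro exI[of _ "\<epsilon> * \<gamma> / (16 * 2 ^ d)"] exI[of _ "1/16"]) auto
qed

end
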